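(* Let $n\in\mathbb{N}$, $0<\beta\le n$, $0<\alpha<\beta$, and assume $\beta\in(n-\alpha,n]$. Let $b$ be a measurable function in $\operatorname{BMO}^\beta(\mathbb{R}^n)$. Define $B(t)=t\log(e+t)$ and $\Psi(t)=[t\log(e+t^{\alpha/\beta})]^{\beta/(\beta-\alpha)}$. Then there exists $C=C(\alpha,\beta,n)>0$ such that for every bounded measurable function $f$ with compact support and all $t>0$, \[ \mathcal{H}^\beta_\infty\big(\{x\in\mathbb{R}^n:|[b,I_\alpha]f(x)|>t\}\big)\le C\,\Psi\Big(\int_{\mathbb{R}^n}B\Big(\|b\|_{\operatorname{BMO}^\beta(\mathbb{R}^n)}\frac{|f(x)|}{t}\Big)\,d\mathcal{H}^\beta_\infty\Big). \]
   Context: For $0<\beta\le n$, $\mathcal{H}^\beta_\infty(E)=\inf\{\sum_i\omega_\beta r_i^\beta:E\subset\bigcup_iB(x_i,r_i)\}$, $\omega_\beta=\pi^{\beta/2}/\Gamma(\beta/2+1)$. Integrals with respect to $\mathcal{H}^\beta_\infty$ are Choquet integrals: $\int_\Omega g\,d\mathcal{H}^\beta_\infty=\int_0^\infty\mathcal{H}^\beta_\infty(\{x\in\Omega:g(x)>s\})\,ds$ for $g\ge0$. Cubes have sides parallel to the axes, $\ell(Q)$ is the side length. $\|b\|_{\operatorname{BMO}^\beta(\mathbb{R}^n)}=\sup_Q\inf_{c\in\mathbb{R}}\ell(Q)^{-\beta}\int_Q|b-c|\,d\mathcal{H}^\beta_\infty$, and $\operatorname{BMO}^\beta(\mathbb{R}^n)$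 consists of functions for which this is finite. $I_\alpha f(x)=\int_{\mathbb{R}^n}f(y)|x-y|^{\alpha-n}\,dy$, $[b,I_\alpha]f=b\,I_\alpha f-I_\alpha(bf)$. *)

theory Defs
  imports "HOL-Analysis.Analysis"
begin

definition omega :: "real \<Rightarrow> real" where
  "omega \<beta> = pi powr (\<beta> / 2) / Gamma (\<beta> / 2 + 1)"

text \<open>Hausdorff content H^beta_infty: infimum over countable covers by balls
  (radius 0 gives the empty ball, so finite covers are included).\<close>
definition hcontent :: "real \<Rightarrow> 'a::euclidean_space set \<Rightarrow> ennreal" where
  "hcontent \<beta> E = (INF cr \<in> {(c, r). (\<forall>i::nat. 0 \<le> r i) \<and> E \<subseteq> (\<Union>i. ball (c i) (r i))}.
       (\<Sum>i. ennreal (omega \<beta> * (snd cr i) powr \<beta>)))"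

definition choquet :: "real \<Rightarrow> 'a::euclidean_space set \<Rightarrow> ('a \<Rightarrow> real) \<Rightarrow> ennreal" where
  "choquet \<beta> \<Omega> g = (\<integral>\<^sup>+ s. indicator {0<..} s * hcontent \<beta> {x \<in> \<Omega>. g x > s} \<partial>lborel)"

definition cube :: "'a::euclidean_space \<Rightarrow> real \<Rightarrow> 'a set" where
  "cube a l = cbox a (a + l *\<^sub>R One)"

definition bmo_norm :: "real \<Rightarrow> ('a::euclidean_space \<Rightarrow> real) \<Rightarrow> ennreal" where
  "bmo_norm \<beta> b = (SUP al \<in> {(a, l). (l::real) > 0}.
       (INF c::real. ennreal (snd al powr (- \<beta>)) *
          choquet \<beta> (cube (fst al) (snd al)) (\<lambda>x. \<bar>b x - c\<bar>)))"

definition riesz :: "real \<Rightarrow> ('a::euclidean_space \<Rightarrow> real) \<Rightarrow> 'a \<Rightarrow> real" where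
  "riesz \<alpha> f x = (\<integral>y. f y * norm (x - y) powr (\<alpha> - real DIM('a)) \<partial>lebesgue)"

definition commutator :: "('a::euclidean_space \<Rightarrow> real) \<Rightarrow> real \<Rightarrow> ('a \<Rightarrow> real) \<Rightarrow> 'a \<Rightarrow> real" where
  "commutator b \<alpha> f x = b x * riesz \<alpha> f x - riesz \<alpha> (\<lambda>y. b y * f y) x"

definition Bfun :: "real \<Rightarrow> real" where
  "Bfun t = t * ln (exp 1 + t)"

definition Psi :: "real \<Rightarrow> real \<Rightarrow> real \<Rightarrow> real" where
  "Psi \<alpha> \<beta> t = (t * ln (exp 1 + t powr (\<alpha> / \<beta>))) powr (\<beta> / (\<beta> - \<alpha>))"

definition Psi_e :: "real \<Rightarrow> real \<Rightarrow> ennreal \<Rightarrow> ennreal" where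
  "Psi_e \<alpha> \<beta> I = (if I = \<infinity> then \<infinity> else ennreal (Psi \<alpha> \<beta> (enn2real I)))"

end

theory Submission
  imports Defs
begin

text \<open>After normalising \<open>b\<close> and \<open>t\<close>, bound the commutator at \<open>x\<close> by the sum over all dyadic scales of the local
  integrals of \<open>\<bar>b x - b y\<bar> * \<bar>f y\<bar>\<close>, and split \<open>\<bar>b x - b y\<bar> \<le> \<bar>b x - c\<bar> + \<bar>b y - c\<bar>\<close> with \<open>c\<close> a mean value of \<open>b\<close>
  on the dyadic cube around \<open>x\<close>. Fix a scale \<open>\<delta>\<close> whose power \<open>\<delta>\<^sup>\<beta>\<close> is comparable to \<open>\<Psi>\<close> of the Choquet integral of
  \<open>B(\<bar>f\<bar>)\<close>. Outside a set of content at most a multiple of \<open>\<delta>\<^sup>\<beta>\<close>, a weak type inequality makes the averages of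
  \<open>B(\<bar>f\<bar>)\<close> over cubes of side \<open>l\<close> decay geometrically in \<open>\<bar>log (l / \<delta>)\<bar>\<close>, relative to \<open>l\<close> to the power \<open>- \<alpha>\<close>.

  The part with \<open>\<bar>b y - c\<bar>\<close> is then summed by Young's inequality and the John--Nirenberg inequality. For the part with
  \<open>\<bar>b x - c\<bar>\<close> the sets where \<open>\<bar>b - c\<bar>\<close> is large must be discarded, but their contents cannot be summed over all
  cubes of a given size when \<open>\<beta> < n\<close>. They can be summed over the cubes whose mass of \<open>f\<close> is not dominated
  by an ancestor at the rate \<open>\<beta>\<close>; passing from an arbitrary cube to a dominating ancestor costs a logarithm of the ratio
  of the sides, and \<open>\<beta> > n - \<alpha>\<close> provides a geometric gain that absorbs it.\<close>

subsection \<open>Dyadic cubes\<close>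

text \<open>The Choquet integral is not additive. For f it is therefore traded once for dyadic
  covers of the sets \<open>{h > 2^j}\<close>, h = B(|f|), whose weighted total N is comparable to
  it; afterwards only sums over cubes and Lebesgue integrals occur, and sums in [0, \<infinity>] may
  be exchanged freely.

  The scale \<delta> is dictated by N log(e + \<delta>^\<alpha>) \<le> \<delta>^(\<beta>-\<alpha>).
  For sides l above \<delta> the total alone bounds the mass of a cube by N l^(n-\<beta>), below
  \<delta> the maximal inequality is better, and the two meet at \<delta>. The extra logarithm is
  what Young's inequality consumes, and solving for \<delta>^\<beta> produces \<Psi>.

  The obstacle for |b x - c| is a count: a cube of side l contains (l/r)^n cubes of side r, whereas
  the content of a set pays for only (l/r)^\<beta> of them. A family of cubes whose exceptional sets
  are added up must obey the smaller count, and this forces the selection of special cubes.\<close>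

abbreviation csum :: "'b set \<Rightarrow> ('b \<Rightarrow> ennreal) \<Rightarrow> ennreal" where
  "csum A f \<equiv> integral\<^sup>N (count_space A) f"

text \<open>The exponent is kept as a product so that \<open>powr_add\<close> merges powers of sides
  that belong to different dimensions and levels.\<close>

abbreviation side_pow :: "int \<Rightarrow> real \<Rightarrow> real" where
  "side_pow k s \<equiv> 2 powr (real_of_int k * s)"

text \<open>Fixing the integer parts of the rescaled coordinates yields half-open cubes and makes
  lying in a common cube an equivalence relation, so the cubes of one level partition the space
  without boundary cases.\<close>

definition dyadic_cube :: "int \<Rightarrow> 'a::euclidean_space \<Rightarrow> 'a set" where
  "dyadic_cube k x = {y. \<forall>i\<in>Basis. \<lfloor>(y \<bullet> i) * 2 powr - real_of_int k\<rfloor> = \<lfloor>(x \<bullet> i) * 2 powr - real_of_int k\<rfloor>}"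

text \<open>The dyadic substitute for the threefold dilation of a cube. Unlike the single cube of x
  it contains a whole ball around x, and it still grows with the level.\<close>

definition dyadic_nbhd :: "int \<Rightarrow> 'a::euclidean_space \<Rightarrow> 'a set" where
  "dyadic_nbhd k x = {y. \<forall>i\<in>Basis. \<bar>\<lfloor>(y \<bullet> i) * 2 powr - real_of_int k\<rfloor> - \<lfloor>(x \<bullet> i) * 2 powr - real_of_int k\<rfloor>\<bar> \<le> 1}"

definition dyadic_corner :: "int \<Rightarrow> 'a::euclidean_space \<Rightarrow> 'a" where
  "dyadic_corner k x = (\<Sum>i\<in>Basis. (2 powr real_of_int k * \<lfloor>(x \<bullet> i) * 2 powr - real_of_int k\<rfloor>) *\<^sub>R i)"

text \<open>The level is stored next to the set, so that the side length can be read off from the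
  pair.\<close>

definition dyadics :: "(int \<times> 'a::euclidean_space set) set" where
  "dyadics = (\<Union>k. \<Union>x. {(k, dyadic_cube k x)})"

text \<open>Passing to the parent halves the integer coordinates, which turns the nesting of cubes
  and of neighbourhoods into integer arithmetic.\<close>

lemma floor_dyadic_Suc:
  "\<lfloor>(x::real) * 2 powr - real_of_int (k + 1)\<rfloor> = \<lfloor>x * 2 powr - real_of_int k\<rfloor> div 2"
proof -
  have "x * 2 powr - real_of_int (k + 1) = (x * 2 powr - real_of_int k) / real_of_int 2"
    by (simp add: powr_add powr_minus powr_diff divide_simps)
  then show ?thesis
    by (metis floor_divide_real_eq_div zero_le_numeral)
qed

lemma dyadic_cube_self [simp]: "x \<in> dyadic_cube k x"
  by (simp add: dyadic_cube_def)

lemma dyadic_cube_eq: "y \<in> dyadic_cube k x \<Longrightarrow> dyadic_cube k y = dyadic_cube k x"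
  by (auto simp: dyadic_cube_def)

lemma dyadic_nbhd_sym: "y \<in> dyadic_nbhd k x \<longleftrightarrow> x \<in> dyadic_nbhd k y"
  by (auto simp: dyadic_nbhd_def abs_minus_commute)

lemma dyadic_cube_subset_nbhd: "dyadic_cube k x \<subseteq> dyadic_nbhd k x"
  by (auto simp: dyadic_cube_def dyadic_nbhd_def)

lemma dyadic_nbhd_cong: "y \<in> dyadic_cube k x \<Longrightarrow> dyadic_nbhd k y = dyadic_nbhd k x"
  by (auto simp: dyadic_cube_def dyadic_nbhd_def)

lemma dyadic_cube_subset_nbhd': "y \<in> dyadic_nbhd k x \<Longrightarrow> dyadic_cube k y \<subseteq> dyadic_nbhd k x"
  by (auto simp: dyadic_cube_def dyadic_nbhd_def)

lemma dyadic_mono_Suc: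
  "dyadic_cube k x \<subseteq> dyadic_cube (k + 1) x" "dyadic_nbhd k x \<subseteq> dyadic_nbhd (k + 1) x"
proof -
  show "dyadic_cube k x \<subseteq> dyadic_cube (k + 1) x"
    unfolding dyadic_cube_def floor_dyadic_Suc by auto
  have "\<bar>a - b\<bar> \<le> 1 \<Longrightarrow> \<bar>a div 2 - b div 2\<bar> \<le> 1" for a b :: int by linarith
  then show "dyadic_nbhd k x \<subseteq> dyadic_nbhd (k + 1) x"
    unfolding dyadic_nbhd_def floor_dyadic_Suc by auto
qed

lemma dyadic_cube_mono: "k \<le> m \<Longrightarrow> dyadic_cube k x \<subseteq> dyadic_cube m x"
  by (induction m rule: int_ge_induct) (use dyadic_mono_Suc in blast)+

lemma dyadic_nbhd_mono: "k \<le> m \<Longrightarrow> dyadic_nbhd k x \<subseteq> dyadic_nbhd m x"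
  by (induction m rule: int_ge_induct) (use dyadic_mono_Suc in blast)+

lemma dyadic_cube_subset: "k \<le> m \<Longrightarrow> y \<in> dyadic_cube m x \<Longrightarrow> dyadic_cube k y \<subseteq> dyadic_cube m x"
  using dyadic_cube_mono dyadic_cube_eq by blast

lemma ball_subset_dyadic_nbhd: "ball x (2 powr real_of_int k) \<subseteq> dyadic_nbhd k x"
proof
  fix y assume "y \<in> ball x (2 powr real_of_int k)"
  then have d: "norm (y - x) < 2 powr k" by (simp add: dist_norm norm_minus_commute)
  show "y \<in> dyadic_nbhd k x" unfolding dyadic_nbhd_def
  proof (clarify)
    fix i :: 'a assume i: "i \<in> Basis"
    define u where "u = (y \<bullet> i) * 2 powr - real_of_int k"
    define v where "v = (x \<bullet> i) * 2 powr - real_of_int k"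
    have "\<bar>u - v\<bar> = \<bar>(y - x) \<bullet> i\<bar> * 2 powr - real_of_int k"
      by (simp add: u_def v_def inner_diff_left abs_mult flip: left_diff_distrib)
    also have "\<dots> < 2 powr k * 2 powr - real_of_int k"
      using Basis_le_norm[OF i, of "y - x"] d by (intro mult_strict_right_mono) auto
    also have "\<dots> = 1" by (simp flip: powr_add)
    finally show "\<bar>\<lfloor>u\<rfloor> - \<lfloor>v\<rfloor>\<bar> \<le> 1" by linarith
  qed
qed

lemma dyadic_floor_bounds:
  fixes u :: real and k z :: int
  shows "\<lfloor>u * 2 powr - real_of_int k\<rfloor> = z \<longleftrightarrow> 2 powr k * z \<le> u \<and> u < 2 powr k * z + 2 powr k"
proof -
  have e: "2 powr - real_of_int k = 1 / 2 powr k" by (simp add: powr_minus_divide)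
  show ?thesis unfolding e floor_eq_iff by (auto simp: field_simps)
qed

lemma inner_dyadic_corner:
  "i \<in> Basis \<Longrightarrow> dyadic_corner k x \<bullet> i = 2 powr k * \<lfloor>(x \<bullet> i) * 2 powr - real_of_int k\<rfloor>"
  by (simp add: dyadic_corner_def inner_sum_left_Basis)

lemma dyadic_cube_altdef:
  "dyadic_cube k x = {y. \<forall>i\<in>Basis. dyadic_corner k x \<bullet> i \<le> y \<bullet> i \<and> y \<bullet> i < dyadic_corner k x \<bullet> i + 2 powr k}"
  unfolding dyadic_cube_def dyadic_floor_bounds by (auto simp: inner_dyadic_corner)

lemma box_subset_dyadic_cube:
  "box (dyadic_corner k x) (dyadic_corner k x + 2 powr k *\<^sub>R One) \<subseteq> dyadic_cube k x"
  unfolding dyadic_cube_altdef box_def by (force simp: inner_add_left)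

lemma dyadic_cube_subset_cbox:
  "dyadic_cube k x \<subseteq> cbox (dyadic_corner k x) (dyadic_corner k x + 2 powr k *\<^sub>R One)"
  unfolding dyadic_cube_altdef cbox_def by (force simp: inner_add_left)

lemma dyadic_nbhd_subset_cube:
  "dyadic_nbhd k x \<subseteq> cube (dyadic_corner k x - 2 powr k *\<^sub>R One) (3 * 2 powr k)"
proof
  fix y assume y: "y \<in> dyadic_nbhd k x"
  show "y \<in> cube (dyadic_corner k x - 2 powr k *\<^sub>R One) (3 * 2 powr k)"
    unfolding cube_def mem_box
  proof
    fix i :: 'a assume i: "i \<in> Basis"
    define z where "z = \<lfloor>(x \<bullet> i) * 2 powr - real_of_int k\<rfloor>"
    define w where "w = \<lfloor>(y \<bullet> i) * 2 powr - real_of_int k\<rfloor>"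
    have w: "2 powr k * w \<le> y \<bullet> i \<and> y \<bullet> i < 2 powr k * w + 2 powr k"
      using dyadic_floor_bounds w_def by blast
    have "\<bar>w - z\<bar> \<le> 1" using y i by (auto simp: dyadic_nbhd_def w_def z_def)
    then have "real_of_int z - 1 \<le> w" "w \<le> real_of_int z + 1" by linarith+
    then have "2 powr k * (real_of_int z - 1) \<le> 2 powr k * w" "2 powr k * w \<le> 2 powr k * (real_of_int z + 1)"
      by (auto intro!: mult_left_mono)
    with w show "(dyadic_corner k x - 2 powr k *\<^sub>R One) \<bullet> i \<le> y \<bullet> i \<and>
       y \<bullet> i \<le> (dyadic_corner k x - 2 powr k *\<^sub>R One + (3 * 2 powr k) *\<^sub>R One) \<bullet> i"
      using i by (auto simp: inner_add_left inner_diff_left inner_dyadic_corner algebra_simps simp flip: z_def)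
  qed
qed

lemma emeasure_cube: "0 \<le> l \<Longrightarrow> emeasure lborel (cube (a::'a::euclidean_space) l) = ennreal (l ^ DIM('a))"
  by (simp add: cube_def emeasure_lborel_cbox_eq inner_add_left)

lemma dyadic_cube_borel [measurable]: "dyadic_cube k x \<in> sets borel"
  unfolding dyadic_cube_def by measurable

lemma dyadic_nbhd_borel [measurable]: "dyadic_nbhd k x \<in> sets borel"
proof -
  have "{y::'a. \<forall>i\<in>Basis. \<bar>real_of_int \<lfloor>(y \<bullet> i) * 2 powr - real_of_int k\<rfloor> - real_of_int \<lfloor>(x \<bullet> i) * 2 powr - real_of_int k\<rfloor>\<bar> \<le> 1} \<in> sets borel"
    by measurable
  then show ?thesis
    unfolding dyadic_nbhd_def of_int_diff[symmetric] of_int_abs[symmetric] of_int_le_1_iff .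
qed

lemma emeasure_dyadic_cube:
  "emeasure lebesgue (dyadic_cube k (x::'a::euclidean_space)) = ennreal (side_pow k (DIM('a)))"
proof -
  have p: "(2 powr real_of_int k) ^ DIM('a) = side_pow k (DIM('a))"
    by (metis powr_gt_zero powr_powr powr_realpow zero_neq_numeral)
  let ?a = "dyadic_corner k x" and ?b = "dyadic_corner k x + 2 powr k *\<^sub>R One"
  have "emeasure lborel (box ?a ?b) = ennreal (side_pow k (DIM('a)))"
    by (simp add: emeasure_lborel_box_eq inner_add_left p)
  moreover have "emeasure lborel (cbox ?a ?b) = ennreal (side_pow k (DIM('a)))"
    by (simp add: emeasure_lborel_cbox_eq inner_add_left p)
  moreover have "emeasure lborel (box ?a ?b) \<le> emeasure lborel (dyadic_cube k x)"
    by (intro emeasure_mono box_subset_dyadic_cube) auto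
  moreover have "emeasure lborel (dyadic_cube k x) \<le> emeasure lborel (cbox ?a ?b)"
    by (intro emeasure_mono dyadic_cube_subset_cbox) auto
  ultimately show ?thesis by simp
qed

lemma emeasure_dyadic_nbhd:
  "emeasure lebesgue (dyadic_nbhd k (x::'a::euclidean_space)) \<le> ennreal (3 ^ DIM('a) * side_pow k (DIM('a)))"
proof -
  have "emeasure lborel (dyadic_nbhd k x) \<le> emeasure lborel (cube (dyadic_corner k x - 2 powr k *\<^sub>R One) (3 * 2 powr k))"
    using dyadic_nbhd_subset_cube by (intro emeasure_mono) (auto simp: cube_def)
  also have "\<dots> = ennreal (3 ^ DIM('a) * side_pow k (DIM('a)))"
    using powr_realpow[of "2 powr real_of_int k" "DIM('a)"]
    by (simp add: emeasure_cube power_mult_distrib powr_powr)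
  finally show ?thesis by simp
qed

lemma dyadicsI [simp]: "(k, dyadic_cube k x) \<in> dyadics"
  by (auto simp: dyadics_def)

lemma dyadicsE:
  assumes "p \<in> dyadics" obtains x where "p = (fst p, dyadic_cube (fst p) x)" "snd p = dyadic_cube (fst p) x"
  using assms by (auto simp: dyadics_def)

lemma dyadics_mem: "p \<in> dyadics \<Longrightarrow> x \<in> snd p \<Longrightarrow> snd p = dyadic_cube (fst p) x"
  by (auto simp: dyadics_def dyadic_cube_eq)

lemma dyadics_mem_eq: "p \<in> dyadics \<Longrightarrow> x \<in> snd p \<Longrightarrow> p = (fst p, dyadic_cube (fst p) x)"
  by (metis dyadics_mem prod.collapse)

lemma dyadics_nonempty: "p \<in> dyadics \<Longrightarrow> snd p \<noteq> {}"
  using dyadic_cube_self by (metis dyadicsE empty_iff)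

text \<open>Every dyadic cube contains an open box, hence a point of a countable dense set, and the
  level together with any of its points determines the cube.\<close>

lemma countable_dyadics [simp]: "countable (dyadics :: (int \<times> 'a::euclidean_space set) set)"
proof -
  obtain D :: "'a set" where D: "countable D" "\<And>X. open X \<Longrightarrow> X \<noteq> {} \<Longrightarrow> \<exists>d\<in>D. d \<in> X"
    using countable_dense_exists by blast
  have "dyadics \<subseteq> (\<Union>k. \<Union>x\<in>D. {(k, dyadic_cube k x)})"
  proof
    fix p :: "int \<times> 'a set" assume "p \<in> dyadics"
    then obtain k x where p: "p = (k, dyadic_cube k x)" by (auto simp: dyadics_def)
    have "box (dyadic_corner k x) (dyadic_corner k x + 2 powr k *\<^sub>R One) \<noteq> {}"
      by (auto simp: box_ne_empty inner_add_left)
    with D(2)[OF open_box] obtain d where "d \<in> D" "d \<in> dyadic_cube k x"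
      using box_subset_dyadic_cube by blast
    then show "p \<in> (\<Union>k. \<Union>x\<in>D. {(k, dyadic_cube k x)})"
      using dyadic_cube_eq[of d k x] p by auto
  qed
  moreover have "countable (\<Union>k::int. \<Union>x\<in>D. {(k, dyadic_cube k x)})" using D(1) by auto
  ultimately show ?thesis by (rule countable_subset)
qed

lemma dyadics_snd_borel: "p \<in> dyadics \<Longrightarrow> snd p \<in> sets borel"
  by (auto simp: dyadics_def)

lemma dyadics_nested:
  assumes "p \<in> dyadics" "q \<in> dyadics" "snd p \<inter> snd q \<noteq> {}" "fst p \<le> fst q"
  shows "snd p \<subseteq> snd q"
  using assms dyadic_cube_mono dyadics_mem by (metis disjoint_iff)

text \<open>Counting by volume: cubes of level k are disjoint of volume 2^(k n) each, and the
  neighbourhood has volume at most 3^n 2^(k n). Proving the bound for finite subfamilies yields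
  finiteness at the same time.\<close>

lemma dyadic_neighbours:
  fixes x :: "'a::euclidean_space"
  shows "finite {P. (k, P) \<in> dyadics \<and> P \<subseteq> dyadic_nbhd k x}" (is "finite ?F")
    and "card {P. (k, P) \<in> dyadics \<and> P \<subseteq> dyadic_nbhd k x} \<le> 3 ^ DIM('a)"
    and "dyadic_nbhd k x = \<Union>{P. (k, P) \<in> dyadics \<and> P \<subseteq> dyadic_nbhd k x}"
proof -
  have "card G \<le> 3 ^ DIM('a)" if G: "G \<subseteq> ?F" "finite G" for G
  proof -
    have disj: "disjoint_family_on (\<lambda>P. P) G"
      unfolding disjoint_family_on_def
    proof (intro ballI impI)
      fix P Q assume "P \<in> G" "Q \<in> G" "P \<noteq> Q"
      then have "(k, P) \<in> dyadics" "(k, Q) \<in> dyadics" using G by auto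
      then show "P \<inter> Q = {}" using \<open>P \<noteq> Q\<close> dyadics_mem by (metis disjoint_iff fst_conv snd_conv)
    qed
    have s: "P \<in> sets lebesgue" if "P \<in> G" for P using dyadics_snd_borel[of "(k, P)"] G that by auto
    have "ennreal (card G * side_pow k (DIM('a))) = (\<Sum>P\<in>G. emeasure lebesgue P)"
    proof -
      have "emeasure lebesgue P = ennreal (side_pow k (DIM('a)))" if "P \<in> G" for P
      proof -
        have "(k, P) \<in> dyadics" using G that by auto
        then obtain y where "P = dyadic_cube k y" by (auto simp: dyadics_def)
        then show ?thesis using emeasure_dyadic_cube by metis
      qed
      then show ?thesis by (simp add: ennreal_mult ennreal_of_nat_eq_real_of_nat)
    qed
    also have "\<dots> = emeasure lebesgue (\<Union>G)"
      using sum_emeasure[OF _ disj G(2), of lebesgue] s by auto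
    also have "\<dots> \<le> emeasure lebesgue (dyadic_nbhd k x)"
      using G by (intro emeasure_mono) auto
    also have "\<dots> \<le> ennreal (3 ^ DIM('a) * side_pow k (DIM('a)))" by (rule emeasure_dyadic_nbhd)
    finally have "card G * side_pow k (DIM('a)) \<le> 3 ^ DIM('a) * side_pow k (DIM('a))" by simp
    then have "real (card G) \<le> 3 ^ DIM('a)" by simp
    then show ?thesis by (metis of_nat_le_iff of_nat_numeral of_nat_power)
  qed
  from finite_if_finite_subsets_card_bdd[of ?F, OF this]
  show "finite ?F" "card ?F \<le> 3 ^ DIM('a)" by auto
  show "dyadic_nbhd k x = \<Union>?F"
    using dyadic_cube_subset_nbhd'[of _ k x] dyadicsI dyadic_cube_self by blast
qed

subsection \<open>Dyadic content\<close>

lemma ennreal_divide_le_iff: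
  assumes "0 < c" shows "a / ennreal c \<le> b \<longleftrightarrow> a \<le> ennreal c * b"
proof -
  have "a / ennreal c \<le> b \<longleftrightarrow> ennreal c * (a / ennreal c) \<le> ennreal c * b"
    using assms by (intro ennreal_mult_le_mult_iff[symmetric]) auto
  also have "ennreal c * (a / ennreal c) = a"
    using assms by (simp add: ennreal_times_divide mult.commute[of "ennreal c"] mult_divide_eq_ennreal)
  finally show ?thesis .
qed

section \<open>Sums with values in [0, \<infinity>]\<close>

lemma csum_indicator:
  fixes f :: "'b \<Rightarrow> ennreal"
  shows "csum A f = csum UNIV (\<lambda>p. f p * indicator A p)"
  by (simp add: nn_integral_count_space_indicator)

lemma csum_mono_set:
  fixes f :: "'b \<Rightarrow> ennreal"
  assumes "A \<subseteq> B" shows "csum A f \<le> csum B f"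
  unfolding csum_indicator[of A f] csum_indicator[of B f]
  using assms by (intro nn_integral_mono mult_left_mono) (auto simp: indicator_def)

lemma csum_swap:
  fixes f :: "'b \<Rightarrow> 'c \<Rightarrow> ennreal"
  shows "csum A (\<lambda>x. csum B (\<lambda>y. f x y)) = csum B (\<lambda>y. csum A (\<lambda>x. f x y))"
proof -
  define g where "g = (\<lambda>(x, y). f x y * indicator A x * indicator B y)"
  have "csum A (\<lambda>x. csum B (\<lambda>y. f x y)) = csum UNIV (\<lambda>x. csum UNIV (\<lambda>y. g (x, y)))"
    by (simp add: nn_integral_count_space_indicator[of A] nn_integral_count_space_indicator[of B]
        g_def mult_ac flip: nn_integral_cmult nn_integral_multc)
  also have "\<dots> = csum UNIV (\<lambda>y. csum UNIV (\<lambda>x. g (x, y)))"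
    by (simp only: nn_integral_fst_count_space nn_integral_snd_count_space)
  also have "\<dots> = csum B (\<lambda>y. csum A (\<lambda>x. f x y))"
    by (simp add: nn_integral_count_space_indicator[of A] nn_integral_count_space_indicator[of B]
        g_def mult_ac flip: nn_integral_cmult nn_integral_multc)
  finally show ?thesis .
qed

lemma csum_UN_le:
  fixes f :: "'b \<Rightarrow> ennreal"
  shows "csum (\<Union>i\<in>I. A i) f \<le> csum I (\<lambda>i. csum (A i) f)"
proof -
  have "csum (\<Union>i\<in>I. A i) f = csum UNIV (\<lambda>p. f p * indicator (\<Union>i\<in>I. A i) p)"
    by (rule nn_integral_count_space_indicator) simp
  also have "\<dots> \<le> csum UNIV (\<lambda>p. csum I (\<lambda>i. f p * indicator (A i) p))"
  proof (rule nn_integral_mono)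
    fix p
    show "f p * indicator (\<Union>i\<in>I. A i) p \<le> csum I (\<lambda>i. f p * indicator (A i) p)"
    proof (cases "p \<in> (\<Union>i\<in>I. A i)")
      case True
      then obtain i where "i \<in> I" "p \<in> A i" by auto
      then show ?thesis using nn_integral_ge_point[of i I "\<lambda>i. f p * indicator (A i) p"] True by simp
    qed simp
  qed
  also have "\<dots> = csum I (\<lambda>i. csum UNIV (\<lambda>p. f p * indicator (A i) p))"
    by (rule csum_swap)
  also have "\<dots> = csum I (\<lambda>i. csum (A i) f)"
    by (intro nn_integral_cong) (simp add: nn_integral_count_space_indicator[where X=X for X])
  finally show ?thesis .
qed

lemma csum_half_powers:
  assumes "countable I"
  shows "csum I (\<lambda>i. ennreal (e * (1/2) ^ Suc (to_nat_on I i))) \<le> ennreal e"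
proof (cases "0 \<le> e")
  case True
  have "csum I (\<lambda>i. ennreal (e * (1/2) ^ Suc (to_nat_on I i)))
      = csum (to_nat_on I ` I) (\<lambda>n. ennreal (e * (1/2) ^ Suc n))"
    by (rule nn_integral_bij_count_space) (simp add: assms bij_betw_def inj_on_to_nat_on)
  also have "\<dots> \<le> csum UNIV (\<lambda>n. ennreal (e * (1/2) ^ Suc n))"
    by (rule csum_mono_set) simp
  also have "\<dots> = (\<Sum>n. ennreal (e * (1/2) ^ Suc n))" by (rule nn_integral_count_space_nat)
  also have "\<dots> = ennreal e"
  proof (rule suminf_ennreal_eq)
    show "(\<lambda>n. e * (1/2) ^ Suc n) sums e"
      using sums_mult[OF power_half_series, of e] by simp
  qed (use True in simp)
  finally show ?thesis .
next
  case False
  then have "ennreal (e * (1/2) ^ Suc n) = 0" for n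
    by (intro ennreal_neg) (simp add: mult_nonpos_nonneg)
  then show ?thesis by simp
qed

section \<open>The dyadic content and its subadditivity\<close>

definition dyadic_weight :: "real \<Rightarrow> int \<times> 'a set \<Rightarrow> ennreal" where
  "dyadic_weight \<beta> p = ennreal (side_pow (fst p) \<beta>)"

text \<open>The dyadic form of the Hausdorff content, without the factor
  \<open>omega \<beta>\<close>. Two cubes of a cover are nested or disjoint, so maximal cubes can be
  selected; for covers by balls this would need a covering lemma at each step.\<close>

definition dcontent :: "real \<Rightarrow> 'a::euclidean_space set \<Rightarrow> ennreal" where
  "dcontent \<beta> E = (INF \<C>\<in>{\<C>. \<C> \<subseteq> dyadics \<and> E \<subseteq> \<Union>(snd ` \<C>)}. csum \<C> (dyadic_weight \<beta>))"

lemma dcontent_le: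
  "\<C> \<subseteq> dyadics \<Longrightarrow> E \<subseteq> \<Union>(snd ` \<C>) \<Longrightarrow> dcontent \<beta> E \<le> csum \<C> (dyadic_weight \<beta>)"
  unfolding dcontent_def by (rule INF_lower) simp

lemma dcontent_lessE:
  assumes "dcontent \<beta> E < W"
  obtains \<C> where "\<C> \<subseteq> dyadics" "E \<subseteq> \<Union>(snd ` \<C>)" "csum \<C> (dyadic_weight \<beta>) < W"
  using assms unfolding dcontent_def INF_less_iff by auto

lemma dcontent_geI:
  assumes "\<And>\<C>. \<C> \<subseteq> dyadics \<Longrightarrow> E \<subseteq> \<Union>(snd ` \<C>) \<Longrightarrow> W \<le> csum \<C> (dyadic_weight \<beta>)"
  shows "W \<le> dcontent \<beta> E"
  unfolding dcontent_def using assms by (intro INF_greatest) auto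

lemma dcontent_mono: "E \<subseteq> F \<Longrightarrow> dcontent \<beta> E \<le> dcontent \<beta> F"
  unfolding dcontent_def by (intro INF_superset_mono) auto

text \<open>Covers that are optimal up to errors e / 2^(i+1) are merged. The sets are arbitrary, so
  exceptional sets never have to be measurable.\<close>

lemma dcontent_UN:
  assumes I: "countable I"
  shows "dcontent \<beta> (\<Union>i\<in>I. E i) \<le> csum I (\<lambda>i. dcontent \<beta> (E i))"
proof (cases "csum I (\<lambda>i. dcontent \<beta> (E i)) = \<infinity>")
  case False
  show ?thesis
  proof (rule ennreal_le_epsilon)
    fix e :: real assume e: "0 < e"
    have fin: "dcontent \<beta> (E i) < \<infinity>" if "i \<in> I" for i
      using nn_integral_ge_point[OF that, of "\<lambda>i. dcontent \<beta> (E i)"] False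
      by (auto simp: less_top top_unique)
    have "\<exists>\<C>. \<C> \<subseteq> dyadics \<and> E i \<subseteq> \<Union>(snd ` \<C>) \<and>
        (csum \<C> (dyadic_weight \<beta>)) \<le> dcontent \<beta> (E i) + ennreal (e * (1/2) ^ Suc (to_nat_on I i))"
      if "i \<in> I" for i
    proof -
      have "dcontent \<beta> (E i) < dcontent \<beta> (E i) + ennreal (e * (1/2) ^ Suc (to_nat_on I i))"
        using fin[OF that] e by (simp add: ennreal_add_left_cancel_less[of _ 0, simplified])
      then show ?thesis by (elim dcontent_lessE) (auto intro: less_imp_le)
    qed
    then obtain \<C> where C: "\<And>i. i \<in> I \<Longrightarrow> \<C> i \<subseteq> dyadics" "\<And>i. i \<in> I \<Longrightarrow> E i \<subseteq> \<Union>(snd ` \<C> i)"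
      "\<And>i. i \<in> I \<Longrightarrow> csum (\<C> i) (dyadic_weight \<beta>) \<le> dcontent \<beta> (E i) + ennreal (e * (1/2) ^ Suc (to_nat_on I i))"
      by metis
    have "dcontent \<beta> (\<Union>i\<in>I. E i) \<le> csum (\<Union>i\<in>I. \<C> i) (dyadic_weight \<beta>)"
    proof (rule dcontent_le)
      show "(\<Union>i\<in>I. \<C> i) \<subseteq> dyadics" using C(1) by blast
      show "(\<Union>i\<in>I. E i) \<subseteq> \<Union>(snd ` (\<Union>i\<in>I. \<C> i))"
      proof (rule UN_least)
        fix i assume i: "i \<in> I"
        have "E i \<subseteq> \<Union>(snd ` \<C> i)" by (rule C(2)[OF i])
        also have "\<dots> \<subseteq> \<Union>(snd ` (\<Union>i\<in>I. \<C> i))" by (intro Union_mono image_mono UN_upper i)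
        finally show "E i \<subseteq> \<Union>(snd ` (\<Union>i\<in>I. \<C> i))" .
      qed
    qed
    also have "\<dots> \<le> csum I (\<lambda>i. csum (\<C> i) (dyadic_weight \<beta>))"
      by (rule csum_UN_le)
    also have "\<dots> \<le> csum I (\<lambda>i. dcontent \<beta> (E i) + ennreal (e * (1/2) ^ Suc (to_nat_on I i)))"
      using C(3) by (intro nn_integral_mono) simp
    also have "\<dots> = csum I (\<lambda>i. dcontent \<beta> (E i)) + csum I (\<lambda>i. ennreal (e * (1/2) ^ Suc (to_nat_on I i)))"
      by (rule nn_integral_add) auto
    also have "\<dots> \<le> csum I (\<lambda>i. dcontent \<beta> (E i)) + ennreal e"
      using csum_half_powers[OF I] by (rule add_left_mono)
    finally show "dcontent \<beta> (\<Union>i\<in>I. E i) \<le> csum I (\<lambda>i. dcontent \<beta> (E i)) + ennreal e" .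
  qed
qed simp

lemma dcontent_Un: "dcontent \<beta> (E \<union> F) \<le> dcontent \<beta> E + dcontent \<beta> F"
proof -
  have "dcontent \<beta> (\<Union>i\<in>UNIV. if i then E else F) \<le> csum UNIV (\<lambda>i. dcontent \<beta> (if i then E else F))"
    by (rule dcontent_UN) simp
  then show ?thesis by (simp add: nn_integral_count_space_finite UNIV_bool Un_commute add.commute)
qed

lemma dcontent_dyadic_le: "p \<in> dyadics \<Longrightarrow> dcontent \<beta> (snd p) \<le> dyadic_weight \<beta> p"
  using dcontent_le[of "{p}" "snd p" \<beta>] by (simp add: nn_integral_count_space_finite)

section \<open>Dyadic content against Lebesgue measure\<close>

lemma emeasure_le_csum:
  assumes E: "E \<in> sets lebesgue" "E \<subseteq> \<Union>(snd ` \<C>)" and C: "\<C> \<subseteq> dyadics"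
  shows "emeasure lebesgue E \<le> csum \<C> (\<lambda>p. emeasure lebesgue (snd p))"
proof -
  have cC: "countable \<C>" using C countable_dyadics countable_subset by blast
  have s: "snd p \<in> sets lebesgue" if "p \<in> \<C>" for p using dyadics_snd_borel[of p] C that by auto
  have "emeasure lebesgue E = (\<integral>\<^sup>+x. indicator E x \<partial>lebesgue)" using E by simp
  also have "\<dots> \<le> (\<integral>\<^sup>+x. csum \<C> (\<lambda>p. indicator (snd p) x) \<partial>lebesgue)"
  proof (rule nn_integral_mono)
    fix x
    show "indicator E x \<le> (csum \<C> (\<lambda>p. indicator (snd p) x) :: ennreal)"
    proof (cases "x \<in> E")
      case True
      then obtain p where "p \<in> \<C>" "x \<in> snd p" using E by auto
      then show ?thesis using nn_integral_ge_point[of p \<C> "\<lambda>p. indicator (snd p) x"] True by simp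
    qed simp
  qed
  also have "\<dots> = csum \<C> (\<lambda>p. \<integral>\<^sup>+x. indicator (snd p) x \<partial>lebesgue)"
    using s by (intro nn_integral_count_space_nn_integral cC) simp
  also have "\<dots> = csum \<C> (\<lambda>p. emeasure lebesgue (snd p))"
    using s by (intro nn_integral_cong) simp
  finally show ?thesis .
qed

lemma emeasure_dyadic:
  "p \<in> dyadics \<Longrightarrow> emeasure lebesgue (snd p :: 'a::euclidean_space set) = dyadic_weight (real DIM('a)) p"
  using emeasure_dyadic_cube unfolding dyadic_weight_def by (metis dyadicsE)

lemma powr_mono_int: "(k::int) \<le> m \<Longrightarrow> 0 \<le> \<beta> \<Longrightarrow> side_pow k \<beta> \<le> side_pow m \<beta>"
  by (intro powr_mono mult_right_mono) auto

lemma dyadic_weight_split: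
  assumes "fst p \<le> k" "\<beta> \<le> \<gamma>"
  shows "dyadic_weight \<gamma> p \<le> ennreal (side_pow k (\<gamma> - \<beta>)) * dyadic_weight \<beta> p"
proof -
  have "side_pow (fst p) \<gamma> = side_pow (fst p) (\<gamma> - \<beta>) * side_pow (fst p) \<beta>"
    by (simp add: algebra_simps flip: powr_add)
  also have "\<dots> \<le> side_pow k (\<gamma> - \<beta>) * side_pow (fst p) \<beta>"
    using assms by (intro mult_right_mono powr_mono_int) auto
  finally show ?thesis by (simp add: dyadic_weight_def flip: ennreal_mult)
qed

text \<open>A cover by cubes of level at most k compares term by term, since a side l \<le> 2^k
  satisfies l^n \<le> 2^(k(n-\<beta>)) l^\<beta>. A cover that uses a cube of level k or more
  already costs as much as the whole cube containing E.\<close>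

lemma emeasure_le_dcontent:
  fixes x :: "'a::euclidean_space"
  assumes \<beta>: "0 < \<beta>" "\<beta> \<le> real DIM('a)" and E: "E \<in> sets lebesgue" "E \<subseteq> dyadic_cube k x"
  shows "emeasure lebesgue E \<le> ennreal (side_pow k (real DIM('a) - \<beta>)) * dcontent \<beta> E"
proof -
  define c where "c = side_pow k (real DIM('a) - \<beta>)"
  have c: "0 < c" by (simp add: c_def)
  have "emeasure lebesgue E / ennreal c \<le> dcontent \<beta> E"
  proof (rule dcontent_geI)
    fix \<C> :: "(int \<times> 'a set) set" assume C: "\<C> \<subseteq> dyadics" "E \<subseteq> \<Union>(snd ` \<C>)"
    have "emeasure lebesgue E \<le> ennreal c * csum \<C> (dyadic_weight \<beta>)"
    proof (cases "\<exists>p\<in>\<C>. k \<le> fst p")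
      case True
      then obtain p where p: "p \<in> \<C>" "k \<le> fst p" by auto
      have "emeasure lebesgue E \<le> emeasure lebesgue (dyadic_cube k x)"
        using E by (intro emeasure_mono) auto
      also have "\<dots> = ennreal (side_pow k (DIM('a)))" by (rule emeasure_dyadic_cube)
      also have "\<dots> = ennreal c * ennreal (side_pow k \<beta>)"
        by (simp add: c_def algebra_simps flip: powr_add ennreal_mult)
      also have "\<dots> \<le> ennreal c * dyadic_weight \<beta> p"
        unfolding dyadic_weight_def using p \<beta> by (intro mult_left_mono ennreal_leI powr_mono_int) auto
      also have "\<dots> \<le> ennreal c * csum \<C> (dyadic_weight \<beta>)"
        by (intro mult_left_mono nn_integral_ge_point p) simp
      finally show ?thesis .
    next
      case False
      have "emeasure lebesgue E \<le> csum \<C> (\<lambda>p. emeasure lebesgue (snd p))"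
        by (rule emeasure_le_csum) (use E C in auto)
      also have "\<dots> \<le> csum \<C> (\<lambda>p. ennreal c * dyadic_weight \<beta> p)"
      proof (intro nn_integral_mono)
        fix p assume "p \<in> space (count_space \<C>)"
        then have pC: "p \<in> \<C>" by simp
        have p: "p \<in> dyadics" by (rule subsetD[OF C(1) pC])
        have "\<not> k \<le> fst p" using False pC by blast
        then have pk: "fst p \<le> k" by simp
        show "emeasure lebesgue (snd p) \<le> ennreal c * dyadic_weight \<beta> p"
          unfolding emeasure_dyadic[OF p] c_def by (rule dyadic_weight_split[OF pk \<beta>(2)])
      qed
      also have "\<dots> = ennreal c * csum \<C> (dyadic_weight \<beta>)"
        by (rule nn_integral_cmult) simp
      finally show ?thesis .
    qed
    then show "emeasure lebesgue E / ennreal c \<le> csum \<C> (dyadic_weight \<beta>)"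
      by (simp add: ennreal_divide_le_iff[OF c])
  qed
  then show ?thesis by (simp only: ennreal_divide_le_iff[OF c] flip: c_def)
qed

text \<open>The preceding comparison for the full cube. With subadditivity it shows that a cube has
  a point outside any set of smaller content, which is how mean values on different cubes are
  compared.\<close>

lemma dcontent_dyadic_cube_ge:
  fixes x :: "'a::euclidean_space"
  assumes \<beta>: "0 < \<beta>" "\<beta> \<le> real DIM('a)"
  shows "ennreal (side_pow k \<beta>) \<le> dcontent \<beta> (dyadic_cube k x)"
proof -
  define c where "c = side_pow k (real DIM('a) - \<beta>)"
  have "ennreal c * ennreal (side_pow k \<beta>) = emeasure lebesgue (dyadic_cube k x)"
    unfolding emeasure_dyadic_cube by (simp add: c_def algebra_simps flip: powr_add ennreal_mult)
  also have "\<dots> \<le> ennreal c * dcontent \<beta> (dyadic_cube k x)"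
    unfolding c_def by (rule emeasure_le_dcontent[OF \<beta>]) auto
  finally show ?thesis
    by (subst (asm) ennreal_mult_le_mult_iff) (auto simp: c_def)
qed

section \<open>Comparison of dyadic and Hausdorff content\<close>

lemma omega_pos: "0 < \<beta> \<Longrightarrow> 0 < omega \<beta>"
  by (simp add: omega_def Gamma_real_pos)

lemma hcontent_le_dcontent:
  assumes \<beta>: "0 < \<beta>"
  shows "\<exists>C>0. \<forall>E::'a::euclidean_space set. hcontent \<beta> E \<le> ennreal C * dcontent \<beta> E"
proof (intro exI conjI allI)
  \<comment> \<open>The l1 norm bounds the distance to the corner by n 2^k; the additional unit
    makes this strict, as the open ball demands.\<close>
  define R where "R = real DIM('a) + 1"
  define C where "C = omega \<beta> * R powr \<beta>"
  have R: "0 < R" by (simp add: R_def add_nonneg_pos)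
  show C: "0 < omega \<beta> * R powr \<beta>" using omega_pos[OF \<beta>] R by simp
  then have C0: "0 < C" by (simp add: C_def)
  fix E :: "'a set"
  have "hcontent \<beta> E / ennreal C \<le> dcontent \<beta> E"
  proof (rule dcontent_geI)
    fix \<C> :: "(int \<times> 'a set) set" assume sub: "\<C> \<subseteq> dyadics" and cov: "E \<subseteq> \<Union>(snd ` \<C>)"
    have cC: "countable \<C>" using sub countable_dyadics countable_subset by blast
    have "\<exists>a. snd p \<subseteq> ball a (R * 2 powr real_of_int (fst p))" if "p \<in> \<C>" for p
    proof -
      from that sub obtain x where x: "snd p = dyadic_cube (fst p) x" using dyadicsE by blast
      have "dyadic_cube (fst p) x \<subseteq> ball (dyadic_corner (fst p) x) (R * 2 powr real_of_int (fst p))"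
      proof
        fix y assume y: "y \<in> dyadic_cube (fst p) x"
        let ?a = "dyadic_corner (fst p) x"
        have "norm (y - ?a) \<le> (\<Sum>i\<in>Basis. \<bar>(y - ?a) \<bullet> i\<bar>)" by (rule norm_le_l1)
        also have "\<dots> \<le> (\<Sum>i\<in>(Basis::'a set). 2 powr real_of_int (fst p))"
          using y by (intro sum_mono) (force simp: dyadic_cube_altdef inner_diff_left)
        also have "\<dots> < R * 2 powr real_of_int (fst p)" by (simp add: R_def algebra_simps)
        finally show "y \<in> ball ?a (R * 2 powr real_of_int (fst p))" by (simp add: dist_norm norm_minus_commute)
      qed
      then show ?thesis unfolding x by (rule exI)
    qed
    then obtain a where a: "\<And>p. p \<in> \<C> \<Longrightarrow> snd p \<subseteq> ball (a p) (R * 2 powr real_of_int (fst p))" by metis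
    define J where "J = to_nat_on \<C> ` \<C>"
    \<comment> \<open>A countable, possibly finite cover must be presented as a sequence over all
      naturals; indices outside \<open>J\<close> get radius 0, that is the empty ball.\<close>
    define r where "r i = (if i \<in> J then R * 2 powr real_of_int (fst (from_nat_into \<C> i)) else 0)" for i
    define c where "c i = a (from_nat_into \<C> i)" for i
    have "hcontent \<beta> E \<le> (\<Sum>i. ennreal (omega \<beta> * (r i) powr \<beta>))"
    proof -
      have "E \<subseteq> (\<Union>i. ball (c i) (r i))"
      proof
        fix y assume "y \<in> E"
        then obtain p where p: "p \<in> \<C>" "y \<in> snd p" using cov by auto
        then have "y \<in> ball (c (to_nat_on \<C> p)) (r (to_nat_on \<C> p))"
          using a[OF p(1)] cC by (auto simp: c_def r_def J_def)
        then show "y \<in> (\<Union>i. ball (c i) (r i))" by blast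
      qed
      moreover have "\<forall>i. 0 \<le> r i" using R by (auto simp: r_def)
      ultimately show ?thesis unfolding hcontent_def
        by (intro INF_lower2[of "(c, r)"]) auto
    qed
    also have "\<dots> = csum UNIV (\<lambda>i. ennreal (omega \<beta> * (r i) powr \<beta>))"
      by (rule nn_integral_count_space_nat[symmetric])
    also have "\<dots> = csum J (\<lambda>i. ennreal (omega \<beta> * (r i) powr \<beta>))"
      by (rule nn_integral_count_space_eq) (auto simp: r_def)
    also have "\<dots> = csum \<C> (\<lambda>p. ennreal (omega \<beta> * (r (to_nat_on \<C> p)) powr \<beta>))"
      unfolding J_def
      by (rule nn_integral_bij_count_space[symmetric]) (simp add: cC bij_betw_def inj_on_to_nat_on)
    also have "\<dots> = csum \<C> (\<lambda>p. ennreal C * dyadic_weight \<beta> p)"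
    proof (intro nn_integral_cong)
      fix p assume "p \<in> space (count_space \<C>)"
      then have "r (to_nat_on \<C> p) = R * 2 powr real_of_int (fst p)" using cC by (auto simp: r_def J_def)
      then show "ennreal (omega \<beta> * (r (to_nat_on \<C> p)) powr \<beta>) = ennreal C * dyadic_weight \<beta> p"
        using R C by (simp add: dyadic_weight_def C_def powr_mult powr_powr mult_ac flip: ennreal_mult)
    qed
    also have "\<dots> = ennreal C * csum \<C> (dyadic_weight \<beta>)"
      by (rule nn_integral_cmult) simp
    finally show "hcontent \<beta> E / ennreal C \<le> csum \<C> (dyadic_weight \<beta>)"
      by (simp add: ennreal_divide_le_iff[OF C0])
  qed
  then show "hcontent \<beta> E \<le> ennreal (omega \<beta> * R powr \<beta>) * dcontent \<beta> E"
    by (simp only: ennreal_divide_le_iff[OF C0] flip: C_def)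
qed

lemma dcontent_le_hcontent:
  assumes \<beta>: "0 < \<beta>"
  shows "\<exists>C>0. \<forall>E::'a::euclidean_space set. dcontent \<beta> E \<le> ennreal C * hcontent \<beta> E"
proof (intro exI conjI allI)
  \<comment> \<open>A ball of radius r is covered by the at most 3^n cubes of a neighbourhood whose
    side lies between r and 2 r, each of weight at most (2 r)^\<beta>.\<close>
  define C where "C = 3 ^ DIM('a) * 2 powr \<beta> / omega \<beta>"
  have om: "0 < omega \<beta>" by (rule omega_pos[OF \<beta>])
  show C: "0 < 3 ^ DIM('a) * 2 powr \<beta> / omega \<beta>" using om by simp
  then have C0: "0 < C" by (simp add: C_def)
  fix E :: "'a set"
  have "dcontent \<beta> E / ennreal C \<le> hcontent \<beta> E"
    unfolding hcontent_def
  proof (rule INF_greatest, clarsimp)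
    fix c :: "nat \<Rightarrow> 'a" and r :: "nat \<Rightarrow> real"
    assume r: "\<forall>i. 0 \<le> r i" and cov: "E \<subseteq> (\<Union>i. ball (c i) (r i))"
    define k where "k i = \<lceil>log 2 (r i)\<rceil>" for i
    \<comment> \<open>Balls of radius 0 are empty, and for them \<open>log 2 0\<close> would give a
      meaningless level.\<close>
    define I where "I = {i. 0 < r i}"
    define F where "F i = Pair (k i) ` {P. (k i, P) \<in> dyadics \<and> P \<subseteq> dyadic_nbhd (k i) (c i)}" for i
    have k: "r i \<le> 2 powr k i" "2 powr k i \<le> 2 * r i" if "i \<in> I" for i
    proof -
      have ri: "0 < r i" using that by (simp add: I_def)
      have "log 2 (r i) \<le> k i" "k i \<le> log 2 (r i) + 1" unfolding k_def by linarith+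
      then have "2 powr log 2 (r i) \<le> 2 powr k i" "2 powr k i \<le> 2 powr (log 2 (r i) + 1)" by auto
      then show "r i \<le> 2 powr k i" "2 powr k i \<le> 2 * r i" using ri by (auto simp: powr_add)
    qed
    have bal: "ball (c i) (r i) \<subseteq> \<Union>(snd ` F i)" if "i \<in> I" for i
    proof -
      have "ball (c i) (r i) \<subseteq> ball (c i) (2 powr k i)" using k[OF that] by auto
      also have "\<dots> \<subseteq> dyadic_nbhd (k i) (c i)" by (rule ball_subset_dyadic_nbhd)
      also have "\<dots> = \<Union>(snd ` F i)"
        unfolding F_def image_image by (subst dyadic_neighbours(3)) simp
      finally show ?thesis .
    qed
    have "dcontent \<beta> E \<le> csum (\<Union>i\<in>I. F i) (dyadic_weight \<beta>)"
    proof (rule dcontent_le)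
      show "(\<Union>i\<in>I. F i) \<subseteq> dyadics" by (auto simp: F_def)
      show "E \<subseteq> \<Union> (snd ` (\<Union>i\<in>I. F i))"
      proof
        fix y assume "y \<in> E"
        then obtain i where i: "y \<in> ball (c i) (r i)" using cov by auto
        then have "0 < r i" by (metis ball_eq_empty empty_iff not_le)
        then have "i \<in> I" by (simp add: I_def)
        then show "y \<in> \<Union> (snd ` (\<Union>i\<in>I. F i))" using bal i by blast
      qed
    qed
    also have "\<dots> \<le> csum I (\<lambda>i. csum (F i) (dyadic_weight \<beta>))"
      by (rule csum_UN_le)
    also have "\<dots> \<le> csum I (\<lambda>i. ennreal C * ennreal (omega \<beta> * r i powr \<beta>))"
    proof (rule nn_integral_mono)
      fix i assume "i \<in> space (count_space I)"
      then have i: "i \<in> I" by simp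
      have fin: "finite (F i)" unfolding F_def by (intro finite_imageI dyadic_neighbours)
      have cd: "card (F i) \<le> 3 ^ DIM('a)"
        unfolding F_def using dyadic_neighbours(2)[of "k i" "c i"] card_image_le[OF dyadic_neighbours(1)] le_trans by blast
      have "csum (F i) (dyadic_weight \<beta>) = (\<Sum>p\<in>F i. ennreal (2 powr (k i * \<beta>)))"
        unfolding nn_integral_count_space_finite[OF fin] by (rule sum.cong) (auto simp: F_def dyadic_weight_def)
      also have "\<dots> = ennreal (real (card (F i)) * 2 powr (k i * \<beta>))"
        by (simp add: ennreal_mult ennreal_of_nat_eq_real_of_nat)
      also have "\<dots> \<le> ennreal (3 ^ DIM('a) * (2 * r i) powr \<beta>)"
      proof (intro ennreal_leI mult_mono)
        show "real (card (F i)) \<le> 3 ^ DIM('a)" using cd by (metis of_nat_le_iff of_nat_numeral of_nat_power)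
        have "2 powr (k i * \<beta>) = (2 powr k i) powr \<beta>" by (simp add: powr_powr)
        also have "\<dots> \<le> (2 * r i) powr \<beta>" using k[OF i] \<beta> by (intro powr_mono2) auto
        finally show "2 powr (k i * \<beta>) \<le> (2 * r i) powr \<beta>" .
      qed auto
      also have "\<dots> = ennreal C * ennreal (omega \<beta> * r i powr \<beta>)"
        using r om C by (simp add: C_def powr_mult mult_ac flip: ennreal_mult)
      finally show "csum (F i) (dyadic_weight \<beta>) \<le> ennreal C * ennreal (omega \<beta> * r i powr \<beta>)" .
    qed
    also have "\<dots> \<le> csum UNIV (\<lambda>i. ennreal C * ennreal (omega \<beta> * r i powr \<beta>))"
      by (rule csum_mono_set) simp
    also have "\<dots> = ennreal C * (\<Sum>i. ennreal (omega \<beta> * r i powr \<beta>))"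
      by (simp add: nn_integral_cmult nn_integral_count_space_nat)
    finally show "dcontent \<beta> E / ennreal C \<le> (\<Sum>i. ennreal (omega \<beta> * r i powr \<beta>))"
      by (simp add: ennreal_divide_le_iff[OF C0])
  qed
  then show "dcontent \<beta> E \<le> ennreal (3 ^ DIM('a) * 2 powr \<beta> / omega \<beta>) * hcontent \<beta> E"
    by (simp only: ennreal_divide_le_iff[OF C0] flip: C_def)
qed

subsection \<open>Heavy cubes\<close>

text \<open>Comparing levels as well as sets makes the order antisymmetric on pairs, as maximality
  requires.\<close>

definition dyadic_le :: "int \<times> 'a set \<Rightarrow> int \<times> 'a set \<Rightarrow> bool" where
  "dyadic_le q p \<longleftrightarrow> fst q \<le> fst p \<and> snd q \<subseteq> snd p"

definition dyadic_mass :: "(int \<times> 'a::euclidean_space set \<Rightarrow> ennreal) \<Rightarrow> int \<times> 'a set \<Rightarrow> ennreal" where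
  "dyadic_mass w p = csum {q \<in> dyadics. dyadic_le q p} w"

text \<open>The Calderon--Zygmund selection in dimension \<beta>: \<open>w\<close> acts as a measure
  carried by cubes, and s is a threshold for its \<beta>-dimensional density. It is used for the
  John--Nirenberg inequality and again for the weak type inequality.\<close>

definition heavy :: "real \<Rightarrow> real \<Rightarrow> (int \<times> 'a::euclidean_space set \<Rightarrow> ennreal) \<Rightarrow> (int \<times> 'a set) set" where
  "heavy \<beta> s w = {p \<in> dyadics. ennreal s * dyadic_weight \<beta> p \<le> dyadic_mass w p}"

definition max_heavy :: "real \<Rightarrow> real \<Rightarrow> (int \<times> 'a::euclidean_space set \<Rightarrow> ennreal) \<Rightarrow> (int \<times> 'a set) set" where
  "max_heavy \<beta> s w = {p \<in> heavy \<beta> s w. \<forall>q \<in> heavy \<beta> s w. dyadic_le p q \<longrightarrow> q = p}"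

lemma csum_at_most_one:
  assumes "\<And>p q. p \<in> M \<Longrightarrow> q \<in> M \<Longrightarrow> P p \<Longrightarrow> P q \<Longrightarrow> p = q"
  shows "csum M (\<lambda>p. indicator {p. P p} p) \<le> (1::ennreal)"
proof (cases "\<exists>p\<in>M. P p")
  case True
  then obtain p where p: "p \<in> M" "P p" by auto
  have "csum M (\<lambda>q. indicator {p. P p} q) = (csum M (\<lambda>q. indicator {p} q) :: ennreal)"
    using p assms by (intro nn_integral_cong) (auto simp: indicator_def)
  also have "\<dots> \<le> 1" using p by (simp add: one_ennreal_def)
  finally show ?thesis .
next
  case False
  then have "csum M (\<lambda>q. indicator {p. P p} q) = (csum M (\<lambda>q. 0) :: ennreal)"
    by (intro nn_integral_cong) (auto simp: indicator_def)
  then show ?thesis by simp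
qed

lemma dyadic_mass_le: "dyadic_mass w p \<le> csum dyadics w"
  unfolding dyadic_mass_def by (rule csum_mono_set) auto

lemma dyadics_comparable:
  assumes "p \<in> dyadics" "q \<in> dyadics" "x \<in> snd p" "x \<in> snd q"
  shows "dyadic_le p q \<or> dyadic_le q p"
  using dyadics_nested[OF assms(1,2)] dyadics_nested[OF assms(2,1)] assms(3,4)
  unfolding dyadic_le_def by (meson disjoint_iff linear)

text \<open>A heavy cube of level m satisfies s 2^(m \<beta>) \<le> W, so the levels of the heavy
  ancestors of p are bounded above, and the topmost one is maximal.\<close>

lemma heavy_below_max:
  assumes \<beta>: "0 < \<beta>" and s: "0 < s" and W: "csum dyadics w \<le> ennreal W"
    and p: "p \<in> heavy \<beta> s w"
  shows "\<exists>q\<in>max_heavy \<beta> s w. dyadic_le p q"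
proof -
  have pd: "p \<in> dyadics" using p by (simp add: heavy_def)
  then obtain x where x: "p = (fst p, dyadic_cube (fst p) x)" using dyadicsE by blast
  define S where "S = {m. fst p \<le> m \<and> (m, dyadic_cube m x) \<in> heavy \<beta> s w}"
  have "m \<le> \<lfloor>log 2 (W / s) / \<beta>\<rfloor>" if "m \<in> S" for m
  proof -
    have "ennreal s * dyadic_weight \<beta> (m, dyadic_cube m x) \<le> ennreal W"
      using that dyadic_mass_le[of w "(m, dyadic_cube m x)"] W unfolding S_def heavy_def by auto
    then have "ennreal (s * side_pow m \<beta>) \<le> ennreal W"
      using s by (simp add: dyadic_weight_def ennreal_mult)
    moreover have pos: "0 < s * side_pow m \<beta>" using s by simp
    ultimately have le: "s * side_pow m \<beta> \<le> W"
      by (metis ennreal_le_iff2 not_le)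
    then have "side_pow m \<beta> \<le> W / s" using s by (simp add: field_simps)
    moreover have "0 < W / s" using less_le_trans[OF pos le] s by simp
    ultimately have "real_of_int m * \<beta> \<le> log 2 (W / s)" by (simp add: le_log_iff)
    then show ?thesis using \<beta> by (simp add: le_floor_iff field_simps)
  qed
  then have "S \<subseteq> {fst p..\<lfloor>log 2 (W / s) / \<beta>\<rfloor>}" by (auto simp: S_def)
  then have fin: "finite S" using finite_subset by blast
  have "fst p \<in> S" using p x by (simp add: S_def)
  define m where "m = Max S"
  have mS: "m \<in> S" using fin \<open>fst p \<in> S\<close> unfolding m_def by (intro Max_in) auto
  have "(m, dyadic_cube m x) \<in> max_heavy \<beta> s w"
    unfolding max_heavy_def
  proof (intro CollectI conjI ballI impI)
    show "(m, dyadic_cube m x) \<in> heavy \<beta> s w" using mS by (simp add: S_def)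
    fix q assume q: "q \<in> heavy \<beta> s w" "dyadic_le (m, dyadic_cube m x) q"
    have "x \<in> snd q" using q(2) by (auto simp: dyadic_le_def)
    moreover have "q \<in> dyadics" using q by (simp add: heavy_def)
    ultimately have qe: "q = (fst q, dyadic_cube (fst q) x)" by (intro dyadics_mem_eq)
    have "m \<le> fst q" using q(2) by (simp add: dyadic_le_def)
    moreover have "fst p \<le> m" using mS by (simp add: S_def)
    ultimately have "fst q \<in> S" using q(1) qe by (auto simp: S_def)
    then have "fst q \<le> m" using fin by (simp add: m_def)
    with \<open>m \<le> fst q\<close> have "fst q = m" by simp
    then show "q = (m, dyadic_cube m x)" using qe by simp
  qed
  moreover have "dyadic_le p (m, dyadic_cube m x)"
    using mS x dyadic_cube_mono[of "fst p" m x] unfolding dyadic_le_def S_def by (metis (no_types, lifting) fst_conv mem_Collect_eq snd_conv)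
  ultimately show ?thesis by blast
qed

text \<open>Cubes sharing a point are comparable, so a cube q lies below at most one maximal heavy
  cube. After the two sums are exchanged, the masses of the maximal cubes therefore add up to at
  most the total weight.\<close>

lemma max_heavy_sum:
  assumes W: "csum dyadics w \<le> ennreal W"
  shows "ennreal s * csum (max_heavy \<beta> s w) (dyadic_weight \<beta>) \<le> ennreal W"
proof -
  let ?M = "max_heavy \<beta> s w"
  have Mh: "p \<in> heavy \<beta> s w" "p \<in> dyadics" if "p \<in> ?M" for p
    using that by (auto simp: max_heavy_def heavy_def)
  have "ennreal s * csum ?M (dyadic_weight \<beta>) = csum ?M (\<lambda>p. ennreal s * dyadic_weight \<beta> p)"
    by (rule nn_integral_cmult[symmetric]) simp
  also have "\<dots> \<le> csum ?M (\<lambda>p. dyadic_mass w p)"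
    by (rule nn_integral_mono) (use Mh(1) in \<open>auto simp: heavy_def\<close>)
  also have "\<dots> = csum ?M (\<lambda>p. csum dyadics (\<lambda>q. w q * indicator {p. dyadic_le q p} p))"
  proof (rule nn_integral_cong)
    fix p
    have "dyadic_mass w p = csum UNIV (\<lambda>q. w q * indicator {q \<in> dyadics. dyadic_le q p} q)"
      unfolding dyadic_mass_def by (rule csum_indicator)
    also have "\<dots> = csum UNIV (\<lambda>q. w q * indicator {p. dyadic_le q p} p * indicator dyadics q)"
      by (rule nn_integral_cong) (auto simp: indicator_def)
    also have "\<dots> = csum dyadics (\<lambda>q. w q * indicator {p. dyadic_le q p} p)"
      by (rule csum_indicator[symmetric])
    finally show "dyadic_mass w p = csum dyadics (\<lambda>q. w q * indicator {p. dyadic_le q p} p)" .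
  qed
  also have "\<dots> = csum dyadics (\<lambda>q. csum ?M (\<lambda>p. w q * indicator {p. dyadic_le q p} p))"
    by (rule csum_swap)
  also have "\<dots> = csum dyadics (\<lambda>q. w q * csum ?M (\<lambda>p. indicator {p. dyadic_le q p} p))"
    by (intro nn_integral_cong nn_integral_cmult) simp
  also have "\<dots> \<le> csum dyadics (\<lambda>q. w q * 1)"
  proof (intro nn_integral_mono mult_left_mono csum_at_most_one)
    fix q p p' :: "int \<times> 'a set"
    assume "q \<in> space (count_space dyadics)" and p: "p \<in> ?M" "p' \<in> ?M" "dyadic_le q p" "dyadic_le q p'"
    then obtain x where "x \<in> snd q" using dyadics_nonempty by fastforce
    then have "x \<in> snd p" "x \<in> snd p'" using p by (auto simp: dyadic_le_def)
    then have "dyadic_le p p' \<or> dyadic_le p' p" using dyadics_comparable Mh(2) p by blast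
    then show "p = p'" using p(1,2) by (auto simp: max_heavy_def)
  qed simp
  also have "\<dots> \<le> ennreal W" using W by simp
  finally show ?thesis .
qed

subsection \<open>The John--Nirenberg inequality\<close>

text \<open>A weak-type form of bounded mean oscillation, with \<open>c\<close> choosing one mean
  value per cube. Apart from measurability, the later estimates see \<open>b\<close> only through
  it. Decay like 1/t is enough, since the John--Nirenberg argument improves it to exponential
  decay.\<close>

definition oscillation_bound ::
  "real \<Rightarrow> real \<Rightarrow> ('a::euclidean_space \<Rightarrow> real) \<Rightarrow> (int \<times> 'a set \<Rightarrow> real) \<Rightarrow> bool" where
  "oscillation_bound \<beta> A b c \<longleftrightarrow> (\<forall>k x. \<forall>t>0.
     dcontent \<beta> {y \<in> dyadic_nbhd k x. t < \<bar>b y - c (k, dyadic_cube k x)\<bar>} \<le> ennreal (A / t * side_pow k \<beta>))"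

lemma oscillation_boundD:
  "oscillation_bound \<beta> A b c \<Longrightarrow> 0 < t \<Longrightarrow>
     dcontent \<beta> {y \<in> dyadic_nbhd k x. t < \<bar>b y - c (k, dyadic_cube k x)\<bar>} \<le> ennreal (A / t * side_pow k \<beta>)"
  by (auto simp: oscillation_bound_def simp del: times_divide_eq_left)

text \<open>Chebyshev's inequality: level sets decrease in s, so the content at t bounds the
  integrand from below on (0, t].\<close>

lemma choquet_markov:
  assumes "0 \<le> t" shows "ennreal t * hcontent \<beta> {x \<in> \<Omega>. g x > t} \<le> choquet \<beta> \<Omega> g"
proof -
  have "ennreal t * hcontent \<beta> {x \<in> \<Omega>. g x > t} = (\<integral>\<^sup>+s. hcontent \<beta> {x \<in> \<Omega>. g x > t} * indicator {0<..t} s \<partial>lborel)"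
    using assms by (subst nn_integral_cmult_indicator) (auto simp: mult.commute)
  also have "\<dots> \<le> choquet \<beta> \<Omega> g"
    unfolding choquet_def
  proof (rule nn_integral_mono)
    fix s
    have "s \<le> t \<Longrightarrow> hcontent \<beta> {x \<in> \<Omega>. g x > t} \<le> hcontent \<beta> {x \<in> \<Omega>. g x > s}"
      unfolding hcontent_def by (intro INF_superset_mono) force+
    then show "hcontent \<beta> {x \<in> \<Omega>. t < g x} * indicator {0<..t} s \<le> indicator {0<..} s * hcontent \<beta> {x \<in> \<Omega>. s < g x}"
      by (auto simp: indicator_def)
  qed
  finally show ?thesis .
qed

lemma bmo_oscillation_bound:
  assumes \<beta>: "0 < \<beta>"
  shows "\<exists>A>0. \<forall>(b::'a::euclidean_space \<Rightarrow> real) v. 0 < v \<longrightarrow> bmo_norm \<beta> b \<le> ennreal v \<longrightarrow> (\<exists>c. oscillation_bound \<beta> (A * v) b c)"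
proof -
  obtain C where C: "0 < C" "\<And>E::'a set. dcontent \<beta> E \<le> ennreal C * hcontent \<beta> E"
    using dcontent_le_hcontent[OF \<beta>] by auto
  \<comment> \<open>The neighbourhood lies in a cube of side 3 * 2^k, whence
    \<open>3 powr \<beta>\<close>. The factor 2 admits a constant that only nearly attains the
    infimum over c.\<close>
  define A where "A = C * (2 * 3 powr \<beta>)"
  have "\<exists>c. oscillation_bound \<beta> (A * v) b c" if v: "0 < v" and b: "bmo_norm \<beta> b \<le> ennreal v" for b :: "'a \<Rightarrow> real" and v
  proof -
    have ex: "\<exists>c. \<forall>t>0. dcontent \<beta> {y \<in> dyadic_nbhd k x. t < \<bar>b y - c\<bar>} \<le> ennreal (A * v / t * side_pow k \<beta>)" for k x
    proof -
      define l where "l = 3 * 2 powr real_of_int k"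
      define a where "a = dyadic_corner k x - 2 powr k *\<^sub>R One"
      have l: "0 < l" by (simp add: l_def)
      have "(INF c. ennreal (l powr - \<beta>) * choquet \<beta> (cube a l) (\<lambda>x. \<bar>b x - c\<bar>)) \<le> bmo_norm \<beta> b"
        unfolding bmo_norm_def using l by (intro SUP_upper2[of "(a, l)"]) auto
      also have "\<dots> \<le> ennreal v" by (rule b)
      also have "\<dots> < ennreal (2 * v)" using v by (intro ennreal_lessI) auto
      finally obtain c where "ennreal (l powr - \<beta>) * choquet \<beta> (cube a l) (\<lambda>x. \<bar>b x - c\<bar>) < ennreal (2 * v)"
        unfolding INF_less_iff by auto
      then have c: "ennreal (l powr - \<beta>) * choquet \<beta> (cube a l) (\<lambda>x. \<bar>b x - c\<bar>) \<le> ennreal (2 * v)" by simp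
      have "dcontent \<beta> {y \<in> dyadic_nbhd k x. t < \<bar>b y - c\<bar>} \<le> ennreal (A * v / t * side_pow k \<beta>)" if t: "0 < t" for t
      proof -
        let ?E = "{y \<in> cube a l. t < \<bar>b y - c\<bar>}"
        have "ennreal (l powr - \<beta> * t) * hcontent \<beta> ?E = ennreal (l powr - \<beta>) * (ennreal t * hcontent \<beta> ?E)"
          using t by (simp add: ennreal_mult mult.assoc)
        also have "\<dots> \<le> ennreal (l powr - \<beta>) * choquet \<beta> (cube a l) (\<lambda>x. \<bar>b x - c\<bar>)"
          using t by (intro mult_left_mono choquet_markov) auto
        also have "\<dots> \<le> ennreal (2 * v)" by (rule c)
        finally have le2: "ennreal (l powr - \<beta> * t) * hcontent \<beta> ?E \<le> ennreal (2 * v)" .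
        have hE: "hcontent \<beta> ?E \<le> ennreal (2 * v / (l powr - \<beta> * t))"
        proof -
          define d where "d = l powr - \<beta> * t"
          have d: "0 < d" using l t by (simp add: d_def)
          have "hcontent \<beta> ?E = ennreal (1 / d) * (ennreal d * hcontent \<beta> ?E)"
            using d by (simp add: mult.assoc[symmetric] flip: ennreal_mult)
          also have "\<dots> \<le> ennreal (1 / d) * ennreal (2 * v)"
            using le2 unfolding d_def by (rule mult_left_mono) simp
          also have "\<dots> = ennreal (1 / d * (2 * v))" using d v by (intro ennreal_mult[symmetric]) auto
          finally show ?thesis by (simp add: d_def)
        qed
        have "dcontent \<beta> {y \<in> dyadic_nbhd k x. t < \<bar>b y - c\<bar>} \<le> dcontent \<beta> ?E"
          using dyadic_nbhd_subset_cube[of k x] by (intro dcontent_mono) (auto simp: a_def l_def)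
        also have "\<dots> \<le> ennreal C * hcontent \<beta> ?E" by (rule C)
        also have "\<dots> \<le> ennreal C * ennreal (2 * v / (l powr - \<beta> * t))"
          by (rule mult_left_mono[OF hE]) simp
        also have "\<dots> = ennreal (A * v / t * side_pow k \<beta>)"
          using C t l v by (simp add: A_def l_def powr_mult powr_powr powr_minus field_simps flip: ennreal_mult)
        finally show ?thesis .
      qed
      then show ?thesis by blast
    qed
    \<comment> \<open>The mean must depend on the cube as a set, while \<open>ex\<close> speaks of a
      base point. Any point of the cube serves, because all of them have the same
      neighbourhood.\<close>
    define c where "c p = (SOME c. \<forall>t>0. dcontent \<beta> {y \<in> dyadic_nbhd (fst p) (SOME x. x \<in> snd p). t < \<bar>b y - c\<bar>} \<le> ennreal (A * v / t * side_pow (fst p) \<beta>))" for p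
    have "oscillation_bound \<beta> (A * v) b c"
      unfolding oscillation_bound_def
    proof (rule allI, rule allI)
      fix k :: int and x :: 'a
      define z where "z = (SOME z. z \<in> dyadic_cube k x)"
      have "z \<in> dyadic_cube k x" unfolding z_def by (rule someI[of _ x]) simp
      then have nb: "dyadic_nbhd k z = dyadic_nbhd k x" by (rule dyadic_nbhd_cong)
      show "\<forall>t>0. dcontent \<beta> {y \<in> dyadic_nbhd k x. t < \<bar>b y - c (k, dyadic_cube k x)\<bar>} \<le> ennreal (A * v / t * side_pow k \<beta>)"
        using someI_ex[OF ex[of k z]] unfolding c_def fst_conv snd_conv z_def[symmetric] nb by blast
    qed
    then show ?thesis by blast
  qed
  moreover have "0 < A" using C by (simp add: A_def)
  ultimately show ?thesis by blast
qed

lemma dyadic_cube_point: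
  fixes x :: "'a::euclidean_space"
  assumes "0 < \<beta>" "\<beta> \<le> real DIM('a)" "dcontent \<beta> B < ennreal (side_pow k \<beta>)"
  shows "\<exists>y\<in>dyadic_cube k x. y \<notin> B"
proof (rule ccontr)
  assume "\<not> ?thesis"
  then have "dcontent \<beta> (dyadic_cube k x) \<le> dcontent \<beta> B" by (intro dcontent_mono) auto
  with dcontent_dyadic_cube_ge[OF assms(1,2), of k x] assms(3) show False by simp
qed

text \<open>Both means are close to \<open>b\<close> off sets of small content, and these cannot
  exhaust the cube of level k, so some point there is close to both. The case m = k treats adjacent
  cubes, m = k + 1 the parent.\<close>

lemma oscillation_bound_diff:
  fixes x z :: "'a::euclidean_space"
  assumes \<beta>: "0 < \<beta>" "\<beta> \<le> real DIM('a)" and A: "0 < A" and b: "oscillation_bound \<beta> A b c"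
    and sub: "dyadic_cube k x \<subseteq> dyadic_nbhd m z" and m: "m \<le> k + 1"
  shows "\<bar>c (k, dyadic_cube k x) - c (m, dyadic_cube m z)\<bar> \<le> 4 * A * (1 + 2 powr \<beta>)"
proof -
  \<comment> \<open>At this level the two exceptional sets, of content at most A/t 2^(k \<beta>) and
    A/t 2^((k+1) \<beta>), together have at most half the content of the cube.\<close>
  define t where "t = 2 * A * (1 + 2 powr \<beta>)"
  have pos: "0 < 1 + 2 powr \<beta>" by (simp add: add_pos_pos)
  have t: "0 < t" using A pos by (simp add: t_def)
  define B1 where "B1 = {y \<in> dyadic_nbhd k x. t < \<bar>b y - c (k, dyadic_cube k x)\<bar>}"
  define B2 where "B2 = {y \<in> dyadic_nbhd m z. t < \<bar>b y - c (m, dyadic_cube m z)\<bar>}"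
  have "dcontent \<beta> (B1 \<union> B2) \<le> ennreal (A / t * side_pow k \<beta>) + ennreal (A / t * side_pow m \<beta>)"
    using b t unfolding B1_def B2_def oscillation_bound_def by (intro order_trans[OF dcontent_Un] add_mono) auto
  also have "\<dots> = ennreal (A / t * side_pow k \<beta> + A / t * side_pow m \<beta>)"
    using A t by (intro ennreal_plus[symmetric]) auto
  also have "\<dots> \<le> ennreal (A / t * side_pow k \<beta> + A / t * side_pow (k + 1) \<beta>)"
    using A t \<beta> m by (intro ennreal_leI add_left_mono mult_left_mono powr_mono_int) auto
  also have "A / t * side_pow k \<beta> + A / t * side_pow (k + 1) \<beta> = A * (1 + 2 powr \<beta>) / t * side_pow k \<beta>"
    by (simp add: algebra_simps powr_add add_divide_distrib)
  also have "A * (1 + 2 powr \<beta>) / t = 1 / 2" using A pos by (simp add: t_def)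
  also have "ennreal (1 / 2 * side_pow k \<beta>) < ennreal (side_pow k \<beta>)"
    by (intro ennreal_lessI) auto
  finally obtain y where y: "y \<in> dyadic_cube k x" "y \<notin> B1 \<union> B2"
    using dyadic_cube_point[OF \<beta>] by blast
  have "y \<in> dyadic_nbhd k x" "y \<in> dyadic_nbhd m z"
    using y(1) sub dyadic_cube_subset_nbhd by blast+
  with y(2) have "\<bar>b y - c (k, dyadic_cube k x)\<bar> \<le> t" "\<bar>b y - c (m, dyadic_cube m z)\<bar> \<le> t"
    by (auto simp: B1_def B2_def)
  then show ?thesis by (simp add: t_def)
qed

text \<open>Telescoping over successive parents, so the cost is linear in the number of generations,
  that is, logarithmic in the ratio of the sides.\<close>

lemma oscillation_bound_chain:
  fixes x :: "'a::euclidean_space"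
  assumes \<beta>: "0 < \<beta>" "\<beta> \<le> real DIM('a)" and A: "0 < A" and b: "oscillation_bound \<beta> A b c"
    and "k \<le> m"
  shows "\<bar>c (k, dyadic_cube k x) - c (m, dyadic_cube m x)\<bar> \<le> 4 * A * (1 + 2 powr \<beta>) * real_of_int (m - k)"
  using \<open>k \<le> m\<close>
proof (induction m rule: int_ge_induct)
  case (step m)
  have "dyadic_cube m x \<subseteq> dyadic_nbhd (m + 1) x"
    using dyadic_mono_Suc(1) dyadic_cube_subset_nbhd by blast
  from oscillation_bound_diff[OF \<beta> A b this order_refl] step.IH
  show ?case by (simp add: algebra_simps)
qed simp

text \<open>The distance the mean can move from a cube to a selected subcube: 16 A from the mean of
  the cube to the value of \<open>b\<close> at a suitable point, 4 A from there to the mean of the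
  subcube's parent, and the last summand from the parent to the subcube.\<close>

definition jn_const :: "real \<Rightarrow> real \<Rightarrow> real" where
  "jn_const \<beta> A = 20 * A + 4 * A * (1 + 2 powr \<beta>)"

lemma jn_const_pos: "0 < A \<Longrightarrow> 0 < jn_const \<beta> A"
  unfolding jn_const_def by (intro add_pos_pos mult_pos_pos) auto

text \<open>A cube is replaced by the maximal cubes that are heavy for a cover of the set where the
  oscillation exceeds a fixed level; the dyadic parent of such a cube is not heavy, so it contains
  points of small oscillation, which keeps the means on the new cubes under control.\<close>

lemma john_nirenberg_dyadic:
  fixes x :: "'a::euclidean_space"
  assumes \<beta>: "0 < \<beta>" "\<beta> \<le> real DIM('a)" and A: "0 < A" and b: "oscillation_bound \<beta> A b c"
  shows "dcontent \<beta> {y \<in> dyadic_cube k x. real m * jn_const \<beta> A < \<bar>b y - c (k, dyadic_cube k x)\<bar>}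
    \<le> ennreal ((1/2) ^ m * side_pow k \<beta>)"
proof (induction m arbitrary: k x)
  case 0
  have "dcontent \<beta> {y \<in> dyadic_cube k x. real 0 * jn_const \<beta> A < \<bar>b y - c (k, dyadic_cube k x)\<bar>} \<le> dcontent \<beta> (snd (k, dyadic_cube k x))"
    by (intro dcontent_mono) auto
  also have "\<dots> \<le> dyadic_weight \<beta> (k, dyadic_cube k x)" by (rule dcontent_dyadic_le) simp
  finally show ?case by (simp add: dyadic_weight_def)
next
  case (Suc m)
  define P0 where "P0 = dyadic_cube k x"
  define c0 where "c0 = c (k, P0)"
  \<comment> \<open>The level 16 A leaves content at most 2^(k \<beta>) / 16, strictly below
    \<open>W\<close>, so a cover of weight less than \<open>W\<close> exists. With density threshold
    1/4 the maximal heavy cubes have total weight at most 4 W, half that of the cube: this is the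
    factor 1/2 per step.\<close>
  define E where "E = {y \<in> P0. 16 * A < \<bar>b y - c0\<bar>}"
  define W where "W = 1/8 * side_pow k \<beta>"
  have "dcontent \<beta> E \<le> dcontent \<beta> {y \<in> dyadic_nbhd k x. 16 * A < \<bar>b y - c (k, dyadic_cube k x)\<bar>}"
    using dyadic_cube_subset_nbhd[of k x] by (intro dcontent_mono) (auto simp: E_def P0_def c0_def)
  also have "\<dots> \<le> ennreal (A / (16 * A) * side_pow k \<beta>)"
    using A by (intro oscillation_boundD[OF b]) simp
  also have "\<dots> < ennreal W" using A by (intro ennreal_lessI) (auto simp: W_def)
  finally obtain \<C> where C: "\<C> \<subseteq> dyadics" "E \<subseteq> \<Union>(snd ` \<C>)" "csum \<C> (dyadic_weight \<beta>) < ennreal W"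
    by (rule dcontent_lessE)
  \<comment> \<open>Cover cubes not inside \<open>P0\<close> are dropped, so that every heavy cube
    meets \<open>P0\<close> and, being of smaller level, lies in it.\<close>
  define w where "w q = dyadic_weight \<beta> q * indicator {q \<in> \<C>. snd q \<subseteq> P0} q" for q
  have wW: "csum dyadics w < ennreal W"
  proof -
    have "csum dyadics w \<le> csum UNIV w" by (rule csum_mono_set) simp
    also have "\<dots> \<le> csum UNIV (\<lambda>q. dyadic_weight \<beta> q * indicator \<C> q)"
      by (rule nn_integral_mono) (auto simp: w_def indicator_def)
    also have "\<dots> = csum \<C> (dyadic_weight \<beta>)" by (rule csum_indicator[symmetric])
    finally show ?thesis using C(3) by simp
  qed
  then have wW': "csum dyadics w \<le> ennreal W" by simp
  define H where "H = heavy \<beta> (1/4) w"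
  define M where "M = max_heavy \<beta> (1/4) w"
  have p0: "(k, P0) \<in> dyadics" by (simp add: P0_def)
  have small: "fst q < k" if "dyadic_weight \<beta> q \<le> ennreal (side_pow k \<beta> / 2)" for q :: "int \<times> 'a set"
  proof (rule ccontr)
    assume "\<not> fst q < k"
    then have "side_pow k \<beta> \<le> side_pow (fst q) \<beta>"
      using \<beta> by (intro powr_mono_int) auto
    moreover have "side_pow (fst q) \<beta> \<le> side_pow k \<beta> / 2"
      using that by (simp add: dyadic_weight_def)
    moreover have "0 < side_pow k \<beta>" by simp
    ultimately show False by linarith
  qed
  have cover: "\<exists>R\<in>\<C>. y \<in> snd R \<and> snd R \<subseteq> P0 \<and> R \<in> H" if y: "y \<in> E" for y
  proof -
    obtain R where R: "R \<in> \<C>" "y \<in> snd R" using C(2) y by auto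
    have Rd: "R \<in> dyadics" using C(1) R(1) by blast
    have "dyadic_weight \<beta> R \<le> csum \<C> (dyadic_weight \<beta>)"
      by (rule nn_integral_ge_point[OF R(1)])
    also have "\<dots> \<le> ennreal W" using C(3) by simp
    also have "\<dots> \<le> ennreal (side_pow k \<beta> / 2)" by (intro ennreal_leI) (simp add: W_def)
    finally have "fst R < k" by (rule small)
    then have sub: "snd R \<subseteq> P0"
      using dyadics_nested[OF Rd p0] R(2) y by (auto simp: E_def)
    \<comment> \<open>A cover cube has density at least 1 from its own weight alone.\<close>
    have "ennreal (1/4) * dyadic_weight \<beta> R \<le> 1 * dyadic_weight \<beta> R"
      by (intro mult_right_mono) (auto simp flip: ennreal_1)
    also have "\<dots> = w R" using R sub by (simp add: w_def)
    also have "\<dots> \<le> dyadic_mass w R"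
      unfolding dyadic_mass_def using Rd by (intro nn_integral_ge_point) (simp add: dyadic_le_def)
    finally have "R \<in> H" using Rd by (simp add: H_def heavy_def)
    then show ?thesis using R sub by blast
  qed
  have M: "q \<in> H" "q \<in> dyadics" "fst q < k" "snd q \<subseteq> P0" if q: "q \<in> M" for q
  proof -
    show qH: "q \<in> H" and qd: "q \<in> dyadics" using q by (auto simp: M_def H_def max_heavy_def heavy_def)
    have mass: "ennreal (1/4) * dyadic_weight \<beta> q \<le> dyadic_mass w q" using qH by (simp add: H_def heavy_def)
    also have "\<dots> \<le> ennreal W" using dyadic_mass_le wW' order_trans by blast
    finally have "dyadic_weight \<beta> q \<le> ennreal (side_pow k \<beta> / 2)"
      by (simp add: dyadic_weight_def W_def flip: ennreal_mult)
    then show less: "fst q < k" by (rule small)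
    have "\<exists>R\<in>dyadics. dyadic_le R q \<and> snd R \<subseteq> P0"
    proof (rule ccontr)
      assume "\<not> ?thesis"
      then have "dyadic_mass w q = csum {R \<in> dyadics. dyadic_le R q} (\<lambda>R. 0)"
        unfolding dyadic_mass_def by (intro nn_integral_cong) (auto simp: w_def indicator_def)
      then have "ennreal (1/4 * side_pow (fst q) \<beta>) \<le> 0"
        using mass by (simp add: dyadic_weight_def ennreal_mult)
      then show False by simp
    qed
    then obtain R where R: "R \<in> dyadics" "dyadic_le R q" "snd R \<subseteq> P0" by blast
    obtain z where "z \<in> snd R" using dyadics_nonempty[OF R(1)] by blast
    then have "z \<in> snd q" "z \<in> P0" using R by (auto simp: dyadic_le_def)
    then show "snd q \<subseteq> P0"
      using dyadics_nested[OF qd p0] less by auto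
  qed
  have shift: "\<bar>c q - c0\<bar> \<le> jn_const \<beta> A" if q: "q \<in> M" for q
  proof -
    obtain z where z: "z \<in> snd q" using dyadics_nonempty[OF M(2)[OF q]] by blast
    define l where "l = fst q"
    define Q where "Q = dyadic_cube (l + 1) z"
    have qe: "q = (l, dyadic_cube l z)" unfolding l_def by (rule dyadics_mem_eq[OF M(2)[OF q] z])
    have Qd: "(l + 1, Q) \<in> dyadics" by (simp add: Q_def)
    have QP: "Q \<subseteq> P0"
      using M(3,4)[OF q] z unfolding Q_def P0_def by (intro dyadic_cube_subset) (auto simp: l_def)
    have "(l + 1, Q) \<notin> H"
    proof
      assume "(l + 1, Q) \<in> H"
      moreover have "dyadic_le q (l + 1, Q)"
        unfolding dyadic_le_def qe Q_def using dyadic_mono_Suc by auto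
      ultimately have "(l + 1, Q) = q" using q by (auto simp: M_def H_def max_heavy_def)
      then show False using qe by simp
    qed
    then have mass: "dyadic_mass w (l + 1, Q) < ennreal (1/4) * dyadic_weight \<beta> (l + 1, Q)"
      using Qd by (auto simp: H_def heavy_def)
    define F where "F = {R \<in> \<C>. dyadic_le R (l + 1, Q) \<and> snd R \<subseteq> P0}"
    \<comment> \<open>A cover cube that contains a point of E and meets the parent \<open>Q\<close>
      lies below it: one containing \<open>Q\<close> would be heavy and strictly above the maximal
      cube \<open>q\<close>. Hence the small mass of \<open>Q\<close> bounds the content of all of
      \<open>Q \<inter> E\<close>.\<close>
    have "dcontent \<beta> (Q \<inter> E) \<le> csum F (dyadic_weight \<beta>)"
    proof (rule dcontent_le)
      show "F \<subseteq> dyadics" using C(1) by (auto simp: F_def)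
      show "Q \<inter> E \<subseteq> \<Union>(snd ` F)"
      proof
        fix y assume y: "y \<in> Q \<inter> E"
        then obtain R where R: "R \<in> \<C>" "y \<in> snd R" "snd R \<subseteq> P0" "R \<in> H" using cover by blast
        have Rd: "R \<in> dyadics" using R C(1) by blast
        have "dyadic_le R (l + 1, Q) \<or> dyadic_le (l + 1, Q) R"
          using dyadics_comparable[OF Rd Qd R(2)] y by simp
        moreover have "\<not> dyadic_le (l + 1, Q) R"
        proof
          assume a: "dyadic_le (l + 1, Q) R"
          then have "dyadic_le q R" unfolding dyadic_le_def qe Q_def using dyadic_mono_Suc by fastforce
          then have "R = q" using q R(4) by (auto simp: M_def H_def max_heavy_def)
          then show False using a by (simp add: dyadic_le_def qe)
        qed
        ultimately have "R \<in> F" using R by (simp add: F_def)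
        then show "y \<in> \<Union>(snd ` F)" using R(2) by blast
      qed
    qed
    also have "\<dots> = csum F w"
      by (intro nn_integral_cong) (auto simp: w_def F_def)
    also have "\<dots> \<le> dyadic_mass w (l + 1, Q)"
      unfolding dyadic_mass_def using C(1) by (intro csum_mono_set) (auto simp: F_def)
    also have "\<dots> \<le> ennreal (1/4) * dyadic_weight \<beta> (l + 1, Q)" using mass by simp
    also have "\<dots> = ennreal (1/4 * side_pow (l + 1) \<beta>)"
      by (simp add: dyadic_weight_def flip: ennreal_mult)
    finally have 1: "dcontent \<beta> (Q \<inter> E) \<le> ennreal (1/4 * side_pow (l + 1) \<beta>)" .
    \<comment> \<open>The level 4 A is chosen so that this second bad set also takes at most a
      quarter of the parent; a point outside both remains.\<close>
    define B where "B = {y \<in> dyadic_nbhd (l + 1) z. 4 * A < \<bar>b y - c (l + 1, Q)\<bar>}"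
    have 2: "dcontent \<beta> B \<le> ennreal (1/4 * side_pow (l + 1) \<beta>)"
    proof -
      have "dcontent \<beta> B \<le> ennreal (A / (4 * A) * side_pow (l + 1) \<beta>)"
        using A unfolding B_def Q_def by (intro oscillation_boundD[OF b]) simp
      then show ?thesis using A by simp
    qed
    have "dcontent \<beta> (Q \<inter> E \<union> B) \<le> ennreal (1/4 * side_pow (l + 1) \<beta>) + ennreal (1/4 * side_pow (l + 1) \<beta>)"
      by (rule order_trans[OF dcontent_Un add_mono[OF 1 2]])
    also have "\<dots> = ennreal (1/2 * side_pow (l + 1) \<beta>)"
      by (simp flip: ennreal_plus)
    also have "\<dots> < ennreal (side_pow (l + 1) \<beta>)" by (intro ennreal_lessI) auto
    finally obtain y where y: "y \<in> Q" "y \<notin> Q \<inter> E \<union> B"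
      using dyadic_cube_point[OF \<beta>] unfolding Q_def by blast
    have "y \<in> dyadic_nbhd (l + 1) z" using y(1) dyadic_cube_subset_nbhd by (auto simp: Q_def)
    then have "\<bar>b y - c (l + 1, Q)\<bar> \<le> 4 * A" using y(2) by (auto simp: B_def)
    moreover have "\<bar>b y - c0\<bar> \<le> 16 * A" using y QP by (auto simp: E_def)
    moreover have "\<bar>c q - c (l + 1, Q)\<bar> \<le> 4 * A * (1 + 2 powr \<beta>)"
      using oscillation_bound_chain[OF \<beta> A b, of l "l + 1" z] by (simp add: qe Q_def)
    ultimately show ?thesis by (simp add: jn_const_def)
  qed
  \<comment> \<open>The mean moves by at most \<open>jn_const \<beta> A\<close>, so an excess of m +
    1 units over the mean of \<open>P0\<close> leaves an excess of m units over the mean of the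
    selected subcube.\<close>
  have "{y \<in> P0. real (Suc m) * jn_const \<beta> A < \<bar>b y - c0\<bar>} \<subseteq> (\<Union>q\<in>M. {y \<in> snd q. real m * jn_const \<beta> A < \<bar>b y - c q\<bar>})"
  proof
    fix y assume "y \<in> {y \<in> P0. real (Suc m) * jn_const \<beta> A < \<bar>b y - c0\<bar>}"
    then have y: "y \<in> P0" "real (Suc m) * jn_const \<beta> A < \<bar>b y - c0\<bar>" by auto
    have "16 * A \<le> jn_const \<beta> A" using A by (auto simp: jn_const_def)
    also have "\<dots> \<le> real (Suc m) * jn_const \<beta> A" using jn_const_pos[OF A, of \<beta>] by simp
    finally have "y \<in> E" using y by (simp add: E_def)
    then obtain R where R: "y \<in> snd R" "R \<in> H" using cover by blast
    then obtain q where q: "q \<in> M" "dyadic_le R q"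
      using heavy_below_max[OF \<beta>(1) _ wW', of "1/4" R] unfolding H_def M_def by auto
    have "y \<in> snd q" using q(2) R(1) by (auto simp: dyadic_le_def)
    moreover have "real m * jn_const \<beta> A < \<bar>b y - c q\<bar>"
      using y(2) shift[OF q(1)] by (simp add: algebra_simps)
    ultimately show "y \<in> (\<Union>q\<in>M. {y \<in> snd q. real m * jn_const \<beta> A < \<bar>b y - c q\<bar>})" using q(1) by blast
  qed
  then have "dcontent \<beta> {y \<in> P0. real (Suc m) * jn_const \<beta> A < \<bar>b y - c0\<bar>}
      \<le> dcontent \<beta> (\<Union>q\<in>M. {y \<in> snd q. real m * jn_const \<beta> A < \<bar>b y - c q\<bar>})"
    by (rule dcontent_mono)
  also have "\<dots> \<le> csum M (\<lambda>q. dcontent \<beta> {y \<in> snd q. real m * jn_const \<beta> A < \<bar>b y - c q\<bar>})"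
    by (rule dcontent_UN, rule countable_subset[OF _ countable_dyadics]) (use M(2) in blast)
  also have "\<dots> \<le> csum M (\<lambda>q. ennreal ((1/2) ^ m) * dyadic_weight \<beta> q)"
  proof (rule nn_integral_mono)
    fix q assume "q \<in> space (count_space M)"
    then have "q \<in> dyadics" using M(2) by simp
    then obtain z where z: "q = (fst q, dyadic_cube (fst q) z)" and sq: "snd q = dyadic_cube (fst q) z"
      using dyadicsE by blast
    show "dcontent \<beta> {y \<in> snd q. real m * jn_const \<beta> A < \<bar>b y - c q\<bar>} \<le> ennreal ((1/2) ^ m) * dyadic_weight \<beta> q"
      using Suc.IH[of "fst q" z] unfolding z[symmetric]
      unfolding sq by (simp add: dyadic_weight_def flip: ennreal_mult)
  qed
  also have "\<dots> = ennreal ((1/2) ^ m) * csum M (dyadic_weight \<beta>)"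
    by (rule nn_integral_cmult) simp
  also have "\<dots> = ennreal ((1/2) ^ m * 4) * (ennreal (1/4) * csum M (dyadic_weight \<beta>))"
    by (simp add: mult.assoc[symmetric] flip: ennreal_mult)
  also have "\<dots> \<le> ennreal ((1/2) ^ m * 4) * ennreal W"
    unfolding M_def by (intro mult_left_mono max_heavy_sum wW') simp
  also have "\<dots> = ennreal ((1/2) ^ Suc m * side_pow k \<beta>)"
    by (simp add: W_def flip: ennreal_mult)
  finally show ?case by (simp add: P0_def c0_def)
qed

section \<open>Exponential integrability\<close>

lemma john_nirenberg_exp:
  fixes x :: "'a::euclidean_space"
  assumes \<beta>: "0 < \<beta>" "\<beta> \<le> real DIM('a)" and A: "0 < A" and b: "oscillation_bound \<beta> A b c" and t: "0 \<le> t"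
  shows "dcontent \<beta> {y \<in> dyadic_cube k x. t < \<bar>b y - c (k, dyadic_cube k x)\<bar>}
    \<le> ennreal (2 * 2 powr (- t / jn_const \<beta> A) * side_pow k \<beta>)"
proof -
  define J where "J = jn_const \<beta> A"
  have J: "0 < J" unfolding J_def by (rule jn_const_pos[OF A])
  \<comment> \<open>Rounding t down to a multiple of \<open>J\<close> loses at most one halving,
    hence the factor 2 in the bound.\<close>
  define m where "m = nat \<lfloor>t / J\<rfloor>"
  have m: "real m \<le> t / J" "t / J < real m + 1" using t J by (auto simp: m_def)
  have "real m * J \<le> t" using m J by (simp add: field_simps)
  then have "dcontent \<beta> {y \<in> dyadic_cube k x. t < \<bar>b y - c (k, dyadic_cube k x)\<bar>}
     \<le> dcontent \<beta> {y \<in> dyadic_cube k x. real m * J < \<bar>b y - c (k, dyadic_cube k x)\<bar>}"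
    by (intro dcontent_mono) auto
  also have "\<dots> \<le> ennreal ((1/2) ^ m * side_pow k \<beta>)"
    unfolding J_def by (rule john_nirenberg_dyadic[OF \<beta> A b])
  also have "\<dots> \<le> ennreal (2 * 2 powr (- t / J) * side_pow k \<beta>)"
  proof (intro ennreal_leI mult_right_mono)
    have "(1/2::real) ^ m = 2 powr (- real m)" by (simp add: powr_minus powr_realpow power_one_over inverse_eq_divide)
    also have "\<dots> \<le> 2 powr (1 + - t / J)" using m by (intro powr_mono) auto
    also have "\<dots> = 2 * 2 powr (- t / J)" by (simp only: powr_add powr_one zero_le_numeral)
    finally show "(1/2::real) ^ m \<le> 2 * 2 powr (- t / J)" .
  qed simp
  finally show ?thesis by (simp add: J_def)
qed

lemma nn_integral_dyadic_nbhd_le: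
  fixes g :: "'a::euclidean_space \<Rightarrow> ennreal"
  assumes g: "g \<in> borel_measurable lebesgue"
    and le: "\<And>z. z \<in> dyadic_nbhd k x \<Longrightarrow> (\<integral>\<^sup>+y\<in>dyadic_cube k z. g y \<partial>lebesgue) \<le> B"
  shows "(\<integral>\<^sup>+y\<in>dyadic_nbhd k x. g y \<partial>lebesgue) \<le> ennreal (3 ^ DIM('a)) * B"
proof -
  define F where "F = {P. (k, P) \<in> dyadics \<and> P \<subseteq> dyadic_nbhd k x}"
  have fin: "finite F" unfolding F_def by (rule dyadic_neighbours)
  have "(\<integral>\<^sup>+y\<in>dyadic_nbhd k x. g y \<partial>lebesgue) \<le> (\<integral>\<^sup>+y. (\<Sum>P\<in>F. g y * indicator P y) \<partial>lebesgue)"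
  proof (rule nn_integral_mono)
    fix y
    show "g y * indicator (dyadic_nbhd k x) y \<le> (\<Sum>P\<in>F. g y * indicator P y)"
    proof (cases "y \<in> dyadic_nbhd k x")
      case True
      then have "dyadic_cube k y \<in> F" unfolding F_def using dyadic_cube_subset_nbhd' by auto
      then have "g y * indicator (dyadic_cube k y) y \<le> (\<Sum>P\<in>F. g y * indicator P y)"
        using fin by (intro member_le_sum) auto
      then show ?thesis by (simp add: True)
    qed simp
  qed
  also have "\<dots> = (\<Sum>P\<in>F. (\<integral>\<^sup>+y\<in>P. g y \<partial>lebesgue))"
  proof (rule nn_integral_sum)
    fix P assume "P \<in> F"
    then have "P \<in> sets lebesgue" using dyadics_snd_borel[of "(k, P)"] by (auto simp: F_def)
    then show "(\<lambda>y. g y * indicator P y) \<in> borel_measurable lebesgue" using g by measurable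
  qed
  also have "\<dots> \<le> (\<Sum>P\<in>F. B)"
  proof (rule sum_mono)
    fix P assume P: "P \<in> F"
    then obtain z where "P = dyadic_cube k z" by (auto simp: F_def dyadics_def)
    moreover have "z \<in> dyadic_nbhd k x" using P calculation by (auto simp: F_def)
    ultimately show "(\<integral>\<^sup>+y\<in>P. g y \<partial>lebesgue) \<le> B" using le by simp
  qed
  also have "\<dots> = of_nat (card F) * B" by simp
  also have "\<dots> \<le> ennreal (3 ^ DIM('a)) * B"
  proof (rule mult_right_mono)
    have "real (card F) \<le> 3 ^ DIM('a)"
      using dyadic_neighbours(2)[of k x] unfolding F_def by (metis of_nat_le_iff of_nat_numeral of_nat_power)
    then show "of_nat (card F) \<le> ennreal (3 ^ DIM('a))"
      by (metis ennreal_leI ennreal_of_nat_eq_real_of_nat)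
  qed simp
  finally show ?thesis .
qed

text \<open>The exponent is half the John--Nirenberg rate: on the m-th layer the exponential is at
  most sqrt 2 to the power m + 1 while the measure decays like 2^-m, so the layers sum
  geometrically. On an adjacent cube the mean is first exchanged for its own, at the cost
  \<open>A3\<close>.\<close>

lemma exp_integral_nbhd:
  assumes \<beta>: "0 < \<beta>" "\<beta> \<le> real DIM('a)" and A: "0 < A"
  shows "\<exists>C>0. \<forall>(b::'a::euclidean_space \<Rightarrow> real) c k x. b \<in> borel_measurable lebesgue \<longrightarrow> oscillation_bound \<beta> A b c \<longrightarrow>
     (\<integral>\<^sup>+y\<in>dyadic_nbhd k x. ennreal (exp (ln 2 / (2 * jn_const \<beta> A) * \<bar>b y - c (k, dyadic_cube k x)\<bar>)) \<partial>lebesgue)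
       \<le> ennreal (C * side_pow k (DIM('a)))"
proof -
  define J where "J = jn_const \<beta> A"
  have J: "0 < J" unfolding J_def by (rule jn_const_pos[OF A])
  define \<kappa> where "\<kappa> = ln 2 / (2 * J)"
  have \<kappa>: "0 < \<kappa>" using J by (simp add: \<kappa>_def)
  define r where "r = sqrt (2::real)"
  have r: "1 < r" "r < 2" by (auto simp: r_def real_less_lsqrt)
  have expr: "exp (\<kappa> * J) = r"
  proof -
    have "exp (\<kappa> * J) = exp (ln 2 / 2)" using J by (simp add: \<kappa>_def)
    also have "\<dots> = 2 powr (1/2)" by (simp add: powr_def)
    finally show ?thesis by (simp add: r_def powr_half_sqrt)
  qed
  define A3 where "A3 = 4 * A * (1 + 2 powr \<beta>)"
  define S where "S = r / (1 - r / 2)"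
  define C where "C = exp (\<kappa> * A3) * 3 ^ DIM('a) * (1 + S)"
  have S: "0 < S" using r by (simp add: S_def)
  have "(\<integral>\<^sup>+y\<in>dyadic_nbhd k x. ennreal (exp (\<kappa> * \<bar>b y - c (k, dyadic_cube k x)\<bar>)) \<partial>lebesgue)
       \<le> ennreal (C * side_pow k (DIM('a)))"
    if bm [measurable]: "b \<in> borel_measurable lebesgue" and b: "oscillation_bound \<beta> A b c" for b :: "'a \<Rightarrow> real" and c k x
  proof -
    have "(\<integral>\<^sup>+y\<in>dyadic_cube k z. ennreal (exp (\<kappa> * \<bar>b y - c (k, dyadic_cube k x)\<bar>)) \<partial>lebesgue)
      \<le> ennreal (exp (\<kappa> * A3) * (1 + S) * side_pow k (DIM('a)))" if z: "z \<in> dyadic_nbhd k x" for z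
    proof -
      define v where "v y = \<bar>b y - c (k, dyadic_cube k z)\<bar>" for y
      have [measurable]: "v \<in> borel_measurable lebesgue" unfolding v_def by measurable
      define E where "E m = {y \<in> dyadic_cube k z. real m * J < v y}" for m :: nat
      have Em [measurable]: "E m \<in> sets lebesgue" for m
      proof -
        have "{y \<in> space lebesgue. real m * J < v y} \<in> sets lebesgue" by measurable
        moreover have "dyadic_cube k z \<in> sets lebesgue" by simp
        ultimately have "{y \<in> space lebesgue. real m * J < v y} \<inter> dyadic_cube k z \<in> sets lebesgue" by (rule sets.Int)
        moreover have "{y \<in> space lebesgue. real m * J < v y} \<inter> dyadic_cube k z = E m" by (auto simp: E_def)
        ultimately show ?thesis by simp
      qed
      have c: "\<bar>c (k, dyadic_cube k z) - c (k, dyadic_cube k x)\<bar> \<le> A3"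
        unfolding A3_def by (rule oscillation_bound_diff[OF \<beta> A b]) (use z dyadic_cube_subset_nbhd' in auto)
      \<comment> \<open>Layer decomposition: a value \<open>v y\<close> in (m J, (m+1) J] puts y
        into \<open>E m\<close>. The separate indicator of the cube accounts for
        \<open>v y = 0\<close>, which belongs to no layer.\<close>
      have pt: "ennreal (exp (\<kappa> * \<bar>b y - c (k, dyadic_cube k x)\<bar>)) * indicator (dyadic_cube k z) y
         \<le> ennreal (exp (\<kappa> * A3)) * (indicator (dyadic_cube k z) y + (\<Sum>m. ennreal (r ^ Suc m) * indicator (E m) y))" for y
      proof (cases "y \<in> dyadic_cube k z")
        case True
        have "\<bar>b y - c (k, dyadic_cube k x)\<bar> \<le> A3 + v y" using c by (simp add: v_def)
        then have "exp (\<kappa> * \<bar>b y - c (k, dyadic_cube k x)\<bar>) \<le> exp (\<kappa> * (A3 + v y))" using \<kappa> by simp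
        also have "\<dots> = exp (\<kappa> * A3) * exp (\<kappa> * v y)" by (simp add: algebra_simps exp_add)
        finally have 1: "ennreal (exp (\<kappa> * \<bar>b y - c (k, dyadic_cube k x)\<bar>)) \<le> ennreal (exp (\<kappa> * A3)) * ennreal (exp (\<kappa> * v y))"
          by (simp flip: ennreal_mult)
        have 2: "ennreal (exp (\<kappa> * v y)) \<le> 1 + (\<Sum>m. ennreal (r ^ Suc m) * indicator (E m) y)"
        proof (cases "v y = 0")
          case False
          then have vy: "0 < v y" by (simp add: v_def)
          define m where "m = nat (\<lceil>v y / J\<rceil> - 1)"
          have pos: "0 < \<lceil>v y / J\<rceil>" using vy J by simp
          then have "real m = real_of_int \<lceil>v y / J\<rceil> - 1" by (simp add: m_def)
          then have "real m < v y / J" "v y / J \<le> real m + 1" by linarith+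
          then have m: "real m * J < v y" "v y \<le> real (Suc m) * J" using J by (auto simp: field_simps)
          have "exp (\<kappa> * v y) \<le> exp (\<kappa> * (real (Suc m) * J))" using m \<kappa> by simp
          also have "\<dots> = exp (real (Suc m) * (\<kappa> * J))" by (simp add: mult_ac)
          also have "\<dots> = exp (\<kappa> * J) ^ Suc m" by (rule exp_of_nat_mult)
          also have "\<dots> = r ^ Suc m" by (simp add: expr)
          finally have "ennreal (exp (\<kappa> * v y)) \<le> ennreal (r ^ Suc m) * indicator (E m) y"
            using True m by (simp add: E_def ennreal_leI)
          also have "\<dots> \<le> (\<Sum>m. ennreal (r ^ Suc m) * indicator (E m) y)"
          proof -
            define f where "f = (\<lambda>m. ennreal (r ^ Suc m) * indicator (E m) y)"
            have "f m \<le> suminf f" using sum_le_suminf[of f "{m}"] by simp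
            then show ?thesis by (simp only: f_def)
          qed
          finally show ?thesis by (simp add: add_increasing)
        qed (simp add: v_def)
        show ?thesis using order_trans[OF 1 mult_left_mono[OF 2]] True by simp
      qed simp
      have "(\<integral>\<^sup>+y\<in>dyadic_cube k z. ennreal (exp (\<kappa> * \<bar>b y - c (k, dyadic_cube k x)\<bar>)) \<partial>lebesgue)
         \<le> (\<integral>\<^sup>+y. ennreal (exp (\<kappa> * A3)) * (indicator (dyadic_cube k z) y + (\<Sum>m. ennreal (r ^ Suc m) * indicator (E m) y)) \<partial>lebesgue)"
        by (rule nn_integral_mono) (rule pt)
      also have "\<dots> = ennreal (exp (\<kappa> * A3)) * (emeasure lebesgue (dyadic_cube k z) + (\<Sum>m. ennreal (r ^ Suc m) * emeasure lebesgue (E m)))"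
      proof -
        have mi: "indicator (dyadic_cube k z) \<in> borel_measurable lebesgue"
          by (rule borel_measurable_indicator) simp
        have mE: "(\<lambda>y. ennreal (r ^ Suc m) * indicator (E m) y) \<in> borel_measurable lebesgue" for m
          by measurable
        have ms: "(\<lambda>y. \<Sum>m. ennreal (r ^ Suc m) * indicator (E m) y) \<in> borel_measurable lebesgue"
          using mE by (rule borel_measurable_suminf_order)
        have "(\<integral>\<^sup>+y. (\<Sum>m. ennreal (r ^ Suc m) * indicator (E m) y) \<partial>lebesgue) = (\<Sum>m. \<integral>\<^sup>+y\<in>E m. ennreal (r ^ Suc m) \<partial>lebesgue)"
          using mE by (rule nn_integral_suminf)
        also have "\<dots> = (\<Sum>m. ennreal (r ^ Suc m) * emeasure lebesgue (E m))"
          using Em by (intro suminf_cong nn_integral_cmult_indicator)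
        finally have e: "(\<integral>\<^sup>+y. (\<Sum>m. ennreal (r ^ Suc m) * indicator (E m) y) \<partial>lebesgue) = (\<Sum>m. ennreal (r ^ Suc m) * emeasure lebesgue (E m))" .
        have i: "(\<integral>\<^sup>+y. indicator (dyadic_cube k z) y \<partial>lebesgue) = emeasure lebesgue (dyadic_cube k z)"
          by (rule nn_integral_indicator) simp
        show ?thesis
          unfolding nn_integral_cmult[OF borel_measurable_add[OF mi ms]] nn_integral_add[OF mi ms] e i ..
      qed
      also have "\<dots> \<le> ennreal (exp (\<kappa> * A3)) * (ennreal (side_pow k (DIM('a))) + ennreal (S * side_pow k (DIM('a))))"
      proof (intro mult_left_mono add_mono)
        have "ennreal (r ^ Suc m) * emeasure lebesgue (E m) \<le> ennreal (r * (r/2) ^ m * side_pow k (DIM('a)))" for m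
        proof -
          have "emeasure lebesgue (E m) \<le> ennreal (side_pow k (DIM('a) - \<beta>)) * dcontent \<beta> (E m)"
            by (rule emeasure_le_dcontent[OF \<beta> Em, of m k z]) (auto simp: E_def)
          also have "\<dots> \<le> ennreal (side_pow k (DIM('a) - \<beta>)) * ennreal ((1/2) ^ m * side_pow k \<beta>)"
            using john_nirenberg_dyadic[OF \<beta> A b, of k z m] by (intro mult_left_mono) (auto simp: E_def J_def v_def)
          also have "\<dots> = ennreal ((1/2) ^ m * side_pow k (DIM('a)))"
            by (simp add: algebra_simps flip: ennreal_mult powr_add)
          finally have "ennreal (r ^ Suc m) * emeasure lebesgue (E m) \<le> ennreal (r ^ Suc m) * ennreal ((1/2) ^ m * side_pow k (DIM('a)))"
            by (rule mult_left_mono) simp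
          also have "\<dots> = ennreal (r * (r/2) ^ m * side_pow k (DIM('a)))"
            using r by (simp add: power_divide flip: ennreal_mult)
          finally show ?thesis .
        qed
        then have "(\<Sum>m. ennreal (r ^ Suc m) * emeasure lebesgue (E m)) \<le> (\<Sum>m. ennreal (r * (r/2) ^ m * side_pow k (DIM('a))))"
          by (intro suminf_le) auto
        also have "\<dots> = ennreal (S * side_pow k (DIM('a)))"
        proof (rule suminf_ennreal_eq)
          have "(\<lambda>m. (r/2) ^ m) sums (1 / (1 - r/2))" using r by (intro geometric_sums) auto
          from sums_mult2[OF sums_mult[OF this, of r], of "side_pow k (DIM('a))"]
          show "(\<lambda>m. r * (r/2) ^ m * side_pow k (DIM('a))) sums (S * side_pow k (DIM('a)))"
            by (simp add: S_def)
        qed (use r in simp)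
        finally show "(\<Sum>m. ennreal (r ^ Suc m) * emeasure lebesgue (E m)) \<le> ennreal (S * side_pow k (DIM('a)))" .
      qed (simp_all add: emeasure_dyadic_cube[simplified])
      also have "\<dots> = ennreal (exp (\<kappa> * A3) * (1 + S) * side_pow k (DIM('a)))"
        using S by (simp add: algebra_simps flip: ennreal_mult ennreal_plus)
      finally show ?thesis .
    qed
    then have "(\<integral>\<^sup>+y\<in>dyadic_nbhd k x. ennreal (exp (\<kappa> * \<bar>b y - c (k, dyadic_cube k x)\<bar>)) \<partial>lebesgue)
       \<le> ennreal (3 ^ DIM('a)) * ennreal (exp (\<kappa> * A3) * (1 + S) * side_pow k (DIM('a)))"
      by (intro nn_integral_dyadic_nbhd_le) auto
    also have "\<dots> = ennreal (C * side_pow k (DIM('a)))"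
      using S by (simp add: C_def mult_ac flip: ennreal_mult)
    finally show ?thesis .
  qed
  moreover have "0 < C" unfolding C_def using S by (intro mult_pos_pos) auto
  ultimately show ?thesis unfolding \<kappa>_def J_def by blast
qed

subsection \<open>Covers of level sets\<close>

text \<open>A discrete stand-in for the Choquet integral: the cost of the cover at height 2^j is
  counted with the factor 2^j. Sums over the cubes of all these covers replace the non-additive
  integral in the estimates for \<open>h\<close>.\<close>

definition level_cover :: "real \<Rightarrow> ('a::euclidean_space \<Rightarrow> real) \<Rightarrow> (int \<Rightarrow> (int \<times> 'a set) set) \<Rightarrow> real \<Rightarrow> bool" where
  "level_cover \<beta> h \<C> N \<longleftrightarrow> (\<forall>j. \<C> j \<subseteq> dyadics \<and> {y. 2 powr real_of_int j < h y} \<subseteq> \<Union>(snd ` \<C> j)) \<and>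
     (csum UNIV (\<lambda>j. csum (\<C> j) (\<lambda>p. ennreal (2 powr real_of_int j) * dyadic_weight \<beta> p))) \<le> ennreal N"

lemma dyadic_level_exists:
  assumes "0 < (v::real)" shows "\<exists>j::int. 2 powr real_of_int j < v \<and> v \<le> 2 * 2 powr real_of_int j"
proof
  define j where "j = \<lceil>log 2 v\<rceil> - 1"
  have "real_of_int j < log 2 v" "log 2 v \<le> real_of_int j + 1" unfolding j_def by linarith+
  then have "2 powr real_of_int j < 2 powr log 2 v" "2 powr log 2 v \<le> 2 powr (real_of_int j + 1)" by auto
  then show "2 powr real_of_int j < v \<and> v \<le> 2 * 2 powr real_of_int j"
    using assms by (simp add: powr_add)
qed

text \<open>The content H(s) of the level sets decreases in s, so it is at least H(2^j) on (2^(j-1),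
  2^j]. These intervals are disjoint and have length 2^(j-1), which accounts for the factor
  2.\<close>

lemma choquet_dyadic_levels:
  "csum UNIV (\<lambda>j. ennreal (2 powr real_of_int j) * hcontent \<beta> {x \<in> \<Omega>. 2 powr real_of_int j < g x}) \<le> 2 * choquet \<beta> \<Omega> g"
proof -
  define H where "H s = hcontent \<beta> {x \<in> \<Omega>. s < g x}" for s
  have Hmono: "H t \<le> H s" if "s \<le> t" for s t
    unfolding H_def hcontent_def using that by (intro INF_superset_mono) force+
  define I where "I j = {2 powr (real_of_int j - 1)<..2 powr real_of_int j}" for j :: int
  have I: "ennreal (2 powr real_of_int j) = 2 * emeasure lborel (I j)" for j
  proof -
    have "2 powr (real_of_int j - 1) = 2 powr real_of_int j / 2" by (simp add: powr_diff)
    then have I: "emeasure lborel (I j) = ennreal (2 powr real_of_int j / 2)"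
      unfolding I_def by simp
    have "ennreal 2 * ennreal (2 powr real_of_int j / 2) = ennreal (2 powr real_of_int j)"
      by (subst ennreal_mult[symmetric]) auto
    then show ?thesis unfolding I by simp
  qed
  have "csum UNIV (\<lambda>j. ennreal (2 powr real_of_int j) * H (2 powr real_of_int j))
      = csum UNIV (\<lambda>j. 2 * (\<integral>\<^sup>+s. H (2 powr real_of_int j) * indicator (I j) s \<partial>lborel))"
    by (intro nn_integral_cong) (subst nn_integral_cmult_indicator, auto simp: I I_def mult_ac)
  also have "\<dots> = 2 * csum UNIV (\<lambda>j. \<integral>\<^sup>+s. H (2 powr real_of_int j) * indicator (I j) s \<partial>lborel)"
    by (rule nn_integral_cmult) simp
  also have "csum UNIV (\<lambda>j. \<integral>\<^sup>+s. H (2 powr real_of_int j) * indicator (I j) s \<partial>lborel)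
      = (\<integral>\<^sup>+s. csum UNIV (\<lambda>j. H (2 powr real_of_int j) * indicator (I j) s) \<partial>lborel)"
    by (rule nn_integral_count_space_nn_integral[symmetric]) (auto simp: I_def)
  also have "\<dots> \<le> choquet \<beta> \<Omega> g"
    unfolding choquet_def H_def[symmetric]
  proof (rule nn_integral_mono)
    fix s :: real
    have "csum UNIV (\<lambda>j. H (2 powr real_of_int j) * indicator (I j) s)
        \<le> csum UNIV (\<lambda>j. (indicator {0<..} s * H s) * indicator {j. s \<in> I j} j)"
    proof (rule nn_integral_mono)
      fix j
      have "s \<in> I j \<Longrightarrow> 0 < s" unfolding I_def using order_less_trans[of 0 "2 powr (real_of_int j - 1)" s] by simp
      then show "H (2 powr real_of_int j) * indicator (I j) s \<le> (indicator {0<..} s * H s) * indicator {j. s \<in> I j} j"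
        by (auto simp: indicator_def I_def intro: Hmono)
    qed
    also have "\<dots> = (indicator {0<..} s * H s) * csum UNIV (\<lambda>j. indicator {j. s \<in> I j} j)"
      by (rule nn_integral_cmult) simp
    also have "\<dots> \<le> (indicator {0<..} s * H s) * 1"
    proof (intro mult_left_mono csum_at_most_one)
      fix i j assume s: "s \<in> I i" "s \<in> I j"
      have "i \<le> j" if "s \<in> I i" "s \<in> I j" for i j
      proof -
        have "2 powr (real_of_int i - 1) < 2 powr real_of_int j"
          using that unfolding I_def greaterThanAtMost_iff by linarith
        then have "real_of_int i - 1 < real_of_int j" by (subst (asm) powr_less_cancel_iff) auto
        then show ?thesis by linarith
      qed
      from this[OF s] this[OF s(2,1)] show "i = j" by simp
    qed simp
    finally show "csum UNIV (\<lambda>j. H (2 powr real_of_int j) * indicator (I j) s) \<le> indicator {0<..} s * H s" by simp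
  qed
  finally show ?thesis by (simp add: H_def mult_left_mono)
qed

lemma level_cover_exists:
  assumes \<beta>: "0 < \<beta>"
  shows "\<exists>C>0. \<forall>(h::'a::euclidean_space \<Rightarrow> real) I. choquet \<beta> UNIV h < ennreal I \<longrightarrow> (\<exists>\<C>. level_cover \<beta> h \<C> (C * I))"
proof -
  obtain C where C: "0 < C" "\<And>E::'a set. dcontent \<beta> E \<le> ennreal C * hcontent \<beta> E"
    using dcontent_le_hcontent[OF \<beta>] by auto
  have "\<exists>\<C>. level_cover \<beta> h \<C> ((2 * C + 1) * I)" if I: "choquet \<beta> UNIV h < ennreal I" for h :: "'a \<Rightarrow> real" and I
  proof -
    have Ipos: "0 < I" using I by (metis ennreal_neg not_gr_zero not_le not_less_zero)
    define H where "H j = hcontent \<beta> {x. 2 powr real_of_int j < h x}" for j :: int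
    \<comment> \<open>Multiplied by 2^j these errors sum to I. The strict bound on the Choquet
      integral gives I > 0, so every error is positive.\<close>
    define e where "e j = I * (1/2) ^ Suc (to_nat_on UNIV j) / 2 powr real_of_int j" for j :: int
    have sumH: "csum UNIV (\<lambda>j. ennreal (2 powr real_of_int j) * H j) \<le> ennreal (2 * I)"
    proof -
      have "csum UNIV (\<lambda>j. ennreal (2 powr real_of_int j) * H j) \<le> 2 * choquet \<beta> UNIV h"
        using choquet_dyadic_levels[of \<beta> UNIV h] by (simp add: H_def)
      also have "\<dots> \<le> 2 * ennreal I" using I by (intro mult_left_mono) auto
      also have "\<dots> = ennreal (2 * I)" using Ipos by (simp add: ennreal_mult)
      finally show ?thesis .
    qed
    have "\<exists>\<C>. \<C> \<subseteq> dyadics \<and> {y. 2 powr real_of_int j < h y} \<subseteq> \<Union>(snd ` \<C>) \<and>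
       (csum \<C> (dyadic_weight \<beta>)) \<le> ennreal C * H j + ennreal (e j)" for j
    proof -
      have "ennreal (2 powr real_of_int j) * H j \<le> ennreal (2 * I)"
        using nn_integral_ge_point[of j UNIV "\<lambda>j. ennreal (2 powr real_of_int j) * H j"] sumH by simp
      then have "H j < \<infinity>" by (auto simp: less_top[symmetric] top_unique ennreal_mult_top)
      then have fin: "ennreal C * H j < \<infinity>" by (simp add: ennreal_mult_less_top)
      have "dcontent \<beta> {y. 2 powr real_of_int j < h y} \<le> ennreal C * H j" unfolding H_def by (rule C)
      also have "\<dots> < ennreal C * H j + ennreal (e j)"
        using fin Ipos by (simp add: e_def ennreal_add_left_cancel_less[of _ 0, simplified])
      finally show ?thesis by (elim dcontent_lessE) (auto intro: less_imp_le)
    qed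
    then obtain \<C> where cov: "\<And>j. \<C> j \<subseteq> dyadics" "\<And>j. {y. 2 powr real_of_int j < h y} \<subseteq> \<Union>(snd ` \<C> j)"
      and w: "\<And>j. (csum (\<C> j) (dyadic_weight \<beta>)) \<le> ennreal C * H j + ennreal (e j)"
      by metis
    have "csum UNIV (\<lambda>j. csum (\<C> j) (\<lambda>p. ennreal (2 powr real_of_int j) * dyadic_weight \<beta> p))
       \<le> csum UNIV (\<lambda>j. ennreal C * (ennreal (2 powr real_of_int j) * H j) + ennreal (I * (1/2) ^ Suc (to_nat_on UNIV j)))"
    proof (rule nn_integral_mono)
      fix j :: int
      have "csum (\<C> j) (\<lambda>p. ennreal (2 powr real_of_int j) * dyadic_weight \<beta> p)
         = ennreal (2 powr real_of_int j) * csum (\<C> j) (dyadic_weight \<beta>)"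
        by (rule nn_integral_cmult) simp
      also have "\<dots> \<le> ennreal (2 powr real_of_int j) * (ennreal C * H j + ennreal (e j))"
        by (intro mult_left_mono w) simp
      also have "\<dots> = ennreal C * (ennreal (2 powr real_of_int j) * H j) + ennreal (2 powr real_of_int j * e j)"
        using Ipos by (simp add: distrib_left mult_ac e_def flip: ennreal_mult)
      finally show "csum (\<C> j) (\<lambda>p. ennreal (2 powr real_of_int j) * dyadic_weight \<beta> p)
         \<le> ennreal C * (ennreal (2 powr real_of_int j) * H j) + ennreal (I * (1/2) ^ Suc (to_nat_on UNIV j))"
        by (simp add: e_def)
    qed
    also have "\<dots> = ennreal C * csum UNIV (\<lambda>j. ennreal (2 powr real_of_int j) * H j)
        + csum (UNIV::int set) (\<lambda>j. ennreal (I * (1/2) ^ Suc (to_nat_on UNIV j)))"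
      by (subst nn_integral_add) (auto intro!: nn_integral_cmult)
    also have "\<dots> \<le> ennreal C * ennreal (2 * I) + ennreal I"
      by (intro add_mono mult_left_mono sumH csum_half_powers) auto
    also have "\<dots> = ennreal ((2 * C + 1) * I)"
      using C Ipos by (simp add: algebra_simps flip: ennreal_mult ennreal_plus)
    finally show ?thesis unfolding level_cover_def using cov by blast
  qed
  moreover have "0 < 2 * C + 1" using C by simp
  ultimately show ?thesis by blast
qed

lemma borel_measurable_csum:
  fixes f :: "'i \<Rightarrow> 'b \<Rightarrow> ennreal"
  assumes I: "countable I" and f: "\<And>i. i \<in> I \<Longrightarrow> f i \<in> borel_measurable M"
  shows "(\<lambda>x. csum I (\<lambda>i. f i x)) \<in> borel_measurable M"
proof -
  define g where "g n x = (if n \<in> to_nat_on I ` I then f (from_nat_into I n) x else 0)" for n x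
  have "csum I (\<lambda>i. f i x) = (\<Sum>n. g n x)" for x
  proof -
    have "csum I (\<lambda>i. f i x) = csum I (\<lambda>i. g (to_nat_on I i) x)"
      using I by (intro nn_integral_cong) (auto simp: g_def)
    also have "\<dots> = csum (to_nat_on I ` I) (\<lambda>n. g n x)"
      by (rule nn_integral_bij_count_space) (simp add: I bij_betw_def inj_on_to_nat_on)
    also have "\<dots> = csum UNIV (\<lambda>n. g n x)"
      by (rule nn_integral_count_space_eq) (auto simp: g_def)
    finally show ?thesis by (simp add: nn_integral_count_space_nat)
  qed
  moreover have "g n \<in> borel_measurable M" for n
  proof (cases "n \<in> to_nat_on I ` I")
    case True
    then have "from_nat_into I n \<in> I" using I by auto
    then show ?thesis using True f by (simp add: g_def[abs_def])
  qed (simp add: g_def[abs_def])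
  ultimately show ?thesis by simp
qed

lemma csum_Sigma:
  fixes f :: "'b \<Rightarrow> 'c \<Rightarrow> ennreal"
  shows "csum UNIV (\<lambda>j. csum (B j) (\<lambda>q. f j q)) = csum (Sigma UNIV B) (\<lambda>z. f (fst z) (snd z))"
proof -
  have "csum UNIV (\<lambda>j. csum (B j) (\<lambda>q. f j q))
      = csum UNIV (\<lambda>j. csum UNIV (\<lambda>q. (\<lambda>z. f (fst z) (snd z) * indicator (Sigma UNIV B) z) (j, q)))"
  proof (rule nn_integral_cong)
    fix j
    show "csum (B j) (\<lambda>q. f j q) = csum UNIV (\<lambda>q. (\<lambda>z. f (fst z) (snd z) * indicator (Sigma UNIV B) z) (j, q))"
      unfolding csum_indicator[of "B j"] by (rule nn_integral_cong) (auto simp: indicator_def)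
  qed
  also have "\<dots> = csum UNIV (\<lambda>z. f (fst z) (snd z) * indicator (Sigma UNIV B) z)"
    by (rule nn_integral_fst_count_space)
  also have "\<dots> = csum (Sigma UNIV B) (\<lambda>z. f (fst z) (snd z))"
    by (rule csum_indicator[symmetric])
  finally show ?thesis .
qed

text \<open>The neighbourhood as a function of the cube; the chosen point is immaterial, because all
  points of a dyadic cube have the same neighbourhood.\<close>

definition enlarged :: "int \<times> 'a::euclidean_space set \<Rightarrow> 'a set" where
  "enlarged p = dyadic_nbhd (fst p) (SOME x. x \<in> snd p)"

lemma enlarged_eq: "p \<in> dyadics \<Longrightarrow> x \<in> snd p \<Longrightarrow> enlarged p = dyadic_nbhd (fst p) x"
proof -
  assume p: "p \<in> dyadics" "x \<in> snd p"
  have "(SOME x. x \<in> snd p) \<in> snd p" by (rule someI) (rule p(2))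
  then have "(SOME x. x \<in> snd p) \<in> dyadic_cube (fst p) x" by (simp only: dyadics_mem[OF p])
  then show ?thesis unfolding enlarged_def by (rule dyadic_nbhd_cong)
qed

lemma enlarged_cube [simp]: "enlarged (k, dyadic_cube k x) = dyadic_nbhd k x"
  using enlarged_eq[of "(k, dyadic_cube k x)" x] by simp

lemma enlarged_borel [measurable, simp]: "enlarged p \<in> sets borel"
  by (simp add: enlarged_def)

text \<open>Adjacency is symmetric. Thus the cubes of one level whose enlargement contains y are
  among the at most 3^n neighbours of the cube of y.\<close>

lemma enlarged_mem_iff:
  assumes p: "p \<in> dyadics" shows "y \<in> enlarged p \<longleftrightarrow> snd p \<subseteq> dyadic_nbhd (fst p) y"
proof -
  obtain x where x: "p = (fst p, dyadic_cube (fst p) x)" "snd p = dyadic_cube (fst p) x"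
    using dyadicsE[OF p] by blast
  have "enlarged p = dyadic_nbhd (fst p) x" by (subst x(1)) simp
  moreover have "x \<in> dyadic_nbhd (fst p) y \<longleftrightarrow> dyadic_cube (fst p) x \<subseteq> dyadic_nbhd (fst p) y"
    using dyadic_cube_subset_nbhd' dyadic_cube_self by blast
  ultimately show ?thesis unfolding x(2) by (metis dyadic_nbhd_sym)
qed

lemma card_dyadic_neighbours_le:
  "csum {P. (k, P) \<in> dyadics \<and> P \<subseteq> dyadic_nbhd k (x::'a::euclidean_space)} (\<lambda>P. 1) \<le> ennreal (3 ^ DIM('a))"
proof -
  have "real (card {P. (k, P) \<in> dyadics \<and> P \<subseteq> dyadic_nbhd k x}) \<le> 3 ^ DIM('a)"
    using of_nat_mono[OF dyadic_neighbours(2)[of k x], where 'a=real] by simp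
  then show ?thesis
    unfolding nn_integral_count_space_finite[OF dyadic_neighbours(1)]
    by (simp add: ennreal_leI ennreal_of_nat_eq_real_of_nat)
qed

lemma dcontent_enlarged:
  assumes p: "p \<in> dyadics"
  shows "dcontent \<beta> (enlarged p :: 'a::euclidean_space set) \<le> ennreal (3 ^ DIM('a)) * dyadic_weight \<beta> p"
proof -
  obtain x where x: "p = (fst p, dyadic_cube (fst p) x)" "snd p = dyadic_cube (fst p) x"
    using dyadicsE[OF p] by blast
  define F where "F = {P. (fst p, P) \<in> dyadics \<and> P \<subseteq> dyadic_nbhd (fst p) x}"
  have e: "enlarged p = \<Union>F" unfolding F_def by (subst x(1)) (simp add: dyadic_neighbours(3)[symmetric])
  have "dcontent \<beta> (enlarged p) \<le> csum (Pair (fst p) ` F) (dyadic_weight \<beta>)"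
    by (rule dcontent_le) (auto simp: e F_def)
  also have "\<dots> = csum F (\<lambda>P. dyadic_weight \<beta> (fst p, P))"
    by (rule nn_integral_bij_count_space[symmetric]) (simp add: bij_betw_def inj_on_def)
  also have "\<dots> = csum F (\<lambda>P. dyadic_weight \<beta> p * 1)" by (simp add: dyadic_weight_def)
  also have "\<dots> = dyadic_weight \<beta> p * csum F (\<lambda>P. 1)"
    by (rule nn_integral_cmult) simp
  also have "\<dots> \<le> dyadic_weight \<beta> p * ennreal (3 ^ DIM('a))"
    unfolding F_def by (intro mult_left_mono card_dyadic_neighbours_le) simp
  finally show ?thesis by (simp add: mult.commute)
qed

lemma level_coverD:
  assumes "level_cover \<beta> h \<C> N"
  shows "z \<in> Sigma UNIV \<C> \<Longrightarrow> snd z \<in> dyadics"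
    and "csum (Sigma UNIV \<C>) (\<lambda>z. ennreal (2 powr real_of_int (fst z)) * dyadic_weight \<beta> (snd z)) \<le> ennreal N"
proof -
  have sub: "\<C> j \<subseteq> dyadics" for j using assms unfolding level_cover_def by blast
  show "snd z \<in> dyadics" if "z \<in> Sigma UNIV \<C>"
  proof -
    have "snd z \<in> \<C> (fst z)" using that by auto
    then show ?thesis by (rule subsetD[OF sub])
  qed
  show "csum (Sigma UNIV \<C>) (\<lambda>z. ennreal (2 powr real_of_int (fst z)) * dyadic_weight \<beta> (snd z)) \<le> ennreal N"
    using assms csum_Sigma[of \<C> "\<lambda>j p. ennreal (2 powr real_of_int j) * dyadic_weight \<beta> p"]
    unfolding level_cover_def by simp
qed

lemma level_cover_countable:
  assumes "level_cover \<beta> h \<C> N" shows "countable (Sigma UNIV \<C>)"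
proof (rule countable_SIGMA)
  fix j show "countable (\<C> j)"
    using assms countable_subset[OF _ countable_dyadics] unfolding level_cover_def by blast
qed simp

text \<open>If h y > 2 s, then y lies in the cover at the height 2^j just below h y, and 2^j \<ge>
  s; otherwise the constant pays. The truncation serves the weak type inequality, and s = 0 gives
  the untruncated sum.\<close>

lemma level_cover_pointwise:
  assumes cov: "level_cover \<beta> h \<C> N" and s: "0 \<le> s"
  shows "ennreal (h y) \<le> ennreal (2 * s) +
    csum {z \<in> Sigma UNIV \<C>. s \<le> 2 powr real_of_int (fst z)} (\<lambda>z. ennreal (2 * 2 powr real_of_int (fst z)) * indicator (snd (snd z)) y)"
proof (cases "h y \<le> 2 * s")
  case True
  then have "ennreal (h y) \<le> ennreal (2 * s)" by (rule ennreal_leI)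
  then show ?thesis by (rule order_trans) simp
next
  case False
  then have "0 < h y" using s by linarith
  then obtain j where j: "2 powr real_of_int j < h y" "h y \<le> 2 * 2 powr real_of_int j"
    using dyadic_level_exists by blast
  then obtain q where q: "q \<in> \<C> j" "y \<in> snd q" using cov unfolding level_cover_def by blast
  have "s \<le> 2 powr real_of_int j" using False j by linarith
  then have z: "(j, q) \<in> {z \<in> Sigma UNIV \<C>. s \<le> 2 powr real_of_int (fst z)}" using q by simp
  have "ennreal (h y) \<le> ennreal (2 * 2 powr real_of_int j) * indicator (snd q) y"
    using j(2) q(2) by (simp add: ennreal_leI)
  also have "\<dots> \<le> csum {z \<in> Sigma UNIV \<C>. s \<le> 2 powr real_of_int (fst z)} (\<lambda>z. ennreal (2 * 2 powr real_of_int (fst z)) * indicator (snd (snd z)) y)"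
    using nn_integral_ge_point[OF z, of "\<lambda>z. ennreal (2 * 2 powr real_of_int (fst z)) * indicator (snd (snd z)) y"] by simp
  finally show ?thesis by (simp add: add_increasing)
qed

lemma level_cover_integral:
  assumes cov: "level_cover \<beta> h \<C> N" and s: "0 \<le> s" and S: "S \<in> sets lebesgue"
  shows "(\<integral>\<^sup>+y\<in>S. ennreal (h y) \<partial>lebesgue) \<le> ennreal (2 * s) * emeasure lebesgue S +
    csum {z \<in> Sigma UNIV \<C>. s \<le> 2 powr real_of_int (fst z)} (\<lambda>z. ennreal (2 * 2 powr real_of_int (fst z)) * emeasure lebesgue (snd (snd z) \<inter> S))"
proof -
  define K where "K = {z \<in> Sigma UNIV \<C>. s \<le> 2 powr real_of_int (fst z)}"
  have cK: "countable K" unfolding K_def by (rule countable_subset[OF _ level_cover_countable[OF cov]]) auto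
  have sm: "snd (snd z) \<in> sets lebesgue" if "z \<in> K" for z
    using dyadics_snd_borel[OF level_coverD(1)[OF cov]] that unfolding K_def by auto
  have m: "(\<lambda>y. ennreal (2 * 2 powr real_of_int (fst z)) * indicator (snd (snd z) \<inter> S) y) \<in> borel_measurable lebesgue" if "z \<in> K" for z
    using sm[OF that] S by (intro borel_measurable_times_ennreal borel_measurable_const borel_measurable_indicator sets.Int)
  have mS: "(\<lambda>y. ennreal (2 * s) * indicator S y) \<in> borel_measurable lebesgue"
    using S by (intro borel_measurable_times_ennreal borel_measurable_const borel_measurable_indicator)
  have "(\<integral>\<^sup>+y\<in>S. ennreal (h y) \<partial>lebesgue)
    \<le> (\<integral>\<^sup>+y. ennreal (2 * s) * indicator S y + csum K (\<lambda>z. ennreal (2 * 2 powr real_of_int (fst z)) * indicator (snd (snd z) \<inter> S) y) \<partial>lebesgue)"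
  proof (rule nn_integral_mono)
    fix y
    have "csum K (\<lambda>z. ennreal (2 * 2 powr real_of_int (fst z)) * indicator (snd (snd z) \<inter> S) y)
       = csum K (\<lambda>z. ennreal (2 * 2 powr real_of_int (fst z)) * indicator (snd (snd z)) y * indicator S y)"
      by (intro nn_integral_cong) (simp add: indicator_inter_arith mult.assoc)
    also have "\<dots> = csum K (\<lambda>z. ennreal (2 * 2 powr real_of_int (fst z)) * indicator (snd (snd z)) y) * indicator S y"
      by (rule nn_integral_multc) simp
    finally show "ennreal (h y) * indicator S y \<le> ennreal (2 * s) * indicator S y + csum K (\<lambda>z. ennreal (2 * 2 powr real_of_int (fst z)) * indicator (snd (snd z) \<inter> S) y)"
      using mult_right_mono[OF level_cover_pointwise[OF cov s, of y], of "indicator S y"]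
      by (simp add: distrib_right K_def)
  qed
  also have "\<dots> = (\<integral>\<^sup>+y\<in>S. ennreal (2 * s) \<partial>lebesgue) +
      (\<integral>\<^sup>+y. (csum K (\<lambda>z. ennreal (2 * 2 powr real_of_int (fst z)) * indicator (snd (snd z) \<inter> S) y)) \<partial>lebesgue)"
    by (rule nn_integral_add[OF mS borel_measurable_csum[OF cK m]])
  also have "(\<integral>\<^sup>+y. (csum K (\<lambda>z. ennreal (2 * 2 powr real_of_int (fst z)) * indicator (snd (snd z) \<inter> S) y)) \<partial>lebesgue)
     = csum K (\<lambda>z. (\<integral>\<^sup>+y. ennreal (2 * 2 powr real_of_int (fst z)) * indicator (snd (snd z) \<inter> S) y \<partial>lebesgue))"
    by (rule nn_integral_count_space_nn_integral[OF cK m])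
  also have "\<dots> = csum K (\<lambda>z. ennreal (2 * 2 powr real_of_int (fst z)) * emeasure lebesgue (snd (snd z) \<inter> S))"
    using S sm by (intro nn_integral_cong nn_integral_cmult_indicator) auto
  also have "(\<integral>\<^sup>+y\<in>S. ennreal (2 * s) \<partial>lebesgue) = ennreal (2 * s) * emeasure lebesgue S"
    by (rule nn_integral_cmult_indicator[OF S])
  finally show ?thesis unfolding K_def .
qed

text \<open>A Carleson-type packing condition at a single level. The exponent \<beta> is the count
  proper to a \<beta>-dimensional set; the family of all cubes of level k has exponent n.\<close>

definition packed :: "real \<Rightarrow> real \<Rightarrow> int \<Rightarrow> (int \<times> 'a::euclidean_space set) set \<Rightarrow> bool" where
  "packed \<beta> K k F \<longleftrightarrow> F \<subseteq> dyadics \<and> (\<forall>p\<in>F. fst p = k) \<and>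
     (\<forall>m x. k \<le> m \<longrightarrow> (csum F (\<lambda>p. indicator {p. snd p \<subseteq> dyadic_cube m x} p)) \<le> ennreal (K * side_pow (m - k) \<beta>))"

lemma level_overlap_le:
  fixes y :: "'a::euclidean_space"
  assumes F: "F \<subseteq> dyadics" "\<And>p. p \<in> F \<Longrightarrow> fst p = k"
  shows "csum F (\<lambda>p. indicator (enlarged p) y) \<le> ennreal (3 ^ DIM('a))"
proof -
  define G where "G = {P. (k, P) \<in> dyadics \<and> P \<subseteq> dyadic_nbhd k y}"
  have "csum F (\<lambda>p. indicator (enlarged p) y) = (csum F (\<lambda>p. indicator {p \<in> F. y \<in> enlarged p} p) :: ennreal)"
    by (intro nn_integral_cong) (auto simp: indicator_def)
  also have "\<dots> = csum UNIV (\<lambda>p. indicator {p \<in> F. y \<in> enlarged p} p)"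
    by (rule nn_integral_count_space_eq) (auto simp: indicator_def)
  also have "\<dots> \<le> csum UNIV (\<lambda>p. 1 * indicator (Pair k ` G) p)"
  proof (rule nn_integral_mono)
    fix p
    have "p \<in> Pair k ` G" if p: "p \<in> F" "y \<in> enlarged p"
    proof -
      have "p \<in> dyadics" "fst p = k" using F p by auto
      moreover from this have "snd p \<subseteq> dyadic_nbhd k y" using enlarged_mem_iff p(2) by blast
      ultimately show ?thesis unfolding G_def by (cases p) auto
    qed
    then show "indicator {p \<in> F. y \<in> enlarged p} p \<le> (1 * indicator (Pair k ` G) p :: ennreal)"
      by (auto simp: indicator_def)
  qed
  also have "\<dots> = csum (Pair k ` G) (\<lambda>p. 1)" by (rule csum_indicator[symmetric])
  also have "\<dots> = csum G (\<lambda>P. 1)"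
    using nn_integral_bij_count_space[of "Pair k" G "Pair k ` G" "\<lambda>_. 1"] by (simp add: bij_betw_def inj_on_def)
  also have "\<dots> \<le> ennreal (3 ^ DIM('a))" unfolding G_def by (rule card_dyadic_neighbours_le)
  finally show ?thesis .
qed

text \<open>A cube q no larger than the members is handled by bounded overlap. For q of level m > k
  the members near q lie in its 3^n neighbours, where the packing condition counts them, and 2^(k n)
  2^((m-k) \<beta>) = 2^(k(n-\<beta>)) 2^(m \<beta>). The volume of an enlargement gives another
  3^n, hence 9^n.\<close>

lemma packed_overlap:
  fixes q :: "int \<times> 'a::euclidean_space set"
  assumes \<beta>: "0 < \<beta>" "\<beta> \<le> real DIM('a)" and F: "packed \<beta> K k F" and K: "1 \<le> K" and q: "q \<in> dyadics"
  shows "csum F (\<lambda>p. emeasure lebesgue (snd q \<inter> enlarged p))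
    \<le> ennreal (9 ^ DIM('a) * K * side_pow k (real DIM('a) - \<beta>)) * dyadic_weight \<beta> q"
proof -
  define n where "n = DIM('a)"
  have Fd: "F \<subseteq> dyadics" and Fk: "\<And>p. p \<in> F \<Longrightarrow> fst p = k"
    and Fp: "\<And>m x. k \<le> m \<Longrightarrow> csum F (\<lambda>p. indicator {p. snd p \<subseteq> dyadic_cube m x} p) \<le> ennreal (K * side_pow (m - k) \<beta>)"
    using F unfolding packed_def by blast+
  have cF: "countable F" by (rule countable_subset[OF Fd countable_dyadics])
  have sq: "snd q \<in> sets lebesgue" using dyadics_snd_borel[OF q] by simp
  have n39: "(3::real) ^ n * 3 ^ n = 9 ^ n" by (simp flip: power_mult_distrib)
  have n3: "(3::real) ^ n \<le> 9 ^ n * K"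
  proof -
    have "(3::real) ^ n * 1 \<le> 9 ^ n * K" using K by (intro mult_mono power_mono) auto
    then show ?thesis by simp
  qed
  show ?thesis
  proof (cases "fst q \<le> k")
    case True
    have "csum F (\<lambda>p. emeasure lebesgue (snd q \<inter> enlarged p))
       = csum F (\<lambda>p. \<integral>\<^sup>+y. indicator (snd q \<inter> enlarged p) y \<partial>lebesgue)"
      using sq by (intro nn_integral_cong nn_integral_indicator[symmetric] sets.Int) auto
    also have "\<dots> = (\<integral>\<^sup>+y. csum F (\<lambda>p. indicator (snd q \<inter> enlarged p) y) \<partial>lebesgue)"
      using sq by (intro nn_integral_count_space_nn_integral[symmetric] cF borel_measurable_indicator sets.Int) auto
    also have "\<dots> \<le> (\<integral>\<^sup>+y\<in>snd q. ennreal (3 ^ n) \<partial>lebesgue)"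
    proof (rule nn_integral_mono)
      fix y
      have "csum F (\<lambda>p. indicator (snd q \<inter> enlarged p) y) = (csum F (\<lambda>p. indicator (snd q) y * indicator (enlarged p) y) :: ennreal)"
        by (simp add: indicator_inter_arith)
      also have "\<dots> = indicator (snd q) y * csum F (\<lambda>p. indicator (enlarged p) y)"
        by (rule nn_integral_cmult) simp
      also have "\<dots> \<le> indicator (snd q) y * ennreal (3 ^ n)"
        unfolding n_def by (intro mult_left_mono level_overlap_le[OF Fd Fk]) auto
      finally show "csum F (\<lambda>p. indicator (snd q \<inter> enlarged p) y) \<le> ennreal (3 ^ n) * indicator (snd q) y"
        by (simp add: mult.commute)
    qed
    also have "\<dots> = ennreal (3 ^ n) * emeasure lebesgue (snd q)" by (rule nn_integral_cmult_indicator[OF sq])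
    also have "\<dots> \<le> ennreal (3 ^ n) * (ennreal (side_pow k (real n - \<beta>)) * dyadic_weight \<beta> q)"
      unfolding emeasure_dyadic[OF q] n_def by (intro mult_left_mono dyadic_weight_split True \<beta>) simp
    also have "\<dots> = ennreal (3 ^ n * side_pow k (real n - \<beta>)) * dyadic_weight \<beta> q"
      by (simp add: ennreal_mult mult.assoc)
    also have "\<dots> \<le> ennreal (9 ^ n * K * side_pow k (real n - \<beta>)) * dyadic_weight \<beta> q"
      using n3 by (intro mult_right_mono ennreal_leI) auto
    finally show ?thesis by (simp add: n_def)
  next
    case False
    define m where "m = fst q"
    obtain x where x: "snd q = dyadic_cube m x" using dyadicsE[OF q] unfolding m_def by metis
    define G where "G = {P. (m, P) \<in> dyadics \<and> P \<subseteq> dyadic_nbhd m x}"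
    have "csum F (\<lambda>p. emeasure lebesgue (snd q \<inter> enlarged p))
      \<le> csum F (\<lambda>p. ennreal (3 ^ n * side_pow k n) * csum G (\<lambda>R. indicator {p. snd p \<subseteq> R} p))"
    proof (rule nn_integral_mono)
      fix p assume "p \<in> space (count_space F)"
      then have p: "p \<in> dyadics" "fst p = k" using Fd Fk by auto
      obtain z where z: "p = (k, dyadic_cube k z)" using dyadicsE[OF p(1)] p(2) by metis
      show "emeasure lebesgue (snd q \<inter> enlarged p) \<le> ennreal (3 ^ n * side_pow k n) * csum G (\<lambda>R. indicator {p. snd p \<subseteq> R} p)"
      proof (cases "snd q \<inter> enlarged p = {}")
        case False
        then obtain y where y: "y \<in> dyadic_cube m x" "y \<in> dyadic_nbhd k z" unfolding x z by auto
        have "y \<in> dyadic_nbhd m z" using y(2) dyadic_nbhd_mono[of k m z] \<open>\<not> fst q \<le> k\<close> unfolding m_def by auto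
        then have "z \<in> dyadic_nbhd m x" using dyadic_nbhd_cong[OF y(1)] dyadic_nbhd_sym by blast
        then have R: "dyadic_cube m z \<in> G" unfolding G_def using dyadic_cube_subset_nbhd' by auto
        have "dyadic_cube k z \<subseteq> dyadic_cube m z" using dyadic_cube_mono[of k m z] \<open>\<not> fst q \<le> k\<close> unfolding m_def by auto
        then have "1 \<le> (csum G (\<lambda>R. indicator {p. snd p \<subseteq> R} p) :: ennreal)"
          using nn_integral_ge_point[OF R, of "\<lambda>R. indicator {p. snd p \<subseteq> R} p"] by (simp add: z)
        then have "ennreal (3 ^ n * side_pow k n) * 1 \<le> ennreal (3 ^ n * side_pow k n) * csum G (\<lambda>R. indicator {p. snd p \<subseteq> R} p)"
          by (rule mult_left_mono) simp
        moreover have "emeasure lebesgue (snd q \<inter> enlarged p) \<le> emeasure lebesgue (dyadic_nbhd k z)"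
          by (intro emeasure_mono) (auto simp: z)
        moreover have "emeasure lebesgue (dyadic_nbhd k z) \<le> ennreal (3 ^ n * side_pow k n)"
          unfolding n_def by (rule emeasure_dyadic_nbhd)
        ultimately show ?thesis by simp
      qed simp
    qed
    also have "\<dots> = ennreal (3 ^ n * side_pow k n) * csum F (\<lambda>p. csum G (\<lambda>R. indicator {p. snd p \<subseteq> R} p))"
      by (rule nn_integral_cmult) simp
    also have "csum F (\<lambda>p. csum G (\<lambda>R. indicator {p. snd p \<subseteq> R} p)) = (csum G (\<lambda>R. csum F (\<lambda>p. indicator {p. snd p \<subseteq> R} p)) :: ennreal)"
      by (rule csum_swap)
    also have "\<dots> \<le> csum G (\<lambda>R. ennreal (K * side_pow (m - k) \<beta>) * 1)"
    proof (rule nn_integral_mono)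
      fix R assume "R \<in> space (count_space G)"
      then obtain z where "R = dyadic_cube m z" by (auto simp: G_def dyadics_def)
      then show "csum F (\<lambda>p. indicator {p. snd p \<subseteq> R} p) \<le> ennreal (K * side_pow (m - k) \<beta>) * 1"
        using Fp[of m z] False unfolding m_def by simp
    qed
    also have "\<dots> = ennreal (K * side_pow (m - k) \<beta>) * csum G (\<lambda>R. 1)"
      by (rule nn_integral_cmult) simp
    also have "\<dots> \<le> ennreal (K * side_pow (m - k) \<beta>) * ennreal (3 ^ n)"
      unfolding G_def n_def by (intro mult_left_mono card_dyadic_neighbours_le) simp
    also have "ennreal (3 ^ n * side_pow k n) * \<dots> = ennreal (9 ^ n * K * side_pow k (real n - \<beta>)) * dyadic_weight \<beta> q"
    proof -
      have "3 ^ n * side_pow k n * (K * side_pow (m - k) \<beta> * 3 ^ n)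
          = (3 ^ n * 3 ^ n) * K * (side_pow k n * side_pow (m - k) \<beta>)" by simp
      also have "side_pow k n * side_pow (m - k) \<beta> = side_pow k (real n - \<beta>) * side_pow m \<beta>"
        by (simp add: algebra_simps flip: powr_add)
      finally have "3 ^ n * side_pow k n * (K * side_pow (m - k) \<beta> * 3 ^ n)
         = 9 ^ n * K * side_pow k (real n - \<beta>) * side_pow m \<beta>" unfolding n39 by (simp add: mult.assoc)
      then show ?thesis using K by (simp add: dyadic_weight_def m_def flip: ennreal_mult)
    qed
    finally show ?thesis by (simp add: n_def mult_left_mono)
  qed
qed

text \<open>The gain from packing: the masses of \<open>h\<close> over the whole family together
  obey, up to constants, the bound for a single neighbourhood. The overlap estimate is summed
  against the untruncated level cover.\<close>

lemma packed_sum: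
  fixes h :: "'a::euclidean_space \<Rightarrow> real"
  assumes \<beta>: "0 < \<beta>" "\<beta> \<le> real DIM('a)" and F: "packed \<beta> K k F" and K: "1 \<le> K"
    and cov: "level_cover \<beta> h \<C> N" and N: "0 \<le> N"
  shows "csum F (\<lambda>p. \<integral>\<^sup>+y\<in>enlarged p. ennreal (h y) \<partial>lebesgue)
     \<le> ennreal (2 * 9 ^ DIM('a) * K * N * side_pow k (real DIM('a) - \<beta>))"
proof -
  define c where "c = 9 ^ DIM('a) * K * side_pow k (real DIM('a) - \<beta>)"
  have c: "0 \<le> c" using K by (simp add: c_def)
  let ?S = "Sigma UNIV \<C>"
  have "csum F (\<lambda>p. \<integral>\<^sup>+y\<in>enlarged p. ennreal (h y) \<partial>lebesgue)
     \<le> csum F (\<lambda>p. csum ?S (\<lambda>z. ennreal (2 * 2 powr real_of_int (fst z)) * emeasure lebesgue (snd (snd z) \<inter> enlarged p)))"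
  proof (rule nn_integral_mono)
    fix p
    show "(\<integral>\<^sup>+y\<in>enlarged p. ennreal (h y) \<partial>lebesgue) \<le> csum ?S (\<lambda>z. ennreal (2 * 2 powr real_of_int (fst z)) * emeasure lebesgue (snd (snd z) \<inter> enlarged p))"
      using level_cover_integral[OF cov order_refl, of "enlarged p"] by (simp add: Collect_mem_eq)
  qed
  also have "\<dots> = csum ?S (\<lambda>z. csum F (\<lambda>p. ennreal (2 * 2 powr real_of_int (fst z)) * emeasure lebesgue (snd (snd z) \<inter> enlarged p)))"
    by (rule csum_swap)
  also have "\<dots> \<le> csum ?S (\<lambda>z. ennreal (2 * c) * (ennreal (2 powr real_of_int (fst z)) * dyadic_weight \<beta> (snd z)))"
  proof (rule nn_integral_mono)
    fix z assume "z \<in> space (count_space ?S)"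
    then have z: "snd z \<in> dyadics" using level_coverD(1)[OF cov] by simp
    have "csum F (\<lambda>p. ennreal (2 * 2 powr real_of_int (fst z)) * emeasure lebesgue (snd (snd z) \<inter> enlarged p))
      = ennreal (2 * 2 powr real_of_int (fst z)) * csum F (\<lambda>p. emeasure lebesgue (snd (snd z) \<inter> enlarged p))"
      by (rule nn_integral_cmult) simp
    also have "\<dots> \<le> ennreal (2 * 2 powr real_of_int (fst z)) * (ennreal c * dyadic_weight \<beta> (snd z))"
      unfolding c_def by (intro mult_left_mono packed_overlap[OF \<beta> F K z]) simp
    also have "\<dots> = ennreal (2 * c) * (ennreal (2 powr real_of_int (fst z)) * dyadic_weight \<beta> (snd z))"
      using c by (simp add: ennreal_mult mult_ac)
    finally show "csum F (\<lambda>p. ennreal (2 * 2 powr real_of_int (fst z)) * emeasure lebesgue (snd (snd z) \<inter> enlarged p))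
      \<le> ennreal (2 * c) * (ennreal (2 powr real_of_int (fst z)) * dyadic_weight \<beta> (snd z))" .
  qed
  also have "\<dots> = ennreal (2 * c) * csum ?S (\<lambda>z. ennreal (2 powr real_of_int (fst z)) * dyadic_weight \<beta> (snd z))"
    by (rule nn_integral_cmult) simp
  also have "\<dots> \<le> ennreal (2 * c) * ennreal N"
    by (intro mult_left_mono level_coverD(2)[OF cov]) simp
  also have "\<dots> = ennreal (2 * 9 ^ DIM('a) * K * N * side_pow k (real DIM('a) - \<beta>))"
    using c N by (simp add: c_def mult_ac flip: ennreal_mult)
  finally show ?thesis .
qed

lemma level_cover_nbhd:
  fixes h :: "'a::euclidean_space \<Rightarrow> real"
  assumes \<beta>: "0 < \<beta>" "\<beta> \<le> real DIM('a)" and cov: "level_cover \<beta> h \<C> N" and N: "0 \<le> N"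
  shows "(\<integral>\<^sup>+y\<in>dyadic_nbhd k x. ennreal (h y) \<partial>lebesgue)
     \<le> ennreal (2 * 9 ^ DIM('a) * N * side_pow k (real DIM('a) - \<beta>))"
proof -
  \<comment> \<open>A single cube is packed with constant 1, since the ratio of sides raised to
    \<beta> is at least 1.\<close>
  have "packed \<beta> 1 k {(k, dyadic_cube k x)}"
    unfolding packed_def
  proof (intro conjI allI impI)
    fix m and z :: 'a assume "k \<le> m"
    then have "2 powr 0 \<le> side_pow (m - k) \<beta>" using \<beta> by (intro powr_mono) auto
    then have "1 \<le> ennreal (1 * side_pow (m - k) \<beta>)" by (simp flip: ennreal_1)
    then show "csum {(k, dyadic_cube k x)} (\<lambda>p. indicator {p. snd p \<subseteq> dyadic_cube m z} p) \<le> ennreal (1 * side_pow (m - k) \<beta>)"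
      by (intro order_trans[OF csum_at_most_one]) auto
  qed auto
  from packed_sum[OF \<beta> this order_refl cov N] show ?thesis
    by (simp add: nn_integral_count_space_finite)
qed

text \<open>The maximal inequality. Cover cubes of height at least s are heavy for the weight they
  generate, and \<open>X\<close> is the union of the enlarged maximal heavy cubes. Off
  \<open>X\<close> no cube adjacent to that of x lies in a heavy cube, so the cover cubes meeting it
  are contained in it and weigh little. Large and small heights each contribute at most 2 s to the
  average over such a cube.\<close>

lemma level_cover_weak_type:
  fixes h :: "'a::euclidean_space \<Rightarrow> real"
  assumes \<beta>: "0 < \<beta>" "\<beta> \<le> real DIM('a)" and cov: "level_cover \<beta> h \<C> N" and N: "0 \<le> N"
    and h: "h \<in> borel_measurable lebesgue" and s: "0 < s"
  shows "\<exists>X. dcontent \<beta> X \<le> ennreal (3 ^ DIM('a) * N / s) \<and>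
    (\<forall>x k. x \<notin> X \<longrightarrow> (\<integral>\<^sup>+y\<in>dyadic_nbhd k x. ennreal (h y) \<partial>lebesgue)
      \<le> ennreal (4 * 3 ^ DIM('a) * s * side_pow k (DIM('a))))"
proof -
  define n where "n = DIM('a)"
  define K where "K = {z \<in> Sigma UNIV \<C>. s \<le> 2 powr real_of_int (fst z)}"
  \<comment> \<open>The same cube may occur in the covers at several heights, so its weight collects
    all of them.\<close>
  define w where "w q = csum K (\<lambda>z. ennreal (2 powr real_of_int (fst z)) * dyadic_weight \<beta> (snd z) * indicator {z. snd z = q} z)" for q
  have Kd: "snd z \<in> dyadics" "s \<le> 2 powr real_of_int (fst z)" if "z \<in> K" for z
    using level_coverD(1)[OF cov, of z] that by (auto simp: K_def)
  have mass: "csum D w = csum K (\<lambda>z. ennreal (2 powr real_of_int (fst z)) * dyadic_weight \<beta> (snd z) * indicator D (snd z))" for D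
  proof -
    have "csum D w = csum K (\<lambda>z. csum D (\<lambda>q. ennreal (2 powr real_of_int (fst z)) * dyadic_weight \<beta> (snd z) * indicator {z. snd z = q} z))"
      unfolding w_def by (rule csum_swap)
    also have "\<dots> = csum K (\<lambda>z. ennreal (2 powr real_of_int (fst z)) * dyadic_weight \<beta> (snd z) * indicator D (snd z))"
    proof (rule nn_integral_cong)
      fix z :: "int \<times> int \<times> 'a set"
      have "csum D (\<lambda>q. ennreal (2 powr real_of_int (fst z)) * dyadic_weight \<beta> (snd z) * indicator {z. snd z = q} z)
         = csum D (\<lambda>q. ennreal (2 powr real_of_int (fst z)) * dyadic_weight \<beta> (snd z) * indicator {snd z} q)"
        by (intro nn_integral_cong) (auto simp: indicator_def)
      also have "\<dots> = ennreal (2 powr real_of_int (fst z)) * dyadic_weight \<beta> (snd z) * csum D (\<lambda>q. indicator {snd z} q)"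
        by (rule nn_integral_cmult) simp
      also have "csum D (\<lambda>q. indicator {snd z} q) = (indicator D (snd z) :: ennreal)"
      proof (cases "snd z \<in> D")
        case True
        then show ?thesis by (simp add: one_ennreal_def)
      next
        case False
        then have "csum D (\<lambda>q. indicator {snd z} q) = (csum D (\<lambda>q. 0) :: ennreal)"
          by (intro nn_integral_cong) (auto simp: indicator_def)
        with False show ?thesis by simp
      qed
      finally show "csum D (\<lambda>q. ennreal (2 powr real_of_int (fst z)) * dyadic_weight \<beta> (snd z) * indicator {z. snd z = q} z)
         = ennreal (2 powr real_of_int (fst z)) * dyadic_weight \<beta> (snd z) * indicator D (snd z)" .
    qed
    finally show ?thesis .
  qed
  have W: "csum dyadics w \<le> ennreal N"
  proof -
    have "csum dyadics w \<le> csum K (\<lambda>z. ennreal (2 powr real_of_int (fst z)) * dyadic_weight \<beta> (snd z))"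
      unfolding mass by (rule nn_integral_mono) (auto simp: indicator_def)
    also have "\<dots> \<le> csum (Sigma UNIV \<C>) (\<lambda>z. ennreal (2 powr real_of_int (fst z)) * dyadic_weight \<beta> (snd z))"
      by (rule csum_mono_set) (auto simp: K_def)
    also have "\<dots> \<le> ennreal N" by (rule level_coverD(2)[OF cov])
    finally show ?thesis .
  qed
  define H where "H = heavy \<beta> s w"
  define M where "M = max_heavy \<beta> s w"
  have Md: "M \<subseteq> dyadics" by (auto simp: M_def max_heavy_def heavy_def)
  have below: "\<exists>q\<in>M. dyadic_le p q" if "p \<in> H" for p
    using heavy_below_max[OF \<beta>(1) s W] that unfolding H_def M_def by blast
  have KH: "snd z \<in> H" if z: "z \<in> K" for z
  proof -
    have "ennreal s * dyadic_weight \<beta> (snd z) \<le> ennreal (2 powr real_of_int (fst z)) * dyadic_weight \<beta> (snd z) * indicator {z'. snd z' = snd z} z"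
      using Kd(2)[OF z] by (simp add: ennreal_leI mult_right_mono)
    also have "\<dots> \<le> w (snd z)"
      unfolding w_def by (rule nn_integral_ge_point[OF z])
    also have "\<dots> \<le> dyadic_mass w (snd z)"
      unfolding dyadic_mass_def using Kd(1)[OF z] by (intro nn_integral_ge_point) (simp add: dyadic_le_def)
    finally show ?thesis using Kd(1)[OF z] by (simp add: H_def heavy_def)
  qed
  define X where "X = (\<Union>q\<in>M. enlarged q)"
  have "dcontent \<beta> X \<le> csum M (\<lambda>q. dcontent \<beta> (enlarged q))"
    unfolding X_def by (rule dcontent_UN[OF countable_subset[OF Md countable_dyadics]])
  also have "\<dots> \<le> csum M (\<lambda>q. ennreal (3 ^ n) * dyadic_weight \<beta> q)"
    unfolding n_def using Md by (intro nn_integral_mono dcontent_enlarged) auto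
  also have "\<dots> = ennreal (3 ^ n) * csum M (dyadic_weight \<beta>)" by (rule nn_integral_cmult) simp
  also have "\<dots> = ennreal (3 ^ n / s) * (ennreal s * csum M (dyadic_weight \<beta>))"
    using s by (simp add: mult.assoc[symmetric] flip: ennreal_mult)
  also have "\<dots> \<le> ennreal (3 ^ n / s) * ennreal N"
    unfolding M_def by (intro mult_left_mono max_heavy_sum W) simp
  also have "\<dots> = ennreal (3 ^ n * N / s)" using s N by (simp flip: ennreal_mult)
  finally have X: "dcontent \<beta> X \<le> ennreal (3 ^ n * N / s)" .
  have "(\<integral>\<^sup>+y\<in>dyadic_nbhd k x. ennreal (h y) \<partial>lebesgue) \<le> ennreal (4 * 3 ^ n * s * side_pow k n)"
    if x: "x \<notin> X" for x k
  proof -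
    have "(\<integral>\<^sup>+y\<in>dyadic_cube k z. ennreal (h y) \<partial>lebesgue) \<le> ennreal (4 * s * side_pow k n)"
      if z: "z \<in> dyadic_nbhd k x" for z
    proof -
      define p where "p = (k, dyadic_cube k z)"
      have pd: "p \<in> dyadics" by (simp add: p_def)
      \<comment> \<open>If an adjacent cube lay in a heavy cube, then x would lie in the enlargement
        of a maximal one above it, because neighbourhoods grow with the level.\<close>
      have noH: "\<not> dyadic_le p q" if "q \<in> H" for q
      proof
        assume pq: "dyadic_le p q"
        obtain q' where q': "q' \<in> M" "dyadic_le q q'" using below[OF \<open>q \<in> H\<close>] by blast
        have le: "k \<le> fst q'" "dyadic_cube k z \<subseteq> snd q'" using pq q'(2) unfolding dyadic_le_def p_def by auto
        have zq: "z \<in> snd q'" using le(2) dyadic_cube_self[of z k] by blast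
        have "enlarged q' = dyadic_nbhd (fst q') z" using enlarged_eq zq q'(1) Md by blast
        moreover have "x \<in> dyadic_nbhd (fst q') z"
          using dyadic_nbhd_mono[OF le(1), of z] z dyadic_nbhd_sym by blast
        ultimately have "x \<in> X" using q'(1) unfolding X_def by blast
        with x show False by simp
      qed
      have "p \<notin> H" using noH[of p] by (auto simp: dyadic_le_def)
      then have light: "dyadic_mass w p \<le> ennreal s * dyadic_weight \<beta> p"
        using pd by (auto simp: H_def heavy_def)
      have "csum K (\<lambda>z'. ennreal (2 * 2 powr real_of_int (fst z')) * emeasure lebesgue (snd (snd z') \<inter> dyadic_cube k z))
        \<le> csum K (\<lambda>z'. ennreal (2 * side_pow k (real n - \<beta>)) * (ennreal (2 powr real_of_int (fst z')) * dyadic_weight \<beta> (snd z') * indicator {q \<in> dyadics. dyadic_le q p} (snd z')))"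
      proof (rule nn_integral_mono)
        fix z' :: "int \<times> int \<times> 'a set" assume "z' \<in> space (count_space K)"
        then have z': "z' \<in> K" by simp
        define q where "q = snd z'"
        have qd: "q \<in> dyadics" "q \<in> H" using Kd(1)[OF z'] KH[OF z'] by (auto simp: q_def)
        show "ennreal (2 * 2 powr real_of_int (fst z')) * emeasure lebesgue (snd (snd z') \<inter> dyadic_cube k z)
          \<le> ennreal (2 * side_pow k (real n - \<beta>)) * (ennreal (2 powr real_of_int (fst z')) * dyadic_weight \<beta> (snd z') * indicator {q \<in> dyadics. dyadic_le q p} (snd z'))"
        proof (cases "snd q \<inter> dyadic_cube k z = {}")
          case False
          then obtain y where "y \<in> snd q" "y \<in> snd p" unfolding p_def by auto
          then have qp: "dyadic_le q p" using dyadics_comparable[OF qd(1) pd] noH[OF qd(2)] by blast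
          have "emeasure lebesgue (snd q \<inter> dyadic_cube k z) \<le> emeasure lebesgue (snd q)"
            using dyadics_snd_borel[OF qd(1)] by (intro emeasure_mono) auto
          also have "\<dots> \<le> ennreal (side_pow k (real n - \<beta>)) * dyadic_weight \<beta> q"
            unfolding emeasure_dyadic[OF qd(1)] n_def using qp \<beta> by (intro dyadic_weight_split) (auto simp: dyadic_le_def p_def)
          finally have "ennreal (2 * 2 powr real_of_int (fst z')) * emeasure lebesgue (snd q \<inter> dyadic_cube k z)
            \<le> ennreal (2 * 2 powr real_of_int (fst z')) * (ennreal (side_pow k (real n - \<beta>)) * dyadic_weight \<beta> q)"
            by (rule mult_left_mono) simp
          also have "\<dots> = ennreal (2 * side_pow k (real n - \<beta>)) * (ennreal (2 powr real_of_int (fst z')) * dyadic_weight \<beta> q)"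
            by (simp add: ennreal_mult mult_ac)
          finally show ?thesis using qp qd by (simp add: q_def)
        qed (simp add: q_def)
      qed
      also have "\<dots> = ennreal (2 * side_pow k (real n - \<beta>)) * dyadic_mass w p"
        unfolding dyadic_mass_def mass by (rule nn_integral_cmult) simp
      also have "\<dots> \<le> ennreal (2 * side_pow k (real n - \<beta>)) * (ennreal s * dyadic_weight \<beta> p)"
        by (rule mult_left_mono[OF light]) simp
      also have "\<dots> = ennreal (2 * s * side_pow k n)"
        using s by (simp add: dyadic_weight_def p_def algebra_simps flip: ennreal_mult powr_add)
      finally have small: "csum K (\<lambda>z'. ennreal (2 * 2 powr real_of_int (fst z')) * emeasure lebesgue (snd (snd z') \<inter> dyadic_cube k z))
        \<le> ennreal (2 * s * side_pow k n)" .
      have "(\<integral>\<^sup>+y\<in>dyadic_cube k z. ennreal (h y) \<partial>lebesgue)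
        \<le> ennreal (2 * s) * emeasure lebesgue (dyadic_cube k z) + csum K (\<lambda>z'. ennreal (2 * 2 powr real_of_int (fst z')) * emeasure lebesgue (snd (snd z') \<inter> dyadic_cube k z))"
        unfolding K_def using s by (intro level_cover_integral[OF cov]) auto
      also have "\<dots> \<le> ennreal (2 * s) * ennreal (side_pow k n) + ennreal (2 * s * side_pow k n)"
        unfolding emeasure_dyadic_cube n_def[symmetric] by (intro add_mono order_refl small)
      also have "\<dots> = ennreal (4 * s * side_pow k n)"
        using s by (simp flip: ennreal_mult ennreal_plus)
      finally show ?thesis .
    qed
    then have "(\<integral>\<^sup>+y\<in>dyadic_nbhd k x. ennreal (h y) \<partial>lebesgue) \<le> ennreal (3 ^ n) * ennreal (4 * s * side_pow k n)"
      unfolding n_def using h by (intro nn_integral_dyadic_nbhd_le) auto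
    also have "\<dots> = ennreal (4 * 3 ^ n * s * side_pow k n)"
      using s by (simp add: mult_ac flip: ennreal_mult)
    finally show ?thesis .
  qed
  with X show ?thesis unfolding n_def by blast
qed

subsection \<open>Local averages\<close>

text \<open>Put \<delta> = 2^k0. For a cube of side l, the maximal inequality at height s bounds the
  mass by s l^n = l^(n-\<alpha>) (l/\<delta>)^\<alpha> / L, and the total N bounds it by N
  l^(n-\<beta>) \<le> l^(n-\<alpha>) (\<delta>/l)^(\<beta>-\<alpha>) / L, up to constants. The first
  is used for l \<le> \<delta>, the second beyond, and the smaller exponent is kept.\<close>

lemma dyadic_average_decay:
  fixes h :: "'a::euclidean_space \<Rightarrow> real" and \<alpha> \<beta> N L :: real
  assumes \<beta>: "0 < \<beta>" "\<beta> \<le> real DIM('a)" and cov: "level_cover \<beta> h \<C> N" and N: "0 \<le> N"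
    and h: "h \<in> borel_measurable lebesgue" and L: "1 \<le> L" and \<alpha>: "0 < \<alpha>" "\<alpha> < \<beta>"
    and NL: "N * L \<le> side_pow k0 (\<beta> - \<alpha>)"
  shows "\<exists>X. dcontent \<beta> X \<le> ennreal (3 ^ DIM('a) * side_pow k0 \<beta>) \<and>
    (\<forall>x k. x \<notin> X \<longrightarrow> (\<integral>\<^sup>+y\<in>dyadic_nbhd k x. ennreal (h y) \<partial>lebesgue)
      \<le> ennreal (4 * 9 ^ DIM('a) / L * 2 powr (- min \<alpha> (\<beta> - \<alpha>) * real_of_int \<bar>k - k0\<bar>) * side_pow k (real DIM('a) - \<alpha>)))"
proof -
  define n where "n = real DIM('a)"
  define \<theta> where "\<theta> = min \<alpha> (\<beta> - \<alpha>)"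
  \<comment> \<open>This height makes N / s = N L \<delta>^\<alpha> \<le> \<delta>^\<beta> for
    \<delta> = 2^k0, the admissible size of the exceptional set.\<close>
  define s where "s = 2 powr (- real_of_int k0 * \<alpha>) / L"
  have s: "0 < s" using L by (simp add: s_def)
  obtain X where X: "dcontent \<beta> X \<le> ennreal (3 ^ DIM('a) * N / s)"
    and av: "\<And>x k. x \<notin> X \<Longrightarrow> (\<integral>\<^sup>+y\<in>dyadic_nbhd k x. ennreal (h y) \<partial>lebesgue) \<le> ennreal (4 * 3 ^ DIM('a) * s * side_pow k n)"
    using level_cover_weak_type[OF \<beta> cov N h s] unfolding n_def by blast
  have "3 ^ DIM('a) * N / s \<le> 3 ^ DIM('a) * side_pow k0 \<beta>"
  proof -
    have "N / s = N * L * side_pow k0 \<alpha>" using L by (simp add: s_def powr_minus field_simps)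
    also have "\<dots> \<le> side_pow k0 (\<beta> - \<alpha>) * side_pow k0 \<alpha>"
      by (intro mult_right_mono NL) simp
    also have "\<dots> = side_pow k0 \<beta>" by (simp add: algebra_simps flip: powr_add)
    finally have "3 ^ DIM('a) * (N / s) \<le> 3 ^ DIM('a) * side_pow k0 \<beta>" by (rule mult_left_mono) simp
    then show ?thesis by simp
  qed
  then have "dcontent \<beta> X \<le> ennreal (3 ^ DIM('a) * side_pow k0 \<beta>)"
    using X by (meson ennreal_leI order_trans)
  moreover have "(\<integral>\<^sup>+y\<in>dyadic_nbhd k x. ennreal (h y) \<partial>lebesgue)
      \<le> ennreal (4 * 9 ^ DIM('a) / L * 2 powr (- \<theta> * real_of_int \<bar>k - k0\<bar>) * side_pow k (n - \<alpha>))"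
    if x: "x \<notin> X" for x k
  proof (cases "k \<le> k0")
    case True
    have "4 * 3 ^ DIM('a) * s * side_pow k n = 4 * 3 ^ DIM('a) / L * (2 powr (- real_of_int k0 * \<alpha>) * side_pow k n)"
      by (simp add: s_def)
    also have "2 powr (- real_of_int k0 * \<alpha>) * side_pow k n = 2 powr (- \<alpha> * real_of_int (k0 - k)) * side_pow k (n - \<alpha>)"
      by (simp add: algebra_simps flip: powr_add)
    also have "4 * 3 ^ DIM('a) / L * \<dots> \<le> 4 * 9 ^ DIM('a) / L * (2 powr (- \<theta> * real_of_int \<bar>k - k0\<bar>) * side_pow k (n - \<alpha>))"
    proof -
      have "\<theta> * real_of_int (k0 - k) \<le> \<alpha> * real_of_int (k0 - k)"
        using True by (intro mult_right_mono) (auto simp: \<theta>_def)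
      then have "- \<alpha> * real_of_int (k0 - k) \<le> - \<theta> * real_of_int \<bar>k - k0\<bar>" using True by simp
      then have e: "2 powr (- \<alpha> * real_of_int (k0 - k)) \<le> 2 powr (- \<theta> * real_of_int \<bar>k - k0\<bar>)" by (rule powr_mono) simp
      show ?thesis using L by (intro mult_mono e divide_right_mono power_mono order_refl mult_nonneg_nonneg divide_nonneg_nonneg) auto
    qed
    finally have "4 * 3 ^ DIM('a) * s * side_pow k n \<le> 4 * 9 ^ DIM('a) / L * 2 powr (- \<theta> * real_of_int \<bar>k - k0\<bar>) * side_pow k (n - \<alpha>)"
      by (simp add: mult.assoc)
    then show ?thesis using av[OF x, of k] by (meson ennreal_leI order_trans)
  next
    case False
    have "N \<le> side_pow k0 (\<beta> - \<alpha>) / L" using NL L by (simp add: field_simps)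
    then have "2 * 9 ^ DIM('a) * N * side_pow k (n - \<beta>) \<le> 2 * 9 ^ DIM('a) * (side_pow k0 (\<beta> - \<alpha>) / L) * side_pow k (n - \<beta>)"
      by (intro mult_right_mono mult_left_mono) auto
    also have "\<dots> = 2 * 9 ^ DIM('a) / L * (side_pow k0 (\<beta> - \<alpha>) * side_pow k (n - \<beta>))" by simp
    also have "side_pow k0 (\<beta> - \<alpha>) * side_pow k (n - \<beta>) = 2 powr (- (\<beta> - \<alpha>) * real_of_int (k - k0)) * side_pow k (n - \<alpha>)"
      by (simp add: algebra_simps flip: powr_add)
    also have "2 * 9 ^ DIM('a) / L * \<dots> \<le> 4 * 9 ^ DIM('a) / L * (2 powr (- \<theta> * real_of_int \<bar>k - k0\<bar>) * side_pow k (n - \<alpha>))"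
    proof -
      have "\<theta> * real_of_int (k - k0) \<le> (\<beta> - \<alpha>) * real_of_int (k - k0)"
        using False by (intro mult_right_mono) (auto simp: \<theta>_def)
      moreover have "real_of_int \<bar>k - k0\<bar> = real_of_int (k - k0)" using False by simp
      ultimately have "- (\<beta> - \<alpha>) * real_of_int (k - k0) \<le> - \<theta> * real_of_int \<bar>k - k0\<bar>"
        by (simp only: mult_minus_left neg_le_iff_le)
      then have e: "2 powr (- (\<beta> - \<alpha>) * real_of_int (k - k0)) \<le> 2 powr (- \<theta> * real_of_int \<bar>k - k0\<bar>)" by (rule powr_mono) simp
      show ?thesis using L by (intro mult_mono e divide_right_mono power_mono order_refl mult_nonneg_nonneg divide_nonneg_nonneg) auto
    qed
    finally have "2 * 9 ^ DIM('a) * N * side_pow k (n - \<beta>) \<le> 4 * 9 ^ DIM('a) / L * 2 powr (- \<theta> * real_of_int \<bar>k - k0\<bar>) * side_pow k (n - \<alpha>)"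
      by (simp add: mult.assoc)
    then show ?thesis using level_cover_nbhd[OF \<beta> cov N, of k x] unfolding n_def by (meson ennreal_leI order_trans)
  qed
  ultimately show ?thesis unfolding n_def \<theta>_def by blast
qed

section \<open>The Young function t log(e + t)\<close>

lemma Bfun_nonneg: "0 \<le> t \<Longrightarrow> 0 \<le> Bfun t"
  unfolding Bfun_def by (intro mult_nonneg_nonneg ln_ge_zero) (auto intro: add_increasing2)

lemma ln_e_add_ge_1: "0 \<le> t \<Longrightarrow> 1 \<le> ln (exp 1 + (t::real))"
  by (subst ln_ge_iff) (auto simp: add_pos_nonneg)

lemma Bfun_ge: "0 \<le> t \<Longrightarrow> t \<le> Bfun t"
  unfolding Bfun_def using ln_e_add_ge_1[of t] mult_left_mono[of 1 "ln (exp 1 + t)" t] by simp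

text \<open>The left side is at most the sum x + y of the two logarithms, and x + y \<le> 2 x y
  because both are at least 1. Consequently \<open>Bfun\<close> is submultiplicative up to the
  factor 2.\<close>

lemma ln_e_add_mult:
  fixes s t :: real
  assumes "0 \<le> s" "0 \<le> t" shows "ln (exp 1 + s * t) \<le> 2 * ln (exp 1 + s) * ln (exp 1 + t)"
proof -
  define x where "x = ln (exp 1 + s)" define y where "y = ln (exp 1 + t)"
  have x: "1 \<le> x" "1 \<le> y" using assms ln_e_add_ge_1 by (auto simp: x_def y_def)
  have "exp 1 + s * t \<le> (exp 1 + s) * (exp 1 + t)"
  proof -
    have "(1::real) \<le> exp 1" by simp
    then have "exp 1 * 1 \<le> exp 1 * (exp 1 :: real)" by (intro mult_left_mono) auto
    moreover have "0 \<le> exp 1 * t + s * exp 1" using assms by simp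
    moreover have "(exp 1 + s) * (exp 1 + t) = exp 1 * exp 1 + (exp 1 * t + s * exp 1) + s * t"
      by (simp add: algebra_simps)
    ultimately show ?thesis by linarith
  qed
  moreover have "0 < exp 1 + s * t" using assms by (intro add_pos_nonneg) auto
  ultimately have "ln (exp 1 + s * t) \<le> ln ((exp 1 + s) * (exp 1 + t))" by (subst ln_le_cancel_iff) auto
  also have "\<dots> = x + y" unfolding x_def y_def using assms by (intro ln_mult_pos add_pos_nonneg) auto
  also have "\<dots> \<le> 2 * x * y"
  proof -
    have "0 \<le> (x - 1) * y + x * (y - 1)" using x by (intro add_nonneg_nonneg mult_nonneg_nonneg) auto
    then show ?thesis by (simp add: algebra_simps)
  qed
  finally show ?thesis by (simp add: x_def y_def)
qed

lemma Bfun_mult: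
  assumes "0 \<le> s" "0 \<le> t" shows "Bfun (s * t) \<le> 2 * Bfun s * Bfun t"
proof -
  have "s * t * ln (exp 1 + s * t) \<le> s * t * (2 * ln (exp 1 + s) * ln (exp 1 + t))"
    using assms by (intro mult_left_mono ln_e_add_mult) auto
  then show ?thesis by (simp add: Bfun_def mult_ac)
qed

lemma Bfun_mono: "0 \<le> s \<Longrightarrow> s \<le> t \<Longrightarrow> Bfun s \<le> Bfun t"
  unfolding Bfun_def by (intro mult_mono) (auto simp: add_pos_nonneg add_increasing2 intro!: ln_ge_zero)

text \<open>The inequality 1 + z \<le> exp z at z = v - ln u, multiplied by u: Young's inequality
  for exp and its conjugate u ln u - u.\<close>

lemma Young_exp_Bfun:
  assumes "0 \<le> u" shows "v * u \<le> exp v + Bfun u"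
proof (cases "u = 0")
  case False
  then have u: "0 < u" using assms by simp
  have "u * (1 + (v - ln u)) \<le> u * exp (v - ln u)" using u exp_ge_add_one_self by (intro mult_left_mono) auto
  also have "\<dots> = exp v" using u by (simp add: exp_diff)
  finally have "v * u \<le> exp v + u * ln u" using u by (simp add: algebra_simps)
  also have "u * ln u \<le> u * ln (exp 1 + u)" using u by (intro mult_left_mono) (auto simp: add_pos_pos)
  finally show ?thesis by (simp add: Bfun_def)
qed (simp add: Bfun_def)

lemma Bfun_measurable [measurable]: "Bfun \<in> borel_measurable borel"
  unfolding Bfun_def by measurable

text \<open>Factors growing linearly in the number of scales are absorbed by an arbitrarily small
  part of the geometric decay.\<close>

lemma linear_le_powr:
  fixes c d \<epsilon> :: real
  assumes "0 < \<epsilon>" shows "\<exists>C>0. \<forall>u\<ge>0. c + d * u \<le> C * 2 powr (\<epsilon> * u)"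
proof (intro exI conjI allI impI)
  define C where "C = \<bar>c\<bar> + \<bar>d\<bar> / (\<epsilon> * ln 2) + 1"
  show C: "0 < \<bar>c\<bar> + \<bar>d\<bar> / (\<epsilon> * ln 2) + 1" using assms by (simp add: add_nonneg_pos)
  fix u :: real assume u: "0 \<le> u"
  have e: "1 + \<epsilon> * u * ln 2 \<le> 2 powr (\<epsilon> * u)" unfolding powr_def using exp_ge_add_one_self[of "\<epsilon> * u * ln 2"] by simp
  have "c + d * u \<le> \<bar>c\<bar> * 1 + \<bar>d\<bar> / (\<epsilon> * ln 2) * (\<epsilon> * u * ln 2)"
    using assms u by (auto intro!: add_mono mult_right_mono)
  also have "\<dots> \<le> \<bar>c\<bar> * 2 powr (\<epsilon> * u) + \<bar>d\<bar> / (\<epsilon> * ln 2) * 2 powr (\<epsilon> * u)"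
  proof (intro add_mono mult_left_mono)
    have "0 \<le> \<epsilon> * u * ln 2" using assms u by simp
    then show "1 \<le> 2 powr (\<epsilon> * u)" "\<epsilon> * u * ln 2 \<le> 2 powr (\<epsilon> * u)" using e by linarith+
  qed (use assms in auto)
  also have "\<dots> \<le> (\<bar>c\<bar> + \<bar>d\<bar> / (\<epsilon> * ln 2) + 1) * 2 powr (\<epsilon> * u)" by (simp add: algebra_simps)
  finally show "c + d * u \<le> (\<bar>c\<bar> + \<bar>d\<bar> / (\<epsilon> * ln 2) + 1) * 2 powr (\<epsilon> * u)" .
qed

text \<open>For a cube of side l, Young's inequality produces B(1/t) with 1/t close to l^\<alpha>,
  hence a logarithm of e + l^\<alpha>. It splits into ln (e + \<delta>^\<alpha>) with \<delta> =
  2^k0, cancelled by the denominator in the hypothesis, times a factor linear in |k - k0|, absorbed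
  by half of the decay.\<close>

lemma oscillation_product_bound:
  fixes \<alpha> \<beta> A :: real
  assumes \<beta>: "0 < \<beta>" "\<beta> \<le> real DIM('a)" and \<alpha>: "0 < \<alpha>" "\<alpha> < \<beta>" and A: "0 < A" and C1: "0 < C1"
  defines "\<theta> \<equiv> min \<alpha> (\<beta> - \<alpha>)"
  shows "\<exists>C>0. \<forall>(b::'a::euclidean_space \<Rightarrow> real) c (f :: 'a \<Rightarrow> real) k0 k x. b \<in> borel_measurable lebesgue \<longrightarrow> oscillation_bound \<beta> A b c \<longrightarrow>
     f \<in> borel_measurable lebesgue \<longrightarrow>
     (\<integral>\<^sup>+y\<in>dyadic_nbhd k x. ennreal (Bfun \<bar>f y\<bar>) \<partial>lebesgue)
       \<le> ennreal (C1 / ln (exp 1 + side_pow k0 \<alpha>) * 2 powr (- \<theta> * real_of_int \<bar>k - k0\<bar>) * side_pow k (real DIM('a) - \<alpha>)) \<longrightarrow>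
     (\<integral>\<^sup>+y\<in>dyadic_nbhd k x. ennreal (\<bar>b y - c (k, dyadic_cube k x)\<bar> * \<bar>f y\<bar>) \<partial>lebesgue)
       \<le> ennreal (C * 2 powr (- (\<theta> / 2) * real_of_int \<bar>k - k0\<bar>) * side_pow k (real DIM('a) - \<alpha>))"
proof -
  define n where "n = real DIM('a)"
  define \<kappa> where "\<kappa> = ln 2 / (2 * jn_const \<beta> A)"
  have \<kappa>: "0 < \<kappa>" using jn_const_pos[OF A] by (simp add: \<kappa>_def)
  have \<theta>: "0 < \<theta>" "\<theta> \<le> \<alpha>" using \<alpha> by (auto simp: \<theta>_def)
  obtain Ce where Ce: "0 < Ce" and ex: "\<And>(b::'a \<Rightarrow> real) c k x. b \<in> borel_measurable lebesgue \<Longrightarrow> oscillation_bound \<beta> A b c \<Longrightarrow>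
     (\<integral>\<^sup>+y\<in>dyadic_nbhd k x. ennreal (exp (\<kappa> * \<bar>b y - c (k, dyadic_cube k x)\<bar>)) \<partial>lebesgue) \<le> ennreal (Ce * side_pow k n)"
    using exp_integral_nbhd[OF \<beta> A] unfolding \<kappa>_def n_def by blast
  obtain Cl where Cl: "0 < Cl" "\<And>u. 0 \<le> u \<Longrightarrow> 2 + 2 * \<alpha> * u \<le> Cl * 2 powr (\<theta> / 2 * u)"
    using linear_le_powr[of "\<theta> / 2" 2 "2 * \<alpha>"] \<theta> by auto
  define C where "C = (Ce + 4 * Cl * C1) / \<kappa>"
  have C: "0 < C" using Ce Cl C1 \<kappa> by (simp add: C_def add_pos_pos)
  have "(\<integral>\<^sup>+y\<in>dyadic_nbhd k x. ennreal (\<bar>b y - c (k, dyadic_cube k x)\<bar> * \<bar>f y\<bar>) \<partial>lebesgue)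
       \<le> ennreal (C * 2 powr (- (\<theta> / 2) * real_of_int \<bar>k - k0\<bar>) * side_pow k (n - \<alpha>))"
    if bm: "b \<in> borel_measurable lebesgue" and b: "oscillation_bound \<beta> A b c" and fm: "f \<in> borel_measurable lebesgue"
      and av: "(\<integral>\<^sup>+y\<in>dyadic_nbhd k x. ennreal (Bfun \<bar>f y\<bar>) \<partial>lebesgue)
       \<le> ennreal (C1 / ln (exp 1 + side_pow k0 \<alpha>) * 2 powr (- \<theta> * real_of_int \<bar>k - k0\<bar>) * side_pow k (n - \<alpha>))"
    for b :: "'a \<Rightarrow> real" and c f k0 k x
  proof -
    define j where "j = real_of_int \<bar>k - k0\<bar>"
    define L where "L = ln (exp 1 + side_pow k0 \<alpha>)"
    \<comment> \<open>Young's inequality is applied to \<open>\<kappa> * \<bar>b y - c\<bar>\<close> and \<open>\<bar>f y\<bar> / t\<close>; half of the decay is kept, the other half absorbs the logarithm in \<open>Bfun (1 / t)\<close>.\<close>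
    define t where "t = 2 powr (- real_of_int k * \<alpha>) * 2 powr (- (\<theta> / 2) * j)"
    define D where "D = side_pow k (n - \<alpha>)"
    have L: "1 \<le> L" unfolding L_def by (rule ln_e_add_ge_1) simp
    have t: "0 < t" by (simp add: t_def)
    have j: "0 \<le> j" by (simp add: j_def)
    have it: "1 / t = side_pow k \<alpha> * 2 powr (\<theta> / 2 * j)"
      by (simp add: t_def powr_minus divide_simps flip: powr_add)
    have Bt: "t * Bfun (1 / t) \<le> L * (2 * Cl * 2 powr (\<theta> / 2 * j))"
    proof -
      have "t * Bfun (1 / t) = ln (exp 1 + 1 / t)" using t by (simp add: Bfun_def)
      \<comment> \<open>The scale k is replaced by k0 through k \<alpha> \<le> k0 \<alpha> +
        \<alpha> j, and \<theta>/2 \<le> \<alpha> bounds the other factor of 1/t, which together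
        give the exponent 2 \<alpha> j.\<close>
      also have "1 / t \<le> side_pow k0 \<alpha> * 2 powr (2 * \<alpha> * j)"
      proof -
        have "real_of_int k * \<alpha> + \<theta> / 2 * j \<le> real_of_int k0 * \<alpha> + 2 * \<alpha> * j"
        proof -
          have "(real_of_int k - real_of_int k0) * \<alpha> \<le> j * \<alpha>" using \<alpha> by (intro mult_right_mono) (auto simp: j_def)
          moreover have "\<theta> / 2 * j \<le> \<alpha> * j" using \<theta> j by (intro mult_right_mono) auto
          ultimately show ?thesis by (simp add: algebra_simps)
        qed
        then show ?thesis unfolding it by (simp flip: powr_add)
      qed
      then have "ln (exp 1 + 1 / t) \<le> ln (exp 1 + side_pow k0 \<alpha> * 2 powr (2 * \<alpha> * j))"
        using t by (subst ln_le_cancel_iff) (auto intro!: add_pos_pos mult_pos_pos)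
      also have "\<dots> \<le> 2 * L * ln (exp 1 + 2 powr (2 * \<alpha> * j))"
        unfolding L_def by (rule ln_e_add_mult) auto
      also have "ln (exp 1 + 2 powr (2 * \<alpha> * j)) \<le> 2 + 2 * \<alpha> * j"
      proof -
        have p: "0 \<le> 2 * \<alpha> * j" using \<alpha> j by simp
        have "1 \<le> 2 powr (2 * \<alpha> * j)" using p by (intro ge_one_powr_ge_zero) auto
        then have "exp 1 + 2 powr (2 * \<alpha> * j) \<le> exp 1 * 2 powr (2 * \<alpha> * j) + 2 powr (2 * \<alpha> * j)" by simp
        also have "\<dots> = (exp 1 + 1) * 2 powr (2 * \<alpha> * j)" by (simp add: algebra_simps)
        also have "\<dots> \<le> exp 2 * exp (2 * \<alpha> * j)"
        proof (rule mult_mono)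
          have "(2::real) \<le> exp 1" using exp_ge_add_one_self[of 1] by simp
          then have "exp 1 * 2 \<le> exp 1 * (exp 1 :: real)" by (intro mult_left_mono) auto
          then show "exp 1 + 1 \<le> (exp 2 :: real)" using exp_ge_add_one_self[of "1::real"] by (simp flip: exp_add)
          have "2 * \<alpha> * j * ln 2 \<le> 2 * \<alpha> * j * 1" using p ln_2_less_1 by (intro mult_left_mono) auto
          then show "2 powr (2 * \<alpha> * j) \<le> exp (2 * \<alpha> * j)" by (simp add: powr_def)
        qed auto
        also have "\<dots> = exp (2 + 2 * \<alpha> * j)" by (simp add: exp_add)
        finally show ?thesis by (metis add_pos_pos exp_gt_zero ln_exp ln_le_cancel_iff powr_gt_zero zero_neq_numeral)
      qed
      also have "2 * L * (2 + 2 * \<alpha> * j) \<le> 2 * L * (Cl * 2 powr (\<theta> / 2 * j))" using Cl(2)[OF j] L by (intro mult_left_mono) auto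
      finally show ?thesis using L by (simp add: mult_ac mult_left_mono)
    qed
    define v where "v y = \<bar>b y - c (k, dyadic_cube k x)\<bar>" for y
    have vm: "v \<in> borel_measurable lebesgue" unfolding v_def using bm by measurable
    have im: "indicator (dyadic_nbhd k x) \<in> borel_measurable lebesgue"
      by (rule borel_measurable_indicator) simp
    have m1: "(\<lambda>y. ennreal (exp (\<kappa> * v y)) * indicator (dyadic_nbhd k x) y) \<in> borel_measurable lebesgue"
      using vm by (intro borel_measurable_times_ennreal im) measurable
    have m2: "(\<lambda>y. ennreal (Bfun \<bar>f y\<bar>) * indicator (dyadic_nbhd k x) y) \<in> borel_measurable lebesgue"
      using fm by (intro borel_measurable_times_ennreal im) measurable
    have B0: "0 \<le> Bfun (1 / t)" "\<And>y. 0 \<le> Bfun \<bar>f y\<bar>" using t by (auto intro!: Bfun_nonneg)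
    have pt: "ennreal (v y * \<bar>f y\<bar>) \<le> ennreal (t / \<kappa>) * ennreal (exp (\<kappa> * v y)) + ennreal (2 / \<kappa> * (t * Bfun (1 / t))) * ennreal (Bfun \<bar>f y\<bar>)" for y
    proof -
      have "\<kappa> * v y * (1 / t * \<bar>f y\<bar>) \<le> exp (\<kappa> * v y) + Bfun (1 / t * \<bar>f y\<bar>)"
        using t by (intro Young_exp_Bfun) simp
      also have "\<dots> \<le> exp (\<kappa> * v y) + 2 * Bfun (1 / t) * Bfun \<bar>f y\<bar>"
        using t by (intro add_left_mono Bfun_mult) auto
      finally have "t / \<kappa> * (\<kappa> * v y * (1 / t * \<bar>f y\<bar>)) \<le> t / \<kappa> * (exp (\<kappa> * v y) + 2 * Bfun (1 / t) * Bfun \<bar>f y\<bar>)"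
        using t \<kappa> by (intro mult_left_mono) auto
      also have "t / \<kappa> * (\<kappa> * v y * (1 / t * \<bar>f y\<bar>)) = v y * \<bar>f y\<bar>" using t \<kappa> by simp
      also have "t / \<kappa> * (exp (\<kappa> * v y) + 2 * Bfun (1 / t) * Bfun \<bar>f y\<bar>) = t / \<kappa> * exp (\<kappa> * v y) + 2 / \<kappa> * (t * Bfun (1 / t)) * Bfun \<bar>f y\<bar>"
        by (simp add: algebra_simps)
      finally have "ennreal (v y * \<bar>f y\<bar>) \<le> ennreal (t / \<kappa> * exp (\<kappa> * v y) + 2 / \<kappa> * (t * Bfun (1 / t)) * Bfun \<bar>f y\<bar>)"
        by (rule ennreal_leI)
      also have "\<dots> = ennreal (t / \<kappa>) * ennreal (exp (\<kappa> * v y)) + ennreal (2 / \<kappa> * (t * Bfun (1 / t))) * ennreal (Bfun \<bar>f y\<bar>)"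
        using t \<kappa> B0 by (subst ennreal_plus) (auto simp del: times_divide_eq_left times_divide_eq_right simp flip: ennreal_mult)
      finally show ?thesis .
    qed
    have "(\<integral>\<^sup>+y\<in>dyadic_nbhd k x. ennreal (v y * \<bar>f y\<bar>) \<partial>lebesgue)
      \<le> (\<integral>\<^sup>+y. ennreal (t / \<kappa>) * (ennreal (exp (\<kappa> * v y)) * indicator (dyadic_nbhd k x) y) +
           ennreal (2 / \<kappa> * (t * Bfun (1 / t))) * (ennreal (Bfun \<bar>f y\<bar>) * indicator (dyadic_nbhd k x) y) \<partial>lebesgue)"
    proof (rule nn_integral_mono)
      fix y
      show "ennreal (v y * \<bar>f y\<bar>) * indicator (dyadic_nbhd k x) y \<le> ennreal (t / \<kappa>) * (ennreal (exp (\<kappa> * v y)) * indicator (dyadic_nbhd k x) y) +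
           ennreal (2 / \<kappa> * (t * Bfun (1 / t))) * (ennreal (Bfun \<bar>f y\<bar>) * indicator (dyadic_nbhd k x) y)"
        using pt[of y] by (cases "y \<in> dyadic_nbhd k x") auto
    qed
    also have "\<dots> = ennreal (t / \<kappa>) * (\<integral>\<^sup>+y\<in>dyadic_nbhd k x. ennreal (exp (\<kappa> * v y)) \<partial>lebesgue) +
        ennreal (2 / \<kappa> * (t * Bfun (1 / t))) * (\<integral>\<^sup>+y\<in>dyadic_nbhd k x. ennreal (Bfun \<bar>f y\<bar>) \<partial>lebesgue)"
      using m1 m2 by (simp only: nn_integral_add nn_integral_cmult borel_measurable_times_ennreal borel_measurable_const)
    also have "\<dots> \<le> ennreal (t / \<kappa>) * ennreal (Ce * side_pow k n) +
        ennreal (2 / \<kappa> * (L * (2 * Cl * 2 powr (\<theta> / 2 * j)))) * ennreal (C1 / L * 2 powr (- \<theta> * j) * D)"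
    proof (rule add_mono, rule mult_left_mono[OF _ zero_le], goal_cases)
      case 1
      show "(\<integral>\<^sup>+y\<in>dyadic_nbhd k x. ennreal (exp (\<kappa> * v y)) \<partial>lebesgue) \<le> ennreal (Ce * side_pow k n)"
        unfolding v_def by (rule ex[OF bm b])
    next
      case 2
      have "(\<integral>\<^sup>+y\<in>dyadic_nbhd k x. ennreal (Bfun \<bar>f y\<bar>) \<partial>lebesgue) \<le> ennreal (C1 / L * 2 powr (- \<theta> * j) * D)"
        using av unfolding L_def j_def D_def .
      moreover have "ennreal (2 / \<kappa> * (t * Bfun (1 / t))) \<le> ennreal (2 / \<kappa> * (L * (2 * Cl * 2 powr (\<theta> / 2 * j))))"
        using \<kappa> by (intro ennreal_leI mult_left_mono[OF Bt]) simp
      ultimately show ?case by (intro mult_mono) auto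
    qed
    also have "\<dots> = ennreal (t / \<kappa> * (Ce * side_pow k n) + 2 / \<kappa> * (L * (2 * Cl * 2 powr (\<theta> / 2 * j))) * (C1 / L * 2 powr (- \<theta> * j) * D))"
      using \<kappa> t Ce L Cl C1 by (subst ennreal_plus) (auto simp: D_def simp flip: ennreal_mult)
    also have "t / \<kappa> * (Ce * side_pow k n) = Ce / \<kappa> * (2 powr (- (\<theta> / 2) * j) * D)"
    proof -
      have "2 powr (- real_of_int k * \<alpha>) * side_pow k n = D"
        by (simp add: D_def algebra_simps flip: powr_add)
      then show ?thesis by (simp add: t_def mult_ac)
    qed
    also have "2 / \<kappa> * (L * (2 * Cl * 2 powr (\<theta> / 2 * j))) * (C1 / L * 2 powr (- \<theta> * j) * D) = 4 * Cl * C1 / \<kappa> * (2 powr (- (\<theta> / 2) * j) * D)"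
    proof -
      have e: "2 powr (\<theta> / 2 * j) * 2 powr (- \<theta> * j) = 2 powr (- (\<theta> / 2) * j)"
        by (simp add: algebra_simps flip: powr_add)
      have "2 / \<kappa> * (L * (2 * Cl * 2 powr (\<theta> / 2 * j))) * (C1 / L * 2 powr (- \<theta> * j) * D)
        = 4 * Cl * C1 / \<kappa> * ((2 powr (\<theta> / 2 * j) * 2 powr (- \<theta> * j)) * D)" using L by simp
      then show ?thesis unfolding e .
    qed
    also have "Ce / \<kappa> * (2 powr (- (\<theta> / 2) * j) * D) + 4 * Cl * C1 / \<kappa> * (2 powr (- (\<theta> / 2) * j) * D) = C * 2 powr (- (\<theta> / 2) * j) * D"
      by (simp add: C_def algebra_simps add_divide_distrib)
    finally show ?thesis unfolding v_def j_def D_def .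
  qed
  then show ?thesis using C unfolding n_def by blast
qed

subsection \<open>Record cubes\<close>

lemma csum_int_geometric:
  fixes \<epsilon> :: real
  assumes \<epsilon>: "0 < \<epsilon>"
  shows "\<exists>S>0. \<forall>k0. (csum UNIV (\<lambda>k. ennreal (2 powr (- \<epsilon> * real_of_int \<bar>k - k0\<bar>)))) \<le> ennreal S"
proof -
  define r :: real where "r = 2 powr - \<epsilon>"
  have r: "0 < r" "r < 1" using \<epsilon> powr_less_cancel_iff[of 2 "- \<epsilon>" 0] by (auto simp: r_def)
  define S where "S = 2 * (1 / (1 - r))"
  have "csum UNIV (\<lambda>k. ennreal (2 powr (- \<epsilon> * real_of_int \<bar>k - k0\<bar>))) \<le> ennreal S" for k0 :: int
  proof -
    let ?f = "\<lambda>k. ennreal (2 powr (- \<epsilon> * real_of_int \<bar>k - k0\<bar>))"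
    have half: "csum (range (\<lambda>m. k0 + s * int m)) (\<lambda>k. ?f k) = ennreal (1 / (1 - r))" if s: "s = 1 \<or> s = -1" for s :: int
    proof -
      have "inj (\<lambda>m. k0 + s * int m)" using s by (auto simp: inj_on_def)
      then have "csum (range (\<lambda>m. k0 + s * int m)) (\<lambda>k. ?f k) = csum UNIV (\<lambda>m. ?f (k0 + s * int m))"
        by (intro nn_integral_bij_count_space[symmetric]) (simp add: bij_betw_def)
      also have "\<dots> = (\<Sum>m. ?f (k0 + s * int m))" by (rule nn_integral_count_space_nat)
      also have "\<dots> = (\<Sum>m. ennreal (r ^ m))"
      proof (rule suminf_cong)
        fix m
        have "real_of_int \<bar>k0 + s * int m - k0\<bar> = real m" using s by auto
        then have "2 powr (- \<epsilon> * real_of_int \<bar>k0 + s * int m - k0\<bar>) = (2 powr - \<epsilon>) powr real m"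
          by (simp add: powr_powr)
        then show "?f (k0 + s * int m) = ennreal (r ^ m)" by (simp add: r_def powr_realpow)
      qed
      also have "\<dots> = ennreal (1 / (1 - r))"
        using r by (intro suminf_ennreal_eq geometric_sums) auto
      finally show ?thesis .
    qed
    have "UNIV \<subseteq> (\<Union>i\<in>UNIV. range (\<lambda>m. k0 + (if i then 1 else - 1) * int m))"
    proof
      fix k :: int
      show "k \<in> (\<Union>i\<in>UNIV. range (\<lambda>m. k0 + (if i then 1 else - 1) * int m))"
      proof (cases "k0 \<le> k")
        case True
        then have "k = k0 + (if True then 1 else - 1) * int (nat (k - k0))" by simp
        then show ?thesis by blast
      next
        case False
        then have "k = k0 + (if False then 1 else - 1) * int (nat (k0 - k))" by simp
        then show ?thesis by blast
      qed
    qed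
    then have "csum UNIV (\<lambda>k. ?f k) \<le> (csum (\<Union>i\<in>UNIV. range (\<lambda>m. k0 + (if i then 1 else - 1) * int m)) (\<lambda>k. ?f k))"
      by (rule csum_mono_set)
    also have "\<dots> \<le> csum (UNIV::bool set) (\<lambda>i. csum (range (\<lambda>m. k0 + (if i then 1 else - 1) * int m)) (\<lambda>k. ?f k))"
      by (rule csum_UN_le)
    also have "\<dots> = csum (UNIV::bool set) (\<lambda>i. ennreal (1 / (1 - r)))"
      by (intro nn_integral_cong half) simp
    also have "\<dots> = ennreal (1 / (1 - r)) * ennreal 2"
      by (simp add: nn_integral_count_space_finite UNIV_bool mult.commute)
    also have "\<dots> = ennreal S"
      using r by (subst ennreal_mult[symmetric]) (auto simp: S_def)
    finally show ?thesis .
  qed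
  moreover have "0 < S" using r by (simp add: S_def)
  ultimately show ?thesis by blast
qed

definition nbhd_integral :: "('a::euclidean_space \<Rightarrow> real) \<Rightarrow> int \<times> 'a set \<Rightarrow> ennreal" where
  "nbhd_integral f p = (\<integral>\<^sup>+y\<in>enlarged p. ennreal \<bar>f y\<bar> \<partial>lebesgue)"

lemma nbhd_integral_cube:
  "nbhd_integral f (k, dyadic_cube k x) = (\<integral>\<^sup>+y\<in>dyadic_nbhd k x. ennreal \<bar>f y\<bar> \<partial>lebesgue)"
  by (simp add: nbhd_integral_def)

text \<open>The density r m 2^(-m \<beta>) is at most B 2^(-m (2 \<beta> - n)) and tends to 0
  because n < 2 \<beta>. Its maximum over m \<ge> k is thus attained, and a maximiser dominates both
  the starting level and all later ones.\<close>

lemma record_level_exists: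
  fixes r :: "int \<Rightarrow> real"
  assumes le: "\<And>m. r m \<le> B * side_pow m (n - \<beta>)" and k: "0 < r k" and n: "n < 2 * \<beta>"
  shows "\<exists>m\<ge>k. r k * side_pow (m - k) \<beta> \<le> r m \<and> (\<forall>m'\<ge>m. r m' \<le> side_pow (m' - m) \<beta> * r m)"
proof -
  define P where "P m = r m * 2 powr (- real_of_int m * \<beta>)" for m
  define S where "S = {m. k \<le> m \<and> P k \<le> P m}"
  have Pk: "0 < P k" using k by (simp add: P_def)
  define \<eta> where "\<eta> = 2 * \<beta> - n"
  have \<eta>: "0 < \<eta>" using n by (simp add: \<eta>_def)
  have "m \<le> \<lfloor>log 2 (B / P k) / \<eta>\<rfloor>" if m: "m \<in> S" for m
  proof -
    have "P k \<le> P m" using m by (simp add: S_def)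
    also have "P m \<le> B * side_pow m (n - \<beta>) * 2 powr (- real_of_int m * \<beta>)"
      unfolding P_def by (intro mult_right_mono le) simp
    also have "\<dots> = B * (side_pow m (n - \<beta>) * 2 powr (- real_of_int m * \<beta>))" by simp
    also have "side_pow m (n - \<beta>) * 2 powr (- real_of_int m * \<beta>) = 2 powr (- (real_of_int m * \<eta>))"
      by (simp add: \<eta>_def algebra_simps flip: powr_add)
    finally have "P k \<le> B / side_pow m \<eta>" by (simp add: powr_minus_divide)
    then have b: "side_pow m \<eta> \<le> B / P k" using Pk by (simp add: field_simps)
    then have "0 < B / P k" by (rule less_le_trans[rotated]) simp
    with b have "real_of_int m * \<eta> \<le> log 2 (B / P k)" by (simp add: le_log_iff)
    then show ?thesis using \<eta> by (simp add: le_floor_iff field_simps)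
  qed
  then have "S \<subseteq> {k..\<lfloor>log 2 (B / P k) / \<eta>\<rfloor>}" by (auto simp: S_def)
  then have fin: "finite S" using finite_subset by blast
  have kS: "k \<in> S" by (simp add: S_def)
  have "Max (P ` S) \<in> P ` S" using fin kS by (intro Max_in) auto
  then obtain m where m: "m \<in> S" "P m = Max (P ` S)" by auto
  have max: "P m' \<le> P m" if "m \<le> m'" for m'
  proof (cases "m' \<in> S")
    case True
    then show ?thesis using m(2) fin by simp
  next
    case False
    then have "P m' < P k" using m(1) that by (auto simp: S_def)
    then show ?thesis using m(1) by (simp add: S_def)
  qed
  have conv: "P i \<le> P j \<Longrightarrow> r i * side_pow (j - i) \<beta> \<le> r j" for i j
  proof -
    assume a: "P i \<le> P j"
    have "r i * side_pow (j - i) \<beta> = P i * side_pow j \<beta>"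
      by (simp add: P_def mult.assoc left_diff_distrib flip: powr_add)
    also have "\<dots> \<le> P j * side_pow j \<beta>" by (intro mult_right_mono a) simp
    also have "\<dots> = r j" by (simp add: P_def mult.assoc flip: powr_add)
    finally show ?thesis .
  qed
  show ?thesis
  proof (intro exI[of _ m] conjI allI impI)
    show "k \<le> m" using m by (simp add: S_def)
    show "r k * side_pow (m - k) \<beta> \<le> r m" using m by (intro conv) (simp add: S_def)
    fix m' assume "m \<le> m'"
    from conv[OF max[OF this]] have "r m' * side_pow (m - m') \<beta> \<le> r m" .
    then have "r m' * side_pow (m - m') \<beta> * side_pow (m' - m) \<beta> \<le> r m * side_pow (m' - m) \<beta>"
      by (rule mult_right_mono) simp
    then show "r m' \<le> side_pow (m' - m) \<beta> * r m"
      by (simp add: mult.assoc left_diff_distrib mult.commute[of "r m"] flip: powr_add)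
  qed
qed

text \<open>Every cube whose neighbourhood carries mass of \<open>f\<close> is dominated by a record cube containing it. Unlike
  the family of all cubes of one level, the record cubes of one level satisfy the packing condition, since their
  masses inside a larger cube \<open>R\<close> add up to at most a multiple of the mass of \<open>R\<close>.\<close>

definition record_cubes :: "real \<Rightarrow> ('a::euclidean_space \<Rightarrow> real) \<Rightarrow> real \<Rightarrow> int \<Rightarrow> (int \<times> 'a set) set" where
  "record_cubes \<beta> f U k = {p \<in> dyadics. fst p = k \<and> nbhd_integral f p \<noteq> 0 \<and> nbhd_integral f p \<le> ennreal U \<and>
     (\<forall>m\<ge>k. \<forall>x\<in>snd p. nbhd_integral f (m, dyadic_cube m x) \<le> ennreal (side_pow (m - k) \<beta>) * nbhd_integral f p)}"

text \<open>A record cube inside R carries at least the fraction 2^(-(m-k) \<beta>) of the mass of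
  R, and the enlargements overlap at most 3^n times within that of R. So the number of such cubes,
  times the mass of R, is at most 3^n 2^((m-k) \<beta>) times the mass of R.\<close>

lemma record_cubes_packed:
  fixes f :: "'a::euclidean_space \<Rightarrow> real"
  assumes f: "f \<in> borel_measurable lebesgue"
  shows "packed \<beta> (3 ^ DIM('a)) k (record_cubes \<beta> f U k)"
  unfolding packed_def
proof (intro conjI allI impI)
  let ?F = "record_cubes \<beta> f U k" and ?I = "nbhd_integral f"
  show Fd: "?F \<subseteq> dyadics" by (auto simp: record_cubes_def)
  show Fk: "\<forall>p\<in>?F. fst p = k" by (auto simp: record_cubes_def)
  fix m and x :: 'a assume km: "k \<le> m"
  define R where "R = (m, dyadic_cube m x)"
  define q where "q = side_pow (m - k) \<beta>"
  define T where "T = (csum ?F (\<lambda>p. indicator {p. snd p \<subseteq> dyadic_cube m x} p) :: ennreal)"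
  have sub: "enlarged p \<subseteq> enlarged R" and rec: "?I R \<le> ennreal q * ?I p" if p: "p \<in> ?F" "snd p \<subseteq> dyadic_cube m x" for p
  proof -
    have pd: "p \<in> dyadics" and pk: "fst p = k" using p Fd Fk by auto
    obtain z where z: "z \<in> snd p" using dyadics_nonempty[OF pd] by blast
    have zx: "z \<in> dyadic_cube m x" using z p(2) by blast
    have "enlarged p = dyadic_nbhd k z" using enlarged_eq[OF pd z] pk by simp
    also have "\<dots> \<subseteq> dyadic_nbhd m z" by (rule dyadic_nbhd_mono[OF km])
    also have "\<dots> = enlarged R" unfolding R_def using dyadic_nbhd_cong[OF zx] by simp
    finally show "enlarged p \<subseteq> enlarged R" .
    have "?I (m, dyadic_cube m z) \<le> ennreal q * ?I p"
      using p(1) km z unfolding record_cubes_def q_def by blast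
    then show "?I R \<le> ennreal q * ?I p" using dyadic_cube_eq[OF zx] by (simp add: R_def)
  qed
  have "T \<le> ennreal (3 ^ DIM('a) * q)"
  proof (cases "\<exists>p\<in>?F. snd p \<subseteq> dyadic_cube m x")
    case False
    then have "T = csum ?F (\<lambda>p. 0)"
      unfolding T_def by (intro nn_integral_cong) (auto simp: indicator_def)
    then show ?thesis by simp
  next
    case True
    then obtain p0 where p0: "p0 \<in> ?F" "snd p0 \<subseteq> dyadic_cube m x" by blast
    \<comment> \<open>The mass of R is to be cancelled, so it must be positive and finite. Both come
      from one record cube inside, whose mass is nonzero and at most \<open>U\<close>.\<close>
    have "?I p0 \<le> ?I R"
      unfolding nbhd_integral_def using sub[OF p0] by (intro nn_integral_mono mult_left_mono) (auto simp: indicator_def)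
    moreover have "?I p0 \<noteq> 0" "?I p0 \<le> ennreal U" using p0 by (auto simp: record_cubes_def)
    ultimately have R0: "?I R \<noteq> 0" by auto
    have "ennreal q * ?I p0 < \<infinity>" using \<open>?I p0 \<le> ennreal U\<close> by (auto simp: ennreal_mult_less_top le_less_trans)
    then have Rfin: "?I R \<noteq> top" using rec[OF p0] by (auto simp: top_unique)
    have fm: "(\<lambda>y. ennreal \<bar>f y\<bar> * indicator (enlarged p) y) \<in> borel_measurable lebesgue" for p :: "int \<times> 'a set"
      using f by (intro borel_measurable_times_ennreal borel_measurable_indicator) auto
    have "?I R * T = csum ?F (\<lambda>p. ?I R * indicator {p. snd p \<subseteq> dyadic_cube m x} p)"
      unfolding T_def by (rule nn_integral_cmult[symmetric]) simp
    also have "\<dots> \<le> csum ?F (\<lambda>p. ennreal q * (\<integral>\<^sup>+y\<in>enlarged R. ennreal \<bar>f y\<bar> * indicator (enlarged p) y \<partial>lebesgue))"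
    proof (rule nn_integral_mono)
      fix p assume "p \<in> space (count_space ?F)"
      then have p: "p \<in> ?F" by simp
      show "?I R * indicator {p. snd p \<subseteq> dyadic_cube m x} p \<le> ennreal q * (\<integral>\<^sup>+y\<in>enlarged R. ennreal \<bar>f y\<bar> * indicator (enlarged p) y \<partial>lebesgue)"
      proof (cases "snd p \<subseteq> dyadic_cube m x")
        case True
        have "(\<integral>\<^sup>+y\<in>enlarged R. ennreal \<bar>f y\<bar> * indicator (enlarged p) y \<partial>lebesgue) = ?I p"
          unfolding nbhd_integral_def using sub[OF p True] by (intro nn_integral_cong) (auto simp: indicator_def)
        then show ?thesis using rec[OF p True] True by simp
      qed simp
    qed
    also have "\<dots> = ennreal q * csum ?F (\<lambda>p. (\<integral>\<^sup>+y\<in>enlarged R. ennreal \<bar>f y\<bar> * indicator (enlarged p) y \<partial>lebesgue))"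
      by (rule nn_integral_cmult) simp
    also have "csum ?F (\<lambda>p. (\<integral>\<^sup>+y\<in>enlarged R. ennreal \<bar>f y\<bar> * indicator (enlarged p) y \<partial>lebesgue))
       = (\<integral>\<^sup>+y. (csum ?F (\<lambda>p. ennreal \<bar>f y\<bar> * indicator (enlarged p) y * indicator (enlarged R) y)) \<partial>lebesgue)"
    proof (rule nn_integral_count_space_nn_integral[symmetric, OF countable_subset[OF Fd countable_dyadics]])
      show "(\<lambda>y. ennreal \<bar>f y\<bar> * indicator (enlarged p) y * indicator (enlarged R) y) \<in> borel_measurable lebesgue" for p :: "int \<times> 'a set"
        by (rule borel_measurable_times_ennreal[OF fm borel_measurable_indicator]) simp
    qed
    also have "\<dots> \<le> (\<integral>\<^sup>+y. ennreal (3 ^ DIM('a)) * (ennreal \<bar>f y\<bar> * indicator (enlarged R) y) \<partial>lebesgue)"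
    proof (rule nn_integral_mono)
      fix y
      have "csum ?F (\<lambda>p. ennreal \<bar>f y\<bar> * indicator (enlarged p) y * indicator (enlarged R) y)
         = csum ?F (\<lambda>p. (ennreal \<bar>f y\<bar> * indicator (enlarged R) y) * indicator (enlarged p) y)"
        by (simp add: mult_ac)
      also have "\<dots> = (ennreal \<bar>f y\<bar> * indicator (enlarged R) y) * csum ?F (\<lambda>p. indicator (enlarged p) y)"
        by (rule nn_integral_cmult) simp
      also have "\<dots> \<le> (ennreal \<bar>f y\<bar> * indicator (enlarged R) y) * ennreal (3 ^ DIM('a))"
        using Fk by (intro mult_left_mono level_overlap_le[OF Fd]) auto
      finally show "csum ?F (\<lambda>p. ennreal \<bar>f y\<bar> * indicator (enlarged p) y * indicator (enlarged R) y)
        \<le> ennreal (3 ^ DIM('a)) * (ennreal \<bar>f y\<bar> * indicator (enlarged R) y)" by (simp add: mult.commute)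
    qed
    also have "\<dots> = ennreal (3 ^ DIM('a)) * ?I R"
      unfolding nbhd_integral_def by (rule nn_integral_cmult[OF fm])
    also have "ennreal q * (ennreal (3 ^ DIM('a)) * ?I R) = ?I R * ennreal (3 ^ DIM('a) * q)"
      by (simp add: q_def ennreal_mult mult_ac)
    finally have "?I R * T \<le> ?I R * ennreal (3 ^ DIM('a) * q)" by (simp add: mult_left_mono)
    then show ?thesis by (subst (asm) ennreal_mult_le_mult_iff[OF R0 Rfin])
  qed
  then show "csum ?F (\<lambda>p. indicator {p. snd p \<subseteq> dyadic_cube m x} p) \<le> ennreal (3 ^ DIM('a) * side_pow (m - k) \<beta>)"
    unfolding T_def q_def .
qed

text \<open>Decay exponential in u^(-1/2) beats every power of u. This turns the John--Nirenberg
  bound at height 1 / sqrt u, with u the average of a cube, into a power of that average.\<close>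

lemma exp_decay_le_powr:
  fixes J M :: real
  assumes J: "0 < J" and M: "0 < M"
  shows "\<exists>D>0. \<forall>u>0. 2 * 2 powr (- (1 / sqrt u) / J) \<le> D * u powr M"
proof (intro exI conjI allI impI)
  \<comment> \<open>With v = 1 / (sqrt u * J), the power v^-p equals u^M J^p exactly for p = 2 M,
    and 2^-v \<le> (p / ln 2)^p v^-p follows from z \<le> exp z at z = v ln 2 / p.\<close>
  define p where "p = 2 * M"
  define D where "D = 2 * (p / ln 2) powr p * J powr p"
  have p: "0 < p" using M by (simp add: p_def)
  show "0 < 2 * (p / ln 2) powr p * J powr p" using p J by simp
  fix u :: real assume u: "0 < u"
  define v where "v = 1 / (sqrt u * J)"
  have v: "0 < v" using u J by (simp add: v_def)
  have "v * ln 2 / p \<le> exp (v * ln 2 / p)" using exp_ge_add_one_self[of "v * ln 2 / p"] by linarith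
  then have "(v * ln 2 / p) powr p \<le> exp (v * ln 2 / p) powr p" using p v by (intro powr_mono2) auto
  also have "\<dots> = 2 powr v" using p by (simp add: powr_def)
  finally have "v powr p * (ln 2 / p) powr p \<le> 2 powr v"
    using v p powr_mult[of v "ln 2 / p" p] by simp
  then have "v powr p * ((ln 2 / p) powr p * (p / ln 2) powr p) \<le> 2 powr v * (p / ln 2) powr p"
    unfolding mult.assoc[symmetric] by (rule mult_right_mono) simp
  also have "(ln 2 / p) powr p * (p / ln 2) powr p = 1"
    using p powr_mult[of "ln 2 / p" "p / ln 2" p] by simp
  finally have 1: "v powr p \<le> 2 powr v * (p / ln 2) powr p" by simp
  have "2 powr - v = 1 / 2 powr v" by (simp add: powr_minus_divide)
  also have "\<dots> \<le> (p / ln 2) powr p / v powr p" using 1 v by (simp add: field_simps)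
  also have "1 / v powr p = (sqrt u * J) powr p" using u J by (simp add: v_def powr_divide)
  then have "(p / ln 2) powr p / v powr p = (p / ln 2) powr p * (sqrt u * J) powr p" by (metis times_divide_eq_right mult.right_neutral)
  also have "(sqrt u * J) powr p = u powr M * J powr p"
    using u J by (simp add: powr_mult powr_half_sqrt[symmetric] powr_powr p_def)
  finally have "2 * 2 powr - v \<le> 2 * ((p / ln 2) powr p * (u powr M * J powr p))" by simp
  moreover have "- (1 / sqrt u) / J = - v" by (simp add: v_def)
  ultimately show "2 * 2 powr (- (1 / sqrt u) / J) \<le> 2 * (p / ln 2) powr p * J powr p * u powr M"
    by (simp only:) (simp add: mult_ac)
qed

text \<open>On a record cube with normalised mass a, the set where |b - c| exceeds 1 / sqrt a is
  discarded. What is left has oscillation times a at most sqrt a, so half of the decay survives. By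
  John--Nirenberg the discarded content is at most a constant times a^M 2^(k \<beta>). One factor a
  turns this into the mass itself, which can be summed over a packed family, and the other M - 1
  factors give decay over the levels.\<close>

lemma record_exceptional_set:
  fixes \<alpha> \<beta> A C1 :: real
  assumes \<beta>: "0 < \<beta>" "\<beta> \<le> real DIM('a)" and \<alpha>: "0 < \<alpha>" "\<alpha> < \<beta>" "real DIM('a) - \<alpha> < \<beta>"
    and A: "0 < A" and C1: "0 < C1"
  defines "\<theta> \<equiv> min \<alpha> (\<beta> - \<alpha>)"
  defines "U \<equiv> \<lambda>C \<theta> k0 k. C * 2 powr (- \<theta> * real_of_int \<bar>k - k0\<bar>) * side_pow k (real DIM('a) - \<alpha>)"
  shows "\<exists>C>0. \<exists>C'>0. \<forall>(b::'a::euclidean_space \<Rightarrow> real) c f h \<C> N k0. oscillation_bound \<beta> A b c \<longrightarrow> level_cover \<beta> h \<C> N \<longrightarrow>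
     0 \<le> N \<longrightarrow> N \<le> side_pow k0 (\<beta> - \<alpha>) \<longrightarrow> f \<in> borel_measurable lebesgue \<longrightarrow> (\<forall>y. \<bar>f y\<bar> \<le> h y) \<longrightarrow>
     (\<exists>X. dcontent \<beta> X \<le> ennreal (C * side_pow k0 \<beta>) \<and>
       (\<forall>x. x \<notin> X \<longrightarrow> (\<forall>k. nbhd_integral f (k, dyadic_cube k x) \<le> ennreal (U C1 \<theta> k0 k)) \<longrightarrow>
         (\<forall>k. ennreal \<bar>b x - c (k, dyadic_cube k x)\<bar> * nbhd_integral f (k, dyadic_cube k x) \<le> ennreal (U C' (\<theta> / 2) k0 k))))"
proof -
  define n where "n = real DIM('a)"
  \<comment> \<open>The gain per generation on passing to a dominating ancestor: the mass grows at
    least at rate \<beta>, while the normalising power of the side grows at rate n -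
    \<alpha>.\<close>
  define \<gamma> where "\<gamma> = \<alpha> + \<beta> - n"
  define J where "J = jn_const \<beta> A"
  define A3 where "A3 = 4 * A * (1 + 2 powr \<beta>)"
  have J: "0 < J" unfolding J_def by (rule jn_const_pos[OF A])
  have A3: "0 < A3" using A by (simp add: A3_def add_pos_pos)
  have \<theta>: "0 < \<theta>" using \<alpha> by (simp add: \<theta>_def)
  have \<gamma>: "0 < \<gamma>" using \<alpha> by (simp add: \<gamma>_def n_def)
  \<comment> \<open>The sum of n - \<alpha> < \<beta> and \<alpha> < \<beta>; it guarantees that
    record ancestors exist.\<close>
  have n2: "n < 2 * \<beta>" using \<alpha> by (simp add: n_def)
  \<comment> \<open>The John--Nirenberg decay is used as a power \<open>M\<close> of the average, large enough to make the exceptional sets summable over all levels.\<close>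
  define M where "M = 1 + (\<alpha> + 1) / \<theta>"
  have M: "1 < M" using \<theta> \<alpha> by (simp add: M_def add_pos_pos)
  obtain D where D: "0 < D" "\<And>u. 0 < u \<Longrightarrow> 2 * 2 powr (- (1 / sqrt u) / J) \<le> D * u powr M"
    using exp_decay_le_powr[OF J, of M] M by auto
  obtain S where S: "0 < S" "\<And>k0. (csum UNIV (\<lambda>k. ennreal (2 powr (- 1 * real_of_int \<bar>k - k0\<bar>)))) \<le> ennreal S"
    using csum_int_geometric[of 1] by auto
  obtain G where G: "0 < G" "\<And>u. 0 \<le> u \<Longrightarrow> u \<le> G * 2 powr (\<gamma> / 2 * u)"
    using linear_le_powr[of "\<gamma> / 2" 0 1] \<gamma> by auto
  define C2 where "C2 = D * C1 powr (M - 1) * (2 * 9 ^ DIM('a) * 3 ^ DIM('a))"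
  define C' where "C' = sqrt C1 * (1 + A3 * (sqrt C1 * G))"
  have C2: "0 < C2" using D C1 by (simp add: C2_def)
  have C': "0 < C'" unfolding C'_def using C1 A3 G by (intro mult_pos_pos add_pos_pos) auto
  have main: "\<exists>X. dcontent \<beta> X \<le> ennreal (C2 * S * side_pow k0 \<beta>) \<and>
       (\<forall>x. x \<notin> X \<longrightarrow> (\<forall>k. nbhd_integral f (k, dyadic_cube k x) \<le> ennreal (U C1 \<theta> k0 k)) \<longrightarrow>
         (\<forall>k. ennreal \<bar>b x - c (k, dyadic_cube k x)\<bar> * nbhd_integral f (k, dyadic_cube k x) \<le> ennreal (U C' (\<theta> / 2) k0 k)))"
    if b: "oscillation_bound \<beta> A b c" and cov: "level_cover \<beta> h \<C> N" and N: "0 \<le> N" "N \<le> side_pow k0 (\<beta> - \<alpha>)"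
      and f: "f \<in> borel_measurable lebesgue" and fh: "\<forall>y. \<bar>f y\<bar> \<le> h y"
    for b :: "'a \<Rightarrow> real" and c f h \<C> N k0
  proof -
    let ?I = "nbhd_integral f"
    define F where "F k = record_cubes \<beta> f (U C1 \<theta> k0 k) k" for k
    \<comment> \<open>Mass divided by side^(n-\<alpha>), the quantity which the fractional integral
      sums over the scales.\<close>
    define a where "a p = enn2real (?I p) * side_pow (fst p) (\<alpha> - n)" for p
    define E where "E p = {y \<in> snd p. 1 / sqrt (a p) < \<bar>b y - c p\<bar>}" for p
    define X where "X = (\<Union>k\<in>UNIV. \<Union>p\<in>F k. E p)"
    have Fd: "p \<in> dyadics" "fst p = k" "?I p \<noteq> 0" "?I p \<le> ennreal (U C1 \<theta> k0 k)" if "p \<in> F k" for p k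
      using that by (auto simp: F_def record_cubes_def)
    have cF: "countable (F k)" for k
      by (rule countable_subset[OF _ countable_dyadics]) (use Fd(1) in blast)
    have U0: "0 \<le> U C1 \<theta> k0 k" for k using C1 by (simp add: U_def)
    have Ih: "?I p \<le> (\<integral>\<^sup>+y\<in>enlarged p. ennreal (h y) \<partial>lebesgue)" for p
      unfolding nbhd_integral_def using fh by (intro nn_integral_mono mult_right_mono ennreal_leI) auto
    have sumF: "csum (F k) (\<lambda>p. ?I p) \<le> ennreal (2 * 9 ^ DIM('a) * 3 ^ DIM('a) * N * side_pow k (n - \<beta>))" for k
    proof -
      have "csum (F k) (\<lambda>p. ?I p) \<le> csum (F k) (\<lambda>p. \<integral>\<^sup>+y\<in>enlarged p. ennreal (h y) \<partial>lebesgue)"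
        by (intro nn_integral_mono Ih)
      also have "\<dots> \<le> ennreal (2 * 9 ^ DIM('a) * 3 ^ DIM('a) * N * side_pow k (n - \<beta>))"
        unfolding n_def F_def by (rule packed_sum[OF \<beta> record_cubes_packed[OF f] _ cov N(1)]) simp
      finally show ?thesis .
    qed
    have dE: "dcontent \<beta> (E p) \<le> ennreal (D * (C1 * 2 powr (- \<theta> * real_of_int \<bar>k - k0\<bar>)) powr (M - 1) * side_pow k \<gamma>) * ?I p"
      if p: "p \<in> F k" for p k
    proof -
      define u where "u = a p"
      have fin: "?I p < top" using Fd(4)[OF p] by (auto simp: le_less_trans)
      have Ie: "?I p = ennreal (enn2real (?I p))" using fin by simp
      have pos: "0 < enn2real (?I p)" using fin Fd(3)[OF p] by (simp add: enn2real_positive_iff zero_less_iff_neq_zero)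
      have u: "0 < u" using pos by (simp add: u_def a_def)
      have uU: "u \<le> C1 * 2 powr (- \<theta> * real_of_int \<bar>k - k0\<bar>)"
      proof -
        have "enn2real (?I p) \<le> U C1 \<theta> k0 k" using Fd(4)[OF p] U0 by (simp add: enn2real_leI)
        then have "u \<le> U C1 \<theta> k0 k * side_pow k (\<alpha> - n)"
          unfolding u_def a_def Fd(2)[OF p] by (rule mult_right_mono) simp
        also have "\<dots> = C1 * 2 powr (- \<theta> * real_of_int \<bar>k - k0\<bar>) * (side_pow k (n - \<alpha>) * side_pow k (\<alpha> - n))"
          by (simp add: U_def n_def)
        also have "side_pow k (n - \<alpha>) * side_pow k (\<alpha> - n) = 1"
          by (simp add: algebra_simps flip: powr_add)
        finally show ?thesis by simp
      qed
      obtain z where z: "p = (k, dyadic_cube k z)" using dyadicsE[OF Fd(1)[OF p]] Fd(2)[OF p] by metis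
      have "dcontent \<beta> (E p) \<le> ennreal (2 * 2 powr (- (1 / sqrt u) / J) * side_pow k \<beta>)"
        using john_nirenberg_exp[OF \<beta> A b, of "1 / sqrt u" k z] u unfolding E_def J_def u_def z by simp
      also have "\<dots> \<le> ennreal (D * (C1 * 2 powr (- \<theta> * real_of_int \<bar>k - k0\<bar>)) powr (M - 1) * side_pow k \<gamma> * enn2real (?I p))"
      proof (rule ennreal_leI)
        have "2 * 2 powr (- (1 / sqrt u) / J) * side_pow k \<beta> \<le> D * u powr M * side_pow k \<beta>"
          by (intro mult_right_mono D u) simp
        also have "u powr M = u powr (M - 1) * u" using u by (simp add: powr_mult_base[symmetric] powr_diff)
        also have "D * (u powr (M - 1) * u) * side_pow k \<beta> = D * u powr (M - 1) * (u * side_pow k \<beta>)" by simp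
        also have "u * side_pow k \<beta> = side_pow k \<gamma> * enn2real (?I p)"
          unfolding u_def a_def Fd(2)[OF p] \<gamma>_def by (simp add: algebra_simps flip: powr_add)
        also have "D * u powr (M - 1) * (side_pow k \<gamma> * enn2real (?I p)) \<le>
           D * (C1 * 2 powr (- \<theta> * real_of_int \<bar>k - k0\<bar>)) powr (M - 1) * (side_pow k \<gamma> * enn2real (?I p))"
          using u uU D M by (intro mult_right_mono mult_left_mono powr_mono2) auto
        finally show "2 * 2 powr (- (1 / sqrt u) / J) * side_pow k \<beta> \<le> D * (C1 * 2 powr (- \<theta> * real_of_int \<bar>k - k0\<bar>)) powr (M - 1) * side_pow k \<gamma> * enn2real (?I p)"
          by simp
      qed
      also have "\<dots> = ennreal (D * (C1 * 2 powr (- \<theta> * real_of_int \<bar>k - k0\<bar>)) powr (M - 1) * side_pow k \<gamma>) * ?I p"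
        using D by (subst (2) Ie) (intro ennreal_mult, auto)
      finally show ?thesis .
    qed
    have level: "dcontent \<beta> (\<Union>p\<in>F k. E p) \<le> ennreal (C2 * side_pow k0 \<beta>) * ennreal (2 powr (- 1 * real_of_int \<bar>k - k0\<bar>))" for k
    proof -
      define j where "j = real_of_int \<bar>k - k0\<bar>"
      define c1 where "c1 = D * (C1 * 2 powr (- \<theta> * j)) powr (M - 1) * side_pow k \<gamma>"
      have "dcontent \<beta> (\<Union>p\<in>F k. E p) \<le> csum (F k) (\<lambda>p. dcontent \<beta> (E p))" by (rule dcontent_UN[OF cF])
      also have "\<dots> \<le> csum (F k) (\<lambda>p. ennreal c1 * ?I p)"
        unfolding c1_def j_def by (intro nn_integral_mono dE) simp
      also have "\<dots> = ennreal c1 * csum (F k) (\<lambda>p. ?I p)" by (rule nn_integral_cmult) simp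
      also have "\<dots> \<le> ennreal c1 * ennreal (2 * 9 ^ DIM('a) * 3 ^ DIM('a) * N * side_pow k (n - \<beta>))"
        by (intro mult_left_mono sumF) simp
      also have "\<dots> = ennreal (c1 * (2 * 9 ^ DIM('a) * 3 ^ DIM('a) * N * side_pow k (n - \<beta>)))"
        using D N by (intro ennreal_mult[symmetric]) (auto simp: c1_def)
      also have "\<dots> \<le> ennreal (C2 * side_pow k0 \<beta> * 2 powr (- 1 * j))"
      proof (rule ennreal_leI)
        \<comment> \<open>Of the decay \<alpha> + 1 per level, \<alpha> is spent on comparing 2^(k
          \<alpha>) with 2^(k0 \<alpha>), and 1 remains for the sum over k.\<close>
        have e: "2 powr (- (\<alpha> + 1) * j) * side_pow k \<alpha> \<le> side_pow k0 \<alpha> * 2 powr (- 1 * j)"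
        proof -
          have "real_of_int k * \<alpha> \<le> (real_of_int k0 + j) * \<alpha>" using \<alpha> by (intro mult_right_mono) (auto simp: j_def)
          then have "- (\<alpha> + 1) * j + real_of_int k * \<alpha> \<le> real_of_int k0 * \<alpha> + - 1 * j" by (simp add: algebra_simps)
          then show ?thesis unfolding powr_add[symmetric] by (rule powr_mono) simp
        qed
        have "(C1 * 2 powr (- \<theta> * j)) powr (M - 1) = C1 powr (M - 1) * 2 powr (- (\<alpha> + 1) * j)"
        proof -
          have "\<theta> * (M - 1) = \<alpha> + 1" using \<theta> by (simp add: M_def)
          then have "- \<theta> * j * (M - 1) = - (\<alpha> + 1) * j" by (metis minus_mult_left mult.assoc mult.commute)
          then show ?thesis using C1 by (simp only: powr_mult[of C1] powr_powr less_imp_le powr_ge_zero)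
        qed
        then have "c1 * (2 * 9 ^ DIM('a) * 3 ^ DIM('a) * N * side_pow k (n - \<beta>))
          = C2 * (2 powr (- (\<alpha> + 1) * j) * (side_pow k \<gamma> * side_pow k (n - \<beta>))) * N"
          by (simp add: c1_def C2_def)
        also have "side_pow k \<gamma> * side_pow k (n - \<beta>) = side_pow k \<alpha>"
          by (simp add: \<gamma>_def algebra_simps flip: powr_add)
        also have "C2 * (2 powr (- (\<alpha> + 1) * j) * side_pow k \<alpha>) * N
          \<le> C2 * (side_pow k0 \<alpha> * 2 powr (- 1 * j)) * side_pow k0 (\<beta> - \<alpha>)"
          using C2 N by (intro mult_mono[OF mult_left_mono[OF e]]) auto
        also have "\<dots> = C2 * (side_pow k0 \<alpha> * side_pow k0 (\<beta> - \<alpha>)) * 2 powr (- 1 * j)" by simp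
        also have "side_pow k0 \<alpha> * side_pow k0 (\<beta> - \<alpha>) = side_pow k0 \<beta>"
          by (simp add: algebra_simps flip: powr_add)
        finally show "c1 * (2 * 9 ^ DIM('a) * 3 ^ DIM('a) * N * side_pow k (n - \<beta>)) \<le> C2 * side_pow k0 \<beta> * 2 powr (- 1 * j)" .
      qed
      finally show ?thesis using C2 by (simp add: j_def ennreal_mult)
    qed
    have "dcontent \<beta> X \<le> csum UNIV (\<lambda>k. dcontent \<beta> (\<Union>p\<in>F k. E p))"
      unfolding X_def by (rule dcontent_UN) simp
    also have "\<dots> \<le> csum UNIV (\<lambda>k. ennreal (C2 * side_pow k0 \<beta>) * ennreal (2 powr (- 1 * real_of_int \<bar>k - k0\<bar>)))"
      by (intro nn_integral_mono level)
    also have "\<dots> = ennreal (C2 * side_pow k0 \<beta>) * csum UNIV (\<lambda>k. ennreal (2 powr (- 1 * real_of_int \<bar>k - k0\<bar>)))"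
      by (rule nn_integral_cmult) simp
    also have "\<dots> \<le> ennreal (C2 * side_pow k0 \<beta>) * ennreal S"
      by (intro mult_left_mono S) simp
    also have "\<dots> = ennreal (C2 * S * side_pow k0 \<beta>)"
      using C2 S by (simp add: mult_ac flip: ennreal_mult)
    finally have dX: "dcontent \<beta> X \<le> ennreal (C2 * S * side_pow k0 \<beta>)" .
    have "ennreal \<bar>b x - c (k, dyadic_cube k x)\<bar> * ?I (k, dyadic_cube k x) \<le> ennreal (U C' (\<theta> / 2) k0 k)"
      if x: "x \<notin> X" and good: "\<And>k. ?I (k, dyadic_cube k x) \<le> ennreal (U C1 \<theta> k0 k)" for x k
    proof (cases "?I (k, dyadic_cube k x) = 0")
      case False
      define r where "r m = enn2real (?I (m, dyadic_cube m x))" for m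
      have Ir: "?I (m, dyadic_cube m x) = ennreal (r m)" for m
      proof -
        have "?I (m, dyadic_cube m x) < top" using good[of m] by (auto simp: le_less_trans)
        then show ?thesis by (simp add: r_def)
      qed
      have r0: "0 \<le> r m" for m by (simp add: r_def)
      have rU: "r m \<le> U C1 \<theta> k0 m" for m using good[of m] U0 by (simp add: Ir)
      have rk: "0 < r k" using False r0[of k] by (auto simp: Ir)
      have rB: "r m \<le> (2 * 9 ^ DIM('a) * N) * side_pow m (n - \<beta>)" for m
      proof -
        have "ennreal (r m) \<le> (\<integral>\<^sup>+y\<in>dyadic_nbhd m x. ennreal (h y) \<partial>lebesgue)"
          using Ih[of "(m, dyadic_cube m x)"] by (simp add: Ir)
        also have "\<dots> \<le> ennreal ((2 * 9 ^ DIM('a) * N) * side_pow m (n - \<beta>))"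
          unfolding n_def by (rule level_cover_nbhd[OF \<beta> cov N(1)])
        finally show ?thesis using N by simp
      qed
      \<comment> \<open>Off \<open>X\<close> the oscillation at x is controlled on record cubes
        only, so the cube of level k is compared with a record ancestor m - k generations above
        it.\<close>
      obtain m where m: "k \<le> m" "r k * side_pow (m - k) \<beta> \<le> r m"
        and rec: "\<And>m'. m \<le> m' \<Longrightarrow> r m' \<le> side_pow (m' - m) \<beta> * r m"
        using record_level_exists[OF rB rk n2] by blast
      define p where "p = (m, dyadic_cube m x)"
      have "0 < r k * side_pow (m - k) \<beta>" using rk by simp
      then have rm: "0 < r m" using m(2) by (rule less_le_trans)
      have pF: "p \<in> F m"
        unfolding F_def record_cubes_def
      proof (intro CollectI conjI allI impI ballI)
        show "p \<in> dyadics" "fst p = m" by (auto simp: p_def)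
        show "?I p \<noteq> 0" "?I p \<le> ennreal (U C1 \<theta> k0 m)" using rm good[of m] by (auto simp: p_def Ir)
        fix m' z assume m': "m \<le> m'" and "z \<in> snd p"
        then have "z \<in> dyadic_cube m' x" using dyadic_cube_mono[OF m', of x] by (auto simp: p_def)
        then show "?I (m', dyadic_cube m' z) \<le> ennreal (side_pow (m' - m) \<beta>) * ?I p"
          using rec[OF m'] r0 by (simp add: dyadic_cube_eq p_def Ir flip: ennreal_mult)
      qed
      have "x \<notin> E p" using x pF by (auto simp: X_def)
      then have bp: "\<bar>b x - c p\<bar> \<le> 1 / sqrt (a p)" by (auto simp: E_def p_def)
      define j where "j = real_of_int \<bar>k - k0\<bar>"
      define u where "u = real_of_int (m - k)"
      define s where "s = r k * side_pow k (\<alpha> - n)"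
      define S' where "S' = a p"
      have u: "0 \<le> u" using m(1) by (simp add: u_def)
      have S'e: "S' = r m * side_pow m (\<alpha> - n)" by (simp add: S'_def a_def p_def r_def)
      have s: "0 < s" "0 < S'" using rk rm by (auto simp: s_def S'e)
      have canc: "U C1 \<theta> k0 i * side_pow i (\<alpha> - n) = C1 * 2 powr (- \<theta> * real_of_int \<bar>i - k0\<bar>)" for i
      proof -
        have "side_pow i (n - \<alpha>) * side_pow i (\<alpha> - n) = 1"
          by (simp add: algebra_simps flip: powr_add)
        then show ?thesis by (simp add: U_def n_def)
      qed
      have sU: "s \<le> C1 * 2 powr (- \<theta> * j)"
        unfolding s_def j_def canc[symmetric] by (intro mult_right_mono rU) simp
      have "S' \<le> C1 * 2 powr (- \<theta> * real_of_int \<bar>m - k0\<bar>)"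
        unfolding S'e canc[symmetric] by (intro mult_right_mono rU) simp
      also have "\<dots> \<le> C1 * 2 powr 0" using C1 \<theta> by (intro mult_left_mono powr_mono) auto
      finally have S'C: "S' \<le> C1" by simp
      \<comment> \<open>Up to the record ancestor the mass grows at least by 2^(u \<beta>) and the
        normalisation changes by 2^(-u (n-\<alpha>)), so the average of the original cube is smaller
        by 2^(-\<gamma> u).\<close>
      have sS: "s \<le> S' * 2 powr (- \<gamma> * u)"
      proof -
        have "s = r k * side_pow (m - k) \<beta> * (2 powr (- u * \<beta>) * side_pow k (\<alpha> - n))"
          by (simp add: s_def u_def mult.assoc algebra_simps flip: powr_add)
        also have "\<dots> \<le> r m * (2 powr (- u * \<beta>) * side_pow k (\<alpha> - n))"
          by (intro mult_right_mono m) simp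
        also have "2 powr (- u * \<beta>) * side_pow k (\<alpha> - n) = side_pow m (\<alpha> - n) * 2 powr (- \<gamma> * u)"
          by (simp add: u_def \<gamma>_def algebra_simps flip: powr_add)
        finally show ?thesis by (simp add: S'e)
      qed
      have sqs: "sqrt s \<le> sqrt S' * 2 powr (- (\<gamma> / 2) * u)"
      proof -
        have "sqrt s \<le> sqrt (S' * 2 powr (- \<gamma> * u))" using sS by simp
        also have "\<dots> = sqrt S' * 2 powr (- (\<gamma> / 2) * u)"
          by (simp add: real_sqrt_mult powr_half_sqrt[symmetric] powr_powr)
        finally show ?thesis .
      qed
      have half: "2 powr (- (\<gamma> / 2) * u) \<le> 2 powr 0" using \<gamma> u by (intro powr_mono) auto
      \<comment> \<open>The two terms of the oscillation, 1 / sqrt S' from x being outside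
        \<open>X\<close> and \<open>A3 * u\<close> from the change of mean, are each brought below a
        multiple of sqrt s after multiplication by s. In the second the gain 2^(-\<gamma> u / 2)
        pays for the factor u.\<close>
      have t1: "s * (1 / sqrt S') \<le> sqrt s"
      proof -
        have "sqrt s * sqrt s \<le> sqrt s * (sqrt S' * 1)"
          using sqs half s by (intro mult_left_mono order_trans[OF sqs] mult_mono) auto
        then show ?thesis using s by (simp add: field_simps)
      qed
      have t2: "s * u \<le> sqrt s * (sqrt C1 * G)"
      proof -
        have "sqrt s * u \<le> (sqrt S' * 2 powr (- (\<gamma> / 2) * u)) * (G * 2 powr (\<gamma> / 2 * u))"
          using u s sqs G by (intro mult_mono) auto
        also have "\<dots> = sqrt S' * G * (2 powr (- (\<gamma> / 2) * u) * 2 powr (\<gamma> / 2 * u))" by simp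
        also have "2 powr (- (\<gamma> / 2) * u) * 2 powr (\<gamma> / 2 * u) = 1" by (simp flip: powr_add)
        also have "sqrt S' * G * 1 \<le> sqrt C1 * G" using S'C G by simp
        finally have "sqrt s * (sqrt s * u) \<le> sqrt s * (sqrt C1 * G)" using s by (intro mult_left_mono) auto
        then show ?thesis using s by (simp flip: mult.assoc)
      qed
      have "\<bar>c (k, dyadic_cube k x) - c p\<bar> \<le> A3 * u"
        unfolding p_def A3_def u_def by (rule oscillation_bound_chain[OF \<beta> A b m(1)])
      then have "\<bar>b x - c (k, dyadic_cube k x)\<bar> \<le> 1 / sqrt S' + A3 * u" using bp unfolding S'_def by linarith
      then have "\<bar>b x - c (k, dyadic_cube k x)\<bar> * s \<le> (1 / sqrt S' + A3 * u) * s" using s by (intro mult_right_mono) auto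
      also have "\<dots> = s * (1 / sqrt S') + A3 * (s * u)" by (simp add: algebra_simps)
      also have "\<dots> \<le> sqrt s + A3 * (sqrt s * (sqrt C1 * G))" using t1 t2 A3 by (intro add_mono mult_left_mono) auto
      also have "\<dots> = sqrt s * (1 + A3 * (sqrt C1 * G))" by (simp add: algebra_simps)
      also have "\<dots> \<le> (sqrt C1 * 2 powr (- (\<theta> / 2) * j)) * (1 + A3 * (sqrt C1 * G))"
      proof (rule mult_right_mono)
        have "sqrt s \<le> sqrt (C1 * 2 powr (- \<theta> * j))" using sU by simp
        also have "\<dots> = sqrt C1 * 2 powr (- (\<theta> / 2) * j)"
          by (simp add: real_sqrt_mult powr_half_sqrt[symmetric] powr_powr)
        finally show "sqrt s \<le> sqrt C1 * 2 powr (- (\<theta> / 2) * j)" .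
        show "0 \<le> 1 + A3 * (sqrt C1 * G)" using A3 C1 G by simp
      qed
      finally have fin: "\<bar>b x - c (k, dyadic_cube k x)\<bar> * s \<le> C' * 2 powr (- (\<theta> / 2) * j)" by (simp add: C'_def mult_ac)
      have "r k = s * side_pow k (n - \<alpha>)"
        by (simp add: s_def mult.assoc algebra_simps flip: powr_add)
      then have "\<bar>b x - c (k, dyadic_cube k x)\<bar> * r k = (\<bar>b x - c (k, dyadic_cube k x)\<bar> * s) * side_pow k (n - \<alpha>)" by simp
      also have "\<dots> \<le> (C' * 2 powr (- (\<theta> / 2) * j)) * side_pow k (n - \<alpha>)" by (intro mult_right_mono fin) simp
      finally show ?thesis unfolding Ir using r0 by (simp add: U_def n_def j_def ennreal_leI flip: ennreal_mult)
    qed simp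
    with dX show ?thesis by blast
  qed
  have C2S: "0 < C2 * S" using C2 S by simp
  show ?thesis
    by (rule exI[of _ "C2 * S"], rule conjI[OF C2S], rule exI[of _ C'], rule conjI[OF C'],
        (rule allI)+, (rule impI)+, rule main; assumption)
qed

subsection \<open>The commutator\<close>

text \<open>Each y other than x lies in one annulus 2^j < |x - y| \<le> 2^(j+1), where the kernel is
  comparable to a power of the side. The single matching term already bounds the integrand, so
  adding all the levels is harmless.\<close>

lemma kernel_dyadic_sum:
  fixes F :: "'a::euclidean_space \<Rightarrow> real"
  assumes F: "F \<in> borel_measurable lebesgue" "\<And>y. 0 \<le> F y" and \<alpha>: "\<alpha> \<le> real DIM('a)"
  shows "(\<integral>\<^sup>+y. ennreal (F y * norm (x - y) powr (\<alpha> - real DIM('a))) \<partial>lebesgue)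
    \<le> csum UNIV (\<lambda>k. ennreal (4 powr (real DIM('a) - \<alpha>) * side_pow k (\<alpha> - real DIM('a))) *
         (\<integral>\<^sup>+y\<in>dyadic_nbhd k x. ennreal (F y) \<partial>lebesgue))"
proof -
  define n where "n = real DIM('a)"
  define w where "w k = ennreal (4 powr (n - \<alpha>) * side_pow k (\<alpha> - n))" for k :: int
  have m: "(\<lambda>y. ennreal (F y) * indicator (dyadic_nbhd k x) y) \<in> borel_measurable lebesgue" for k
    using F(1) by (intro borel_measurable_times_ennreal borel_measurable_indicator) auto
  have "(\<integral>\<^sup>+y. ennreal (F y * norm (x - y) powr (\<alpha> - n)) \<partial>lebesgue)
     \<le> (\<integral>\<^sup>+y. csum UNIV (\<lambda>k. w k * (ennreal (F y) * indicator (dyadic_nbhd k x) y)) \<partial>lebesgue)"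
  proof (rule nn_integral_mono)
    fix y
    show "ennreal (F y * norm (x - y) powr (\<alpha> - n)) \<le> csum UNIV (\<lambda>k. w k * (ennreal (F y) * indicator (dyadic_nbhd k x) y))"
    \<comment> \<open>At y = x the kernel is \<open>0 powr _\<close>, which is 0, so the singularity
      contributes nothing.\<close>
    proof (cases "x = y")
      case False
      then have "0 < norm (x - y)" by simp
      then obtain j where j: "2 powr real_of_int j < norm (x - y)" "norm (x - y) \<le> 2 * 2 powr real_of_int j"
        using dyadic_level_exists by blast
      \<comment> \<open>Two levels up instead of one, since |x - y| may equal 2^(j+1) and the ball
        inside the neighbourhood is open; this causes the factor 4^(n-\<alpha>).\<close>
      define k where "k = j + 2"
      have e: "2 powr real_of_int k = 4 * 2 powr real_of_int j" by (simp add: k_def powr_add)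
      have "norm (x - y) < 2 powr real_of_int k" using j by (simp add: e)
      then have y: "y \<in> dyadic_nbhd k x" using ball_subset_dyadic_nbhd[of x k] by (auto simp: dist_norm)
      have "norm (x - y) powr (\<alpha> - n) \<le> (2 powr real_of_int j) powr (\<alpha> - n)"
        using j \<alpha> by (intro powr_mono2') (auto simp: n_def)
      also have "2 powr real_of_int j = 2 powr real_of_int k / 4" by (simp add: e)
      also have "(2 powr real_of_int k / 4) powr (\<alpha> - n) = (2 powr real_of_int k) powr (\<alpha> - n) / 4 powr (\<alpha> - n)"
        by (simp add: powr_divide)
      also have "\<dots> = 4 powr (n - \<alpha>) * side_pow k (\<alpha> - n)"
        using powr_minus_divide[of 4 "\<alpha> - n"] by (simp add: powr_powr)
      finally have "F y * norm (x - y) powr (\<alpha> - n) \<le> F y * (4 powr (n - \<alpha>) * side_pow k (\<alpha> - n))"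
        using F(2) by (rule mult_left_mono)
      then have "ennreal (F y * norm (x - y) powr (\<alpha> - n)) \<le> w k * (ennreal (F y) * indicator (dyadic_nbhd k x) y)"
        using y F(2) by (simp add: w_def mult.commute ennreal_leI flip: ennreal_mult)
      also have "\<dots> \<le> csum UNIV (\<lambda>k. w k * (ennreal (F y) * indicator (dyadic_nbhd k x) y))"
        by (rule nn_integral_ge_point) simp
      finally show ?thesis .
    qed simp
  qed
  also have "\<dots> = csum UNIV (\<lambda>k. \<integral>\<^sup>+y. w k * (ennreal (F y) * indicator (dyadic_nbhd k x) y) \<partial>lebesgue)"
    by (intro nn_integral_count_space_nn_integral borel_measurable_times_ennreal borel_measurable_const m) simp
  also have "\<dots> = csum UNIV (\<lambda>k. w k * (\<integral>\<^sup>+y\<in>dyadic_nbhd k x. ennreal (F y) \<partial>lebesgue))"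
    by (intro nn_integral_cong nn_integral_cmult m)
  finally show ?thesis unfolding w_def n_def .
qed

text \<open>The powers of the side cancel level by level, and a geometric series in the distance to
  \<open>k0\<close> is left.\<close>

lemma kernel_geometric_bound:
  fixes F :: "'a::euclidean_space \<Rightarrow> real"
  assumes F: "F \<in> borel_measurable lebesgue" "\<And>y. 0 \<le> F y" and \<alpha>: "\<alpha> \<le> real DIM('a)" and B: "0 \<le> B" and S: "0 \<le> S"
    and le: "\<And>k. (\<integral>\<^sup>+y\<in>dyadic_nbhd k x. ennreal (F y) \<partial>lebesgue)
      \<le> ennreal (B * 2 powr (- \<epsilon> * real_of_int \<bar>k - k0\<bar>) * side_pow k (real DIM('a) - \<alpha>))"
    and sum: "csum UNIV (\<lambda>k. ennreal (2 powr (- \<epsilon> * real_of_int \<bar>k - k0\<bar>))) \<le> ennreal S"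
  shows "(\<integral>\<^sup>+y. ennreal (F y * norm (x - y) powr (\<alpha> - real DIM('a))) \<partial>lebesgue) \<le> ennreal (4 powr (real DIM('a) - \<alpha>) * B * S)"
proof -
  define n where "n = real DIM('a)"
  have "(\<integral>\<^sup>+y. ennreal (F y * norm (x - y) powr (\<alpha> - n)) \<partial>lebesgue)
    \<le> csum UNIV (\<lambda>k. ennreal (4 powr (n - \<alpha>) * side_pow k (\<alpha> - n)) *
         (\<integral>\<^sup>+y\<in>dyadic_nbhd k x. ennreal (F y) \<partial>lebesgue))"
    unfolding n_def by (rule kernel_dyadic_sum[OF F \<alpha>])
  also have "\<dots> \<le> csum UNIV (\<lambda>k. ennreal (4 powr (n - \<alpha>) * B) * ennreal (2 powr (- \<epsilon> * real_of_int \<bar>k - k0\<bar>)))"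
  proof (rule nn_integral_mono)
    fix k :: int
    define P where "P = 2 powr (- \<epsilon> * real_of_int \<bar>k - k0\<bar>)"
    have one: "side_pow k (\<alpha> - n) * side_pow k (n - \<alpha>) = 1"
      by (simp add: algebra_simps flip: powr_add)
    have "ennreal (4 powr (n - \<alpha>) * side_pow k (\<alpha> - n)) * (\<integral>\<^sup>+y\<in>dyadic_nbhd k x. ennreal (F y) \<partial>lebesgue)
      \<le> ennreal (4 powr (n - \<alpha>) * side_pow k (\<alpha> - n)) * ennreal (B * P * side_pow k (n - \<alpha>))"
      unfolding n_def P_def by (intro mult_left_mono le) simp
    also have "\<dots> = ennreal (4 powr (n - \<alpha>) * side_pow k (\<alpha> - n) * (B * P * side_pow k (n - \<alpha>)))"
      using B by (intro ennreal_mult[symmetric]) (auto simp: P_def)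
    also have "4 powr (n - \<alpha>) * side_pow k (\<alpha> - n) * (B * P * side_pow k (n - \<alpha>))
      = 4 powr (n - \<alpha>) * B * P * (side_pow k (\<alpha> - n) * side_pow k (n - \<alpha>))" by (simp only: mult_ac)
    also have "\<dots> = 4 powr (n - \<alpha>) * B * P" unfolding one by simp
    also have "ennreal \<dots> = ennreal (4 powr (n - \<alpha>) * B) * ennreal P" using B by (intro ennreal_mult) (auto simp: P_def)
    finally show "ennreal (4 powr (n - \<alpha>) * side_pow k (\<alpha> - n)) * (\<integral>\<^sup>+y\<in>dyadic_nbhd k x. ennreal (F y) \<partial>lebesgue)
      \<le> ennreal (4 powr (n - \<alpha>) * B) * ennreal (2 powr (- \<epsilon> * real_of_int \<bar>k - k0\<bar>))" unfolding P_def .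
  qed
  also have "\<dots> = ennreal (4 powr (n - \<alpha>) * B) * csum UNIV (\<lambda>k. ennreal (2 powr (- \<epsilon> * real_of_int \<bar>k - k0\<bar>)))"
    by (rule nn_integral_cmult) simp
  also have "\<dots> \<le> ennreal (4 powr (n - \<alpha>) * B) * ennreal S"
    by (intro mult_left_mono sum) simp
  also have "\<dots> = ennreal (4 powr (n - \<alpha>) * B * S)" using B S by (intro ennreal_mult[symmetric]) auto
  finally show ?thesis unfolding n_def .
qed

text \<open>\<open>riesz\<close> is a Bochner integral with default value 0 on non-integrable
  functions, so linearity has to be justified. With K the kernel, integrability of f K and of (b x -
  b y) f K gives that of b f K, and then the commutator is the integral of (b x - b y) f K.\<close>

lemma commutator_le_nn_integral:
  fixes b f :: "'a::euclidean_space \<Rightarrow> real"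
  assumes bm: "b \<in> borel_measurable lebesgue" and fm: "f \<in> borel_measurable lebesgue"
    and fin: "(\<integral>\<^sup>+y. ennreal (\<bar>f y\<bar> * norm (x - y) powr (\<alpha> - real DIM('a))) \<partial>lebesgue) < \<infinity>"
    and le: "(\<integral>\<^sup>+y. ennreal (\<bar>b x - b y\<bar> * \<bar>f y\<bar> * norm (x - y) powr (\<alpha> - real DIM('a))) \<partial>lebesgue) \<le> ennreal C" and C: "0 \<le> C"
  shows "\<bar>commutator b \<alpha> f x\<bar> \<le> C"
proof -
  define K where "K y = norm (x - y) powr (\<alpha> - real DIM('a))" for y
  have "K \<in> borel_measurable lborel" unfolding K_def by measurable
  then have Km: "K \<in> borel_measurable lebesgue" by (rule measurable_completion)
  have K0: "0 \<le> K y" for y by (simp add: K_def)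
  have G: "integrable lebesgue (\<lambda>y. f y * K y)"
  proof (rule integrableI_bounded)
    show "(\<lambda>y. f y * K y) \<in> borel_measurable lebesgue" using fm Km by (rule borel_measurable_times)
    show "(\<integral>\<^sup>+y. ennreal (norm (f y * K y)) \<partial>lebesgue) < \<infinity>" using fin K0 by (simp add: abs_mult K_def)
  qed
  have H: "integrable lebesgue (\<lambda>y. (b x - b y) * f y * K y)"
  proof (rule integrableI_bounded)
    show "(\<lambda>y. (b x - b y) * f y * K y) \<in> borel_measurable lebesgue"
      by (intro borel_measurable_times borel_measurable_diff borel_measurable_const bm fm Km)
    have "(\<integral>\<^sup>+y. ennreal (norm ((b x - b y) * f y * K y)) \<partial>lebesgue) \<le> ennreal C" using le K0 by (simp add: abs_mult K_def)
    then show "(\<integral>\<^sup>+y. ennreal (norm ((b x - b y) * f y * K y)) \<partial>lebesgue) < \<infinity>" by (auto simp: le_less_trans)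
  qed
  have "integral\<^sup>L lebesgue (\<lambda>y. (b x - b y) * f y * K y) = integral\<^sup>L lebesgue (\<lambda>y. b x * (f y * K y) - b y * f y * K y)"
    by (simp add: algebra_simps)
  also have "\<dots> = b x * integral\<^sup>L lebesgue (\<lambda>y. f y * K y) - integral\<^sup>L lebesgue (\<lambda>y. b y * f y * K y)"
  proof -
    have "integrable lebesgue (\<lambda>y. b x * (f y * K y) - (b x - b y) * f y * K y)"
      using G H by (intro Bochner_Integration.integrable_diff integrable_mult_right)
    then have "integrable lebesgue (\<lambda>y. b y * f y * K y)" by (simp add: algebra_simps)
    then show ?thesis using G by (subst Bochner_Integration.integral_diff) auto
  qed
  also have "\<dots> = commutator b \<alpha> f x" by (simp add: commutator_def riesz_def K_def)
  finally have e: "commutator b \<alpha> f x = integral\<^sup>L lebesgue (\<lambda>y. (b x - b y) * f y * K y)" by simp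
  have "\<bar>commutator b \<alpha> f x\<bar> \<le> integral\<^sup>L lebesgue (\<lambda>y. norm ((b x - b y) * f y * K y))"
    unfolding e using integral_norm_bound[of lebesgue "\<lambda>y. (b x - b y) * f y * K y"] by simp
  moreover have "ennreal (integral\<^sup>L lebesgue (\<lambda>y. norm ((b x - b y) * f y * K y))) \<le> ennreal C"
    using nn_integral_eq_integral[OF integrable_norm[OF H]] le K0 by (simp add: abs_mult K_def)
  ultimately show ?thesis using C by simp
qed

text \<open>The normalised case, with a fixed oscillation constant and a fixed height
  \<open>C0\<close>. The hypothesis on N and k0 contains the logarithm, so the averages of B(|f|)
  are small by that factor; those of |f| inherit the decay from |f| \<le> B(|f|).\<close>

lemma commutator_dyadic_bound:
  fixes \<alpha> \<beta> A :: real
  assumes \<beta>: "0 < \<beta>" "\<beta> \<le> real DIM('a)" and \<alpha>: "0 < \<alpha>" "\<alpha> < \<beta>" "real DIM('a) - \<alpha> < \<beta>" and A: "0 < A"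
  shows "\<exists>C0>0. \<exists>C1>0. \<forall>(b::'a::euclidean_space \<Rightarrow> real) c f \<C> N k0. b \<in> borel_measurable lebesgue \<longrightarrow> f \<in> borel_measurable lebesgue \<longrightarrow>
     oscillation_bound \<beta> A b c \<longrightarrow> level_cover \<beta> (\<lambda>y. Bfun \<bar>f y\<bar>) \<C> N \<longrightarrow> 0 \<le> N \<longrightarrow>
     N * ln (exp 1 + side_pow k0 \<alpha>) \<le> side_pow k0 (\<beta> - \<alpha>) \<longrightarrow>
     (\<exists>X. dcontent \<beta> X \<le> ennreal (C1 * side_pow k0 \<beta>) \<and> (\<forall>x. x \<notin> X \<longrightarrow> \<bar>commutator b \<alpha> f x\<bar> \<le> C0))"
proof -
  define n where "n = real DIM('a)"
  define \<theta> where "\<theta> = min \<alpha> (\<beta> - \<alpha>)"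
  have \<theta>: "0 < \<theta>" using \<alpha> by (simp add: \<theta>_def)
  have \<alpha>n: "\<alpha> \<le> real DIM('a)" using \<alpha> \<beta> by simp
  define C1 where "C1 = (4 * 9 ^ DIM('a) :: real)"
  have C1: "0 < C1" by (simp add: C1_def)
  obtain C2 where C2': "0 < C2 \<and> (\<forall>(b::'a \<Rightarrow> real) c f k0 k x. b \<in> borel_measurable lebesgue \<longrightarrow> oscillation_bound \<beta> A b c \<longrightarrow>
     f \<in> borel_measurable lebesgue \<longrightarrow>
     (\<integral>\<^sup>+y\<in>dyadic_nbhd k x. ennreal (Bfun \<bar>f y\<bar>) \<partial>lebesgue)
       \<le> ennreal (C1 / ln (exp 1 + side_pow k0 \<alpha>) * 2 powr (- \<theta> * real_of_int \<bar>k - k0\<bar>) * side_pow k (n - \<alpha>)) \<longrightarrow>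
     (\<integral>\<^sup>+y\<in>dyadic_nbhd k x. ennreal (\<bar>b y - c (k, dyadic_cube k x)\<bar> * \<bar>f y\<bar>) \<partial>lebesgue)
       \<le> ennreal (C2 * 2 powr (- (\<theta> / 2) * real_of_int \<bar>k - k0\<bar>) * side_pow k (n - \<alpha>)))"
    using oscillation_product_bound[OF \<beta> \<alpha>(1,2) A C1, folded n_def \<theta>_def] by (elim exE) (rule that)
  have C2: "0 < C2" by (rule conjunct1[OF C2'])
  note prod = conjunct2[OF C2', rule_format]
  obtain C3 where C3': "0 < C3 \<and> (\<exists>C4>0. \<forall>(b::'a \<Rightarrow> real) c f h \<C> N k0. oscillation_bound \<beta> A b c \<longrightarrow> level_cover \<beta> h \<C> N \<longrightarrow>
     0 \<le> N \<longrightarrow> N \<le> side_pow k0 (\<beta> - \<alpha>) \<longrightarrow> f \<in> borel_measurable lebesgue \<longrightarrow> (\<forall>y. \<bar>f y\<bar> \<le> h y) \<longrightarrow>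
     (\<exists>X. dcontent \<beta> X \<le> ennreal (C3 * side_pow k0 \<beta>) \<and>
       (\<forall>x. x \<notin> X \<longrightarrow> (\<forall>k. nbhd_integral f (k, dyadic_cube k x) \<le> ennreal (C1 * 2 powr (- \<theta> * real_of_int \<bar>k - k0\<bar>) * side_pow k (n - \<alpha>))) \<longrightarrow>
         (\<forall>k. ennreal \<bar>b x - c (k, dyadic_cube k x)\<bar> * nbhd_integral f (k, dyadic_cube k x)
           \<le> ennreal (C4 * 2 powr (- (\<theta> / 2) * real_of_int \<bar>k - k0\<bar>) * side_pow k (n - \<alpha>))))))"
    using record_exceptional_set[OF \<beta> \<alpha> A C1, folded n_def \<theta>_def] by (elim exE) (rule that)
  have C3: "0 < C3" by (rule conjunct1[OF C3'])
  obtain C4 where C4': "0 < C4 \<and> (\<forall>(b::'a \<Rightarrow> real) c f h \<C> N k0. oscillation_bound \<beta> A b c \<longrightarrow> level_cover \<beta> h \<C> N \<longrightarrow>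
     0 \<le> N \<longrightarrow> N \<le> side_pow k0 (\<beta> - \<alpha>) \<longrightarrow> f \<in> borel_measurable lebesgue \<longrightarrow> (\<forall>y. \<bar>f y\<bar> \<le> h y) \<longrightarrow>
     (\<exists>X. dcontent \<beta> X \<le> ennreal (C3 * side_pow k0 \<beta>) \<and>
       (\<forall>x. x \<notin> X \<longrightarrow> (\<forall>k. nbhd_integral f (k, dyadic_cube k x) \<le> ennreal (C1 * 2 powr (- \<theta> * real_of_int \<bar>k - k0\<bar>) * side_pow k (n - \<alpha>))) \<longrightarrow>
         (\<forall>k. ennreal \<bar>b x - c (k, dyadic_cube k x)\<bar> * nbhd_integral f (k, dyadic_cube k x)
           \<le> ennreal (C4 * 2 powr (- (\<theta> / 2) * real_of_int \<bar>k - k0\<bar>) * side_pow k (n - \<alpha>))))))"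
    using conjunct2[OF C3'] by (elim exE) (rule that)
  have C4: "0 < C4" by (rule conjunct1[OF C4'])
  obtain S where S: "0 < S" and sum: "\<And>k0. (csum UNIV (\<lambda>k. ennreal (2 powr (- (\<theta> / 2) * real_of_int \<bar>k - k0\<bar>)))) \<le> ennreal S"
    using csum_int_geometric[of "\<theta> / 2"] \<theta> by auto
  define C0 where "C0 = 4 powr (n - \<alpha>) * (C4 + C2) * S"
  define C5 where "C5 = 3 ^ DIM('a) + C3"
  have C0: "0 < C0" using C4 C2 S by (simp add: C0_def)
  have C5: "0 < C5" using C3 by (simp add: C5_def add_pos_pos)
  have main: "\<exists>X. dcontent \<beta> X \<le> ennreal (C5 * side_pow k0 \<beta>) \<and> (\<forall>x. x \<notin> X \<longrightarrow> \<bar>commutator b \<alpha> f x\<bar> \<le> C0)"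
    if bm: "b \<in> borel_measurable lebesgue" and fm: "f \<in> borel_measurable lebesgue" and b: "oscillation_bound \<beta> A b c"
      and cov: "level_cover \<beta> (\<lambda>y. Bfun \<bar>f y\<bar>) \<C> N" and N: "0 \<le> N"
      and NL: "N * ln (exp 1 + side_pow k0 \<alpha>) \<le> side_pow k0 (\<beta> - \<alpha>)"
    for b :: "'a \<Rightarrow> real" and c f \<C> N k0
  proof -
    define L where "L = ln (exp 1 + side_pow k0 \<alpha>)"
    have L: "1 \<le> L" unfolding L_def by (rule ln_e_add_ge_1) simp
    have hm: "(\<lambda>y. Bfun \<bar>f y\<bar>) \<in> borel_measurable lebesgue" using fm by measurable
    have "N * 1 \<le> N * L" by (rule mult_left_mono[OF L N])
    then have N2: "N \<le> side_pow k0 (\<beta> - \<alpha>)" using NL unfolding L_def by linarith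
    obtain X1 where X1: "dcontent \<beta> X1 \<le> ennreal (3 ^ DIM('a) * side_pow k0 \<beta>)"
      and av: "\<And>x k. x \<notin> X1 \<Longrightarrow> (\<integral>\<^sup>+y\<in>dyadic_nbhd k x. ennreal (Bfun \<bar>f y\<bar>) \<partial>lebesgue)
      \<le> ennreal (C1 / L * 2 powr (- \<theta> * real_of_int \<bar>k - k0\<bar>) * side_pow k (n - \<alpha>))"
      using dyadic_average_decay[OF \<beta> cov N hm L \<alpha>(1,2) NL[folded L_def]] unfolding C1_def n_def \<theta>_def by blast
    have fB: "\<forall>y. \<bar>f y\<bar> \<le> Bfun \<bar>f y\<bar>" by (simp add: Bfun_ge)
    obtain X2 where X2: "dcontent \<beta> X2 \<le> ennreal (C3 * side_pow k0 \<beta>)"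
      and rec: "\<And>x k. x \<notin> X2 \<Longrightarrow> (\<forall>k. nbhd_integral f (k, dyadic_cube k x) \<le> ennreal (C1 * 2 powr (- \<theta> * real_of_int \<bar>k - k0\<bar>) * side_pow k (n - \<alpha>))) \<Longrightarrow>
         ennreal \<bar>b x - c (k, dyadic_cube k x)\<bar> * nbhd_integral f (k, dyadic_cube k x)
           \<le> ennreal (C4 * 2 powr (- (\<theta> / 2) * real_of_int \<bar>k - k0\<bar>) * side_pow k (n - \<alpha>))"
      using conjunct2[OF C4', THEN spec, THEN spec, THEN spec, THEN spec, THEN spec, THEN spec, THEN spec,
          THEN mp, THEN mp, THEN mp, THEN mp, THEN mp, THEN mp, OF b cov N N2 fm fB] by blast
    have "dcontent \<beta> (X1 \<union> X2) \<le> ennreal (3 ^ DIM('a) * side_pow k0 \<beta>) + ennreal (C3 * side_pow k0 \<beta>)"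
      by (rule order_trans[OF dcontent_Un add_mono[OF X1 X2]])
    also have "\<dots> = ennreal (C5 * side_pow k0 \<beta>)"
      using C3 by (simp add: C5_def algebra_simps flip: ennreal_plus)
    finally have dX: "dcontent \<beta> (X1 \<union> X2) \<le> ennreal (C5 * side_pow k0 \<beta>)" .
    have "\<bar>commutator b \<alpha> f x\<bar> \<le> C0" if x: "x \<notin> X1 \<union> X2" for x
    proof -
      define P where "P \<epsilon> k = 2 powr (- \<epsilon> * real_of_int \<bar>k - k0\<bar>) * side_pow k (n - \<alpha>)" for \<epsilon> k
      have P0: "0 \<le> P \<epsilon> k" for \<epsilon> k by (simp add: P_def)
      have avf: "nbhd_integral f (k, dyadic_cube k x) \<le> ennreal (C1 * P \<theta> k)" for k
      proof -
        have "nbhd_integral f (k, dyadic_cube k x) \<le> (\<integral>\<^sup>+y\<in>dyadic_nbhd k x. ennreal (Bfun \<bar>f y\<bar>) \<partial>lebesgue)"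
          unfolding nbhd_integral_cube using fB by (intro nn_integral_mono mult_right_mono ennreal_leI) auto
        also have "\<dots> \<le> ennreal (C1 / L * P \<theta> k)" using av[of x k] x by (simp add: P_def mult.assoc)
        also have "\<dots> \<le> ennreal (C1 * P \<theta> k)"
        proof (intro ennreal_leI mult_right_mono P0)
          show "C1 / L \<le> C1" using L C1 by (simp add: divide_le_eq)
        qed
        finally show ?thesis .
      qed
      show ?thesis
      proof (rule commutator_le_nn_integral[OF bm fm])
        show "(\<integral>\<^sup>+y. ennreal (\<bar>f y\<bar> * norm (x - y) powr (\<alpha> - real DIM('a))) \<partial>lebesgue) < \<infinity>"
        \<comment> \<open>Finiteness of the potential of |f| at x is needed to write the commutator
          as one integral; the decay of the averages of |f| provides it.\<close>
        proof (rule le_less_trans)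
          show "(\<integral>\<^sup>+y. ennreal (\<bar>f y\<bar> * norm (x - y) powr (\<alpha> - real DIM('a))) \<partial>lebesgue) \<le> ennreal (4 powr (real DIM('a) - \<alpha>) * C1 * S)"
          proof (rule kernel_geometric_bound[OF _ _ \<alpha>n _ _ _ sum[of k0]])
            fix k
            have "C1 * P \<theta> k \<le> C1 * P (\<theta> / 2) k"
              unfolding P_def using C1 \<theta> by (intro mult_left_mono mult_right_mono powr_mono) (auto intro!: mult_right_mono)
            then have "nbhd_integral f (k, dyadic_cube k x) \<le> ennreal (C1 * P (\<theta> / 2) k)"
              using avf[of k] by (meson ennreal_leI order_trans)
            then show "(\<integral>\<^sup>+y\<in>dyadic_nbhd k x. ennreal \<bar>f y\<bar> \<partial>lebesgue)
              \<le> ennreal (C1 * 2 powr (- (\<theta> / 2) * real_of_int \<bar>k - k0\<bar>) * side_pow k (real DIM('a) - \<alpha>))"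
              unfolding nbhd_integral_cube P_def n_def by (simp add: mult.assoc)
          qed (use fm C1 S in auto)
        qed simp
        have "(\<integral>\<^sup>+y. ennreal ((\<bar>b x - b y\<bar> * \<bar>f y\<bar>) * norm (x - y) powr (\<alpha> - real DIM('a))) \<partial>lebesgue) \<le> ennreal (4 powr (real DIM('a) - \<alpha>) * (C4 + C2) * S)"
        proof (rule kernel_geometric_bound[OF _ _ \<alpha>n _ _ _ sum[of k0]])
          fix k
          define ck where "ck = c (k, dyadic_cube k x)"
          have m1: "(\<lambda>y. ennreal \<bar>f y\<bar> * indicator (dyadic_nbhd k x) y) \<in> borel_measurable lebesgue"
            using fm by (intro borel_measurable_times_ennreal borel_measurable_indicator) auto
          have m2: "(\<lambda>y. ennreal (\<bar>b y - ck\<bar> * \<bar>f y\<bar>) * indicator (dyadic_nbhd k x) y) \<in> borel_measurable lebesgue"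
          proof (intro borel_measurable_times_ennreal borel_measurable_indicator)
            show "(\<lambda>y. ennreal (\<bar>b y - ck\<bar> * \<bar>f y\<bar>)) \<in> borel_measurable lebesgue" using bm fm by measurable
          qed simp
          have "(\<integral>\<^sup>+y\<in>dyadic_nbhd k x. ennreal (\<bar>b x - b y\<bar> * \<bar>f y\<bar>) \<partial>lebesgue)
            \<le> (\<integral>\<^sup>+y. ennreal \<bar>b x - ck\<bar> * (ennreal \<bar>f y\<bar> * indicator (dyadic_nbhd k x) y) + ennreal (\<bar>b y - ck\<bar> * \<bar>f y\<bar>) * indicator (dyadic_nbhd k x) y \<partial>lebesgue)"
          proof (rule nn_integral_mono)
            fix y
            have "\<bar>b x - b y\<bar> * \<bar>f y\<bar> \<le> (\<bar>b x - ck\<bar> + \<bar>b y - ck\<bar>) * \<bar>f y\<bar>" by (intro mult_right_mono) auto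
            also have "\<dots> = \<bar>b x - ck\<bar> * \<bar>f y\<bar> + \<bar>b y - ck\<bar> * \<bar>f y\<bar>" by (simp add: algebra_simps)
            finally have "ennreal (\<bar>b x - b y\<bar> * \<bar>f y\<bar>) \<le> ennreal \<bar>b x - ck\<bar> * ennreal \<bar>f y\<bar> + ennreal (\<bar>b y - ck\<bar> * \<bar>f y\<bar>)"
              by (simp add: ennreal_leI flip: ennreal_mult ennreal_plus)
            then show "ennreal (\<bar>b x - b y\<bar> * \<bar>f y\<bar>) * indicator (dyadic_nbhd k x) y
              \<le> ennreal \<bar>b x - ck\<bar> * (ennreal \<bar>f y\<bar> * indicator (dyadic_nbhd k x) y) + ennreal (\<bar>b y - ck\<bar> * \<bar>f y\<bar>) * indicator (dyadic_nbhd k x) y"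
              by (cases "y \<in> dyadic_nbhd k x") auto
          qed
          also have "\<dots> = ennreal \<bar>b x - ck\<bar> * nbhd_integral f (k, dyadic_cube k x) + (\<integral>\<^sup>+y\<in>dyadic_nbhd k x. ennreal (\<bar>b y - ck\<bar> * \<bar>f y\<bar>) \<partial>lebesgue)"
            unfolding nbhd_integral_cube
            by (subst nn_integral_add[OF borel_measurable_times_ennreal[OF borel_measurable_const m1] m2]) (simp only: nn_integral_cmult[OF m1])
          also have "\<dots> \<le> ennreal (C4 * P (\<theta> / 2) k) + ennreal (C2 * P (\<theta> / 2) k)"
          proof (rule add_mono)
            show "ennreal \<bar>b x - ck\<bar> * nbhd_integral f (k, dyadic_cube k x) \<le> ennreal (C4 * P (\<theta> / 2) k)"
              using rec[of x k] x avf unfolding ck_def P_def by (simp add: mult.assoc)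
            show "(\<integral>\<^sup>+y\<in>dyadic_nbhd k x. ennreal (\<bar>b y - ck\<bar> * \<bar>f y\<bar>) \<partial>lebesgue) \<le> ennreal (C2 * P (\<theta> / 2) k)"
              using prod[OF bm b fm av[of x k, unfolded L_def]] x unfolding ck_def P_def by (simp add: mult.assoc)
          qed
          also have "\<dots> = ennreal ((C4 + C2) * P (\<theta> / 2) k)"
            using C4 C2 P0 by (subst ennreal_plus[symmetric]) (auto simp: algebra_simps)
          finally show "(\<integral>\<^sup>+y\<in>dyadic_nbhd k x. ennreal (\<bar>b x - b y\<bar> * \<bar>f y\<bar>) \<partial>lebesgue)
              \<le> ennreal ((C4 + C2) * 2 powr (- (\<theta> / 2) * real_of_int \<bar>k - k0\<bar>) * side_pow k (real DIM('a) - \<alpha>))"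
            by (simp add: P_def n_def mult.assoc)
        qed (use bm fm C4 C2 S in auto)
        then show "(\<integral>\<^sup>+y. ennreal (\<bar>b x - b y\<bar> * \<bar>f y\<bar> * norm (x - y) powr (\<alpha> - real DIM('a))) \<partial>lebesgue) \<le> ennreal C0"
          by (simp add: C0_def n_def)
      qed (use C0 in simp)
    qed
    with dX show ?thesis by blast
  qed
  show ?thesis
    by (rule exI[of _ C0], rule conjI[OF C0], rule exI[of _ C5], rule conjI[OF C5],
        (rule allI)+, (rule impI)+, rule main; assumption)
qed

section \<open>Rescaling and the choice of the scale\<close>

lemma oscillation_bound_scale:
  assumes v: "0 < v" and b: "oscillation_bound \<beta> (A * v) b c"
  shows "oscillation_bound \<beta> A (\<lambda>y. b y / v) (\<lambda>p. c p / v)"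
  unfolding oscillation_bound_def
proof (rule allI, rule allI, rule allI, rule impI)
  fix k :: int and x :: 'a and t :: real assume t: "0 < t"
  have "(t < \<bar>b y / v - c (k, dyadic_cube k x) / v\<bar>) = (t * v < \<bar>b y - c (k, dyadic_cube k x)\<bar>)" for y
    using v by (simp add: field_simps flip: diff_divide_distrib)
  then have "dcontent \<beta> {y \<in> dyadic_nbhd k x. t < \<bar>b y / v - c (k, dyadic_cube k x) / v\<bar>}
     = dcontent \<beta> {y \<in> dyadic_nbhd k x. t * v < \<bar>b y - c (k, dyadic_cube k x)\<bar>}" by simp
  also have "\<dots> \<le> ennreal (A * v / (t * v) * side_pow k \<beta>)"
    using t v by (intro oscillation_boundD[OF b]) simp
  also have "A * v / (t * v) = A / t" using v by simp
  finally show "dcontent \<beta> {y \<in> dyadic_nbhd k x. t < \<bar>b y / v - c (k, dyadic_cube k x) / v\<bar>} \<le> ennreal (A / t * side_pow k \<beta>)" .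
qed

lemma commutator_scale: "commutator (\<lambda>y. r * b y) \<alpha> (\<lambda>y. s * f y) x = r * s * commutator b \<alpha> f x"
proof -
  have 1: "riesz \<alpha> (\<lambda>y. s * f y) x = s * riesz \<alpha> f x" for s and f :: "'a \<Rightarrow> real"
    unfolding riesz_def by (simp add: mult.assoc)
  have "riesz \<alpha> (\<lambda>y. r * b y * (s * f y)) x = riesz \<alpha> (\<lambda>y. (r * s) * (b y * f y)) x" by (simp add: mult_ac)
  then show ?thesis unfolding commutator_def 1 by (simp add: algebra_simps)
qed

text \<open>Multiplication by 2^d merely shifts the heights of the covers by d, which is why
  constant factors are rounded up to powers of two.\<close>

lemma level_cover_scale:
  assumes cov: "level_cover \<beta> g \<C> N" and N: "0 \<le> N" and h: "\<And>y. h y \<le> 2 powr real_of_int d * g y"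
  shows "level_cover \<beta> h (\<lambda>j. \<C> (j - d)) (2 powr real_of_int d * N)"
  unfolding level_cover_def
proof (intro conjI allI)
  fix j
  show "\<C> (j - d) \<subseteq> dyadics" using cov by (simp add: level_cover_def)
  have "{y. 2 powr real_of_int j < h y} \<subseteq> {y. 2 powr real_of_int (j - d) < g y}"
  proof
    fix y assume "y \<in> {y. 2 powr real_of_int j < h y}"
    then have "2 powr real_of_int j < 2 powr real_of_int d * g y" using h[of y] by simp
    then show "y \<in> {y. 2 powr real_of_int (j - d) < g y}" by (simp add: powr_diff field_simps)
  qed
  also have "\<dots> \<subseteq> \<Union>(snd ` \<C> (j - d))" using cov unfolding level_cover_def by blast
  finally show "{y. 2 powr real_of_int j < h y} \<subseteq> \<Union>(snd ` \<C> (j - d))" .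
next
  have "csum UNIV (\<lambda>j. csum (\<C> (j - d)) (\<lambda>p. ennreal (2 powr real_of_int j) * dyadic_weight \<beta> p))
    = csum UNIV (\<lambda>i. csum (\<C> (i + d - d)) (\<lambda>p. ennreal (2 powr real_of_int (i + d)) * dyadic_weight \<beta> p))"
    by (rule nn_integral_bij_count_space[symmetric]) (rule bij_betw_byWitness[of _ "\<lambda>j. j - d"], auto)
  also have "\<dots> = csum UNIV (\<lambda>i. ennreal (2 powr real_of_int d) * csum (\<C> i) (\<lambda>p. ennreal (2 powr real_of_int i) * dyadic_weight \<beta> p))"
  proof (rule nn_integral_cong)
    fix i
    have "ennreal (2 powr real_of_int (i + d)) = ennreal (2 powr real_of_int d) * ennreal (2 powr real_of_int i)"
      by (simp add: powr_add mult.commute flip: ennreal_mult)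
    then show "csum (\<C> (i + d - d)) (\<lambda>p. ennreal (2 powr real_of_int (i + d)) * dyadic_weight \<beta> p)
      = ennreal (2 powr real_of_int d) * csum (\<C> i) (\<lambda>p. ennreal (2 powr real_of_int i) * dyadic_weight \<beta> p)"
      by (simp add: mult.assoc nn_integral_cmult)
  qed
  also have "\<dots> = ennreal (2 powr real_of_int d) * csum UNIV (\<lambda>i. csum (\<C> i) (\<lambda>p. ennreal (2 powr real_of_int i) * dyadic_weight \<beta> p))"
    by (rule nn_integral_cmult) simp
  also have "\<dots> \<le> ennreal (2 powr real_of_int d) * ennreal N"
    using cov unfolding level_cover_def by (intro mult_left_mono) auto
  also have "\<dots> = ennreal (2 powr real_of_int d * N)" using N by (simp add: ennreal_mult)
  finally show "csum UNIV (\<lambda>j. csum (\<C> (j - d)) (\<lambda>p. ennreal (2 powr real_of_int j) * dyadic_weight \<beta> p)) \<le> ennreal (2 powr real_of_int d * N)" .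
qed

text \<open>Here \<Psi> originates. Setting \<delta>^(\<beta>-\<alpha>) = K0 I ln (e +
  I^(\<alpha>/\<beta>)) makes \<delta>^\<beta> a multiple of \<Psi>(I), but the required inequality
  has ln (e + \<delta>^\<alpha>) instead. As \<delta> is at most a power of K0 times a power of e +
  I^(\<alpha>/\<beta>), the logarithms are comparable; K0 enters the left side only logarithmically,
  so a large K0 wins.\<close>

lemma dyadic_scale_choice:
  fixes \<alpha> \<beta> C :: real
  assumes \<alpha>: "0 < \<alpha>" "\<alpha> < \<beta>" and C: "0 < C"
  shows "\<exists>K>0. \<forall>I>0. \<exists>k0::int. C * I * ln (exp 1 + side_pow k0 \<alpha>) \<le> side_pow k0 (\<beta> - \<alpha>) \<and>
    side_pow k0 \<beta> \<le> K * Psi \<alpha> \<beta> I"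
proof -
  define q where "q = \<alpha> / (\<beta> - \<alpha>)"
  \<comment> \<open>With Y = e + I^(\<alpha>/\<beta>), the product U = I ln Y is at most
    Y^(\<beta>/\<alpha> + 1), so U^q \<le> Y^r.\<close>
  define r where "r = q * (\<beta> / \<alpha> + 1)"
  define c0 where "c0 = ln (exp 1 + 2 powr \<alpha>) + r"
  \<comment> \<open>K0 is a square because ln K0 = 2 ln s \<le> 2 s. The condition on K0 then
    reduces to C (c0 + 2 q s) \<le> s^2, which holds for s \<ge> 1 and s \<ge> C (c0 + 2 q).\<close>
  define s where "s = max 1 (C * (c0 + 2 * q))"
  define K0 where "K0 = s * s"
  have q: "0 < q" using \<alpha> by (simp add: q_def)
  have r: "0 < r" using q \<alpha> by (simp add: r_def add_pos_pos)
  have c0: "0 < c0" unfolding c0_def using r ln_e_add_ge_1[of "2 powr \<alpha>"] by simp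
  have s: "1 \<le> s" "C * (c0 + 2 * q) \<le> s" by (auto simp: s_def)
  have K0: "1 \<le> K0" using s mult_mono[of 1 s 1 s] by (simp add: K0_def)
  have K0': "C * (ln (exp 1 + 2 powr \<alpha> * K0 powr q) + r) \<le> K0"
  proof -
    have "1 powr q \<le> K0 powr q" using K0 q by (intro powr_mono2) auto
    then have "exp 1 * 1 + 2 powr \<alpha> * K0 powr q \<le> exp 1 * K0 powr q + 2 powr \<alpha> * K0 powr q"
      by (intro add_right_mono mult_left_mono) auto
    also have "\<dots> = (exp 1 + 2 powr \<alpha>) * K0 powr q" by (simp add: algebra_simps)
    finally have "ln (exp 1 + 2 powr \<alpha> * K0 powr q) \<le> ln ((exp 1 + 2 powr \<alpha>) * K0 powr q)"
      using K0 by (subst ln_le_cancel_iff) (auto intro!: add_pos_pos mult_pos_pos)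
    also have "\<dots> = ln (exp 1 + 2 powr \<alpha>) + q * ln K0"
      using K0 by (subst ln_mult_pos) (auto simp: ln_powr add_pos_pos)
    also have "ln K0 = 2 * ln s" using s by (simp add: K0_def ln_mult_pos)
    also have "ln s \<le> s" using ln_le_minus_one[of s] s by linarith
    finally have "ln (exp 1 + 2 powr \<alpha> * K0 powr q) + r \<le> c0 + 2 * q * s" using q by (simp add: c0_def)
    also have "\<dots> \<le> (c0 + 2 * q) * s"
    proof -
      have "c0 * 1 \<le> c0 * s" using s c0 by (intro mult_left_mono) auto
      then show ?thesis by (simp add: algebra_simps)
    qed
    finally have "C * (ln (exp 1 + 2 powr \<alpha> * K0 powr q) + r) \<le> C * (c0 + 2 * q) * s" using C by (simp add: mult.assoc)
    also have "\<dots> \<le> s * s" using s by (intro mult_right_mono) auto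
    finally show ?thesis by (simp add: K0_def)
  qed
  define K where "K = 2 powr \<beta> * K0 powr (\<beta> / (\<beta> - \<alpha>))"
  have "\<exists>k0::int. C * I * ln (exp 1 + side_pow k0 \<alpha>) \<le> side_pow k0 (\<beta> - \<alpha>) \<and>
    side_pow k0 \<beta> \<le> K * Psi \<alpha> \<beta> I" if I: "0 < I" for I
  proof -
    define Y where "Y = exp 1 + I powr (\<alpha> / \<beta>)"
    define U where "U = I * ln Y"
    have lnY: "1 \<le> ln Y" unfolding Y_def by (rule ln_e_add_ge_1) simp
    have "(1::real) \<le> exp 1" by simp
    then have Y: "1 \<le> Y" unfolding Y_def by (intro add_increasing2) auto
    have Y0: "0 < Y" using Y by simp
    have U: "0 < U" using I lnY by (simp add: U_def)
    define \<delta> where "\<delta> = (K0 * U) powr (1 / (\<beta> - \<alpha>))"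
    have \<delta>: "0 < \<delta>" using U K0 by (simp add: \<delta>_def)
    obtain j :: int where j: "2 powr real_of_int j < \<delta>" "\<delta> \<le> 2 * 2 powr real_of_int j"
      using dyadic_level_exists[OF \<delta>] by blast
    \<comment> \<open>Rounding up gives \<delta> \<le> 2^k0 \<le> 2 \<delta>: the lower bound
      preserves the required inequality, the upper one costs only constants.\<close>
    define k0 where "k0 = j + 1"
    have e: "2 powr real_of_int k0 = 2 * 2 powr real_of_int j" by (simp add: k0_def powr_add)
    have k: "\<delta> \<le> 2 powr real_of_int k0" "2 powr real_of_int k0 \<le> 2 * \<delta>" using j by (auto simp: e)
    have pw: "side_pow k0 t = (2 powr real_of_int k0) powr t" for t by (simp add: powr_powr)
    have dp: "\<delta> powr t = (K0 * U) powr (t / (\<beta> - \<alpha>))" for t by (simp add: \<delta>_def powr_powr)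
    have up: "side_pow k0 t \<le> 2 powr t * (K0 * U) powr (t / (\<beta> - \<alpha>))" if "0 \<le> t" for t
    proof -
      have "side_pow k0 t \<le> (2 * \<delta>) powr t" unfolding pw using k that by (intro powr_mono2) auto
      also have "\<dots> = 2 powr t * \<delta> powr t" using \<delta> by (simp add: powr_mult)
      finally show ?thesis unfolding dp .
    qed
    have "C * ln (exp 1 + side_pow k0 \<alpha>) \<le> K0 * ln Y"
    proof -
      have "I = (I powr (\<alpha> / \<beta>)) powr (\<beta> / \<alpha>)" using I \<alpha> by (simp add: powr_powr)
      also have "\<dots> \<le> Y powr (\<beta> / \<alpha>)" using \<alpha> by (intro powr_mono2) (auto simp: Y_def)
      finally have IY: "I \<le> Y powr (\<beta> / \<alpha>)" .
      have "U \<le> Y powr (\<beta> / \<alpha>) * Y"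
        unfolding U_def using IY I lnY Y ln_le_minus_one[OF Y0] by (intro mult_mono) auto
      also have "\<dots> = Y powr (\<beta> / \<alpha> + 1)" using Y by (simp add: powr_add)
      finally have UY: "U powr q \<le> (Y powr (\<beta> / \<alpha> + 1)) powr q" using U q by (intro powr_mono2) auto
      have "side_pow k0 \<alpha> \<le> 2 powr \<alpha> * (K0 * U) powr q" using up[of \<alpha>] \<alpha> by (simp add: q_def)
      also have "\<dots> = 2 powr \<alpha> * K0 powr q * U powr q" using K0 U by (simp add: powr_mult)
      also have "\<dots> \<le> 2 powr \<alpha> * K0 powr q * Y powr r"
        using UY by (intro mult_left_mono) (auto simp: powr_powr r_def mult.commute)
      finally have "exp 1 + side_pow k0 \<alpha> \<le> exp 1 * 1 + 2 powr \<alpha> * K0 powr q * Y powr r" by simp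
      also have "\<dots> \<le> exp 1 * Y powr r + 2 powr \<alpha> * K0 powr q * Y powr r"
        using Y r by (intro add_right_mono mult_left_mono ge_one_powr_ge_zero) auto
      also have "\<dots> = (exp 1 + 2 powr \<alpha> * K0 powr q) * Y powr r" by (simp add: algebra_simps)
      finally have "ln (exp 1 + side_pow k0 \<alpha>) \<le> ln ((exp 1 + 2 powr \<alpha> * K0 powr q) * Y powr r)"
        using K0 Y by (subst ln_le_cancel_iff) (auto intro!: add_pos_pos mult_pos_pos)
      also have "\<dots> = ln (exp 1 + 2 powr \<alpha> * K0 powr q) * 1 + r * ln Y"
        using K0 Y by (subst ln_mult_pos) (auto simp: ln_powr intro!: add_pos_pos mult_pos_pos)
      also have "\<dots> \<le> ln (exp 1 + 2 powr \<alpha> * K0 powr q) * ln Y + r * ln Y"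
        using lnY ln_e_add_ge_1[of "2 powr \<alpha> * K0 powr q"] by (intro add_right_mono mult_left_mono) auto
      also have "\<dots> = (ln (exp 1 + 2 powr \<alpha> * K0 powr q) + r) * ln Y" by (simp add: algebra_simps)
      finally have "C * ln (exp 1 + side_pow k0 \<alpha>) \<le> C * ((ln (exp 1 + 2 powr \<alpha> * K0 powr q) + r) * ln Y)"
        using C by (intro mult_left_mono) auto
      also have "\<dots> = C * (ln (exp 1 + 2 powr \<alpha> * K0 powr q) + r) * ln Y" by simp
      also have "\<dots> \<le> K0 * ln Y" using lnY by (intro mult_right_mono K0') auto
      finally show ?thesis .
    qed
    then have "I * (C * ln (exp 1 + side_pow k0 \<alpha>)) \<le> I * (K0 * ln Y)" using I by (intro mult_left_mono) auto
    also have "\<dots> = \<delta> powr (\<beta> - \<alpha>)" unfolding dp using \<alpha> K0 I lnY by (simp add: U_def mult_ac abs_mult)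
    also have "\<dots> \<le> side_pow k0 (\<beta> - \<alpha>)" unfolding pw using k \<delta> \<alpha> by (intro powr_mono2) auto
    finally have "C * I * ln (exp 1 + side_pow k0 \<alpha>) \<le> side_pow k0 (\<beta> - \<alpha>)" by (simp add: mult_ac)
    moreover have "side_pow k0 \<beta> \<le> K * Psi \<alpha> \<beta> I"
      using up[of \<beta>] \<alpha> K0 U by (simp add: K_def Psi_def U_def Y_def powr_mult mult.assoc)
    ultimately show ?thesis by blast
  qed
  moreover have "0 < K" using K0 by (simp add: K_def)
  ultimately show ?thesis by blast
qed

text \<open>Admitting any v > 0 above the seminorm and any I above the Choquet integral leaves room
  to treat a vanishing seminorm, and the exact value of the integral, by approximation.\<close>

lemma commutator_weak_type:
  fixes \<alpha> \<beta> :: real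
  assumes \<beta>: "0 < \<beta>" "\<beta> \<le> real DIM('a)" and \<alpha>: "0 < \<alpha>" "\<alpha> < \<beta>" "real DIM('a) - \<alpha> < \<beta>"
  shows "\<exists>C>0. \<forall>(b::'a::euclidean_space \<Rightarrow> real) f t v I. b \<in> borel_measurable lebesgue \<longrightarrow> f \<in> borel_measurable lebesgue \<longrightarrow>
     0 < v \<longrightarrow> bmo_norm \<beta> b \<le> ennreal v \<longrightarrow> 0 < t \<longrightarrow> choquet \<beta> UNIV (\<lambda>x. Bfun (v * \<bar>f x\<bar> / t)) < ennreal I \<longrightarrow>
     hcontent \<beta> {x. t < \<bar>commutator b \<alpha> f x\<bar>} \<le> ennreal (C * Psi \<alpha> \<beta> I)"
proof -
  obtain A where A: "0 < A" and osc: "\<And>(b::'a \<Rightarrow> real) v. 0 < v \<Longrightarrow> bmo_norm \<beta> b \<le> ennreal v \<Longrightarrow> \<exists>c. oscillation_bound \<beta> (A * v) b c"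
    using bmo_oscillation_bound[OF \<beta>(1)] by blast
  obtain C0 where C0': "0 < C0 \<and> (\<exists>C1>0. \<forall>(b::'a \<Rightarrow> real) c f \<C> N k0. b \<in> borel_measurable lebesgue \<longrightarrow> f \<in> borel_measurable lebesgue \<longrightarrow>
     oscillation_bound \<beta> A b c \<longrightarrow> level_cover \<beta> (\<lambda>y. Bfun \<bar>f y\<bar>) \<C> N \<longrightarrow> 0 \<le> N \<longrightarrow>
     N * ln (exp 1 + side_pow k0 \<alpha>) \<le> side_pow k0 (\<beta> - \<alpha>) \<longrightarrow>
     (\<exists>X. dcontent \<beta> X \<le> ennreal (C1 * side_pow k0 \<beta>) \<and> (\<forall>x. x \<notin> X \<longrightarrow> \<bar>commutator b \<alpha> f x\<bar> \<le> C0)))"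
    using commutator_dyadic_bound[OF \<beta> \<alpha> A] by (elim exE) (rule that)
  have C0: "0 < C0" by (rule conjunct1[OF C0'])
  obtain C1 where C1': "0 < C1 \<and> (\<forall>(b::'a \<Rightarrow> real) c f \<C> N k0. b \<in> borel_measurable lebesgue \<longrightarrow> f \<in> borel_measurable lebesgue \<longrightarrow>
     oscillation_bound \<beta> A b c \<longrightarrow> level_cover \<beta> (\<lambda>y. Bfun \<bar>f y\<bar>) \<C> N \<longrightarrow> 0 \<le> N \<longrightarrow>
     N * ln (exp 1 + side_pow k0 \<alpha>) \<le> side_pow k0 (\<beta> - \<alpha>) \<longrightarrow>
     (\<exists>X. dcontent \<beta> X \<le> ennreal (C1 * side_pow k0 \<beta>) \<and> (\<forall>x. x \<notin> X \<longrightarrow> \<bar>commutator b \<alpha> f x\<bar> \<le> C0)))"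
    using conjunct2[OF C0'] by (elim exE) (rule that)
  have C1: "0 < C1" by (rule conjunct1[OF C1'])
  obtain Cc where Cc: "0 < Cc" and lc: "\<And>(h::'a \<Rightarrow> real) I. choquet \<beta> UNIV h < ennreal I \<Longrightarrow> \<exists>\<C>. level_cover \<beta> h \<C> (Cc * I)"
    using level_cover_exists[OF \<beta>(1)] by blast
  obtain Ch where Ch: "0 < Ch" "\<And>E::'a set. hcontent \<beta> E \<le> ennreal Ch * dcontent \<beta> E"
    using hcontent_le_dcontent[OF \<beta>(1)] by auto
  \<comment> \<open>The height \<open>C0\<close> of the normalised estimate is moved into f, which
    multiplies B by at most 2 B(C0); 2^d is a power of two above this factor.\<close>
  obtain m :: nat where "2 * Bfun C0 < 2 ^ m" using real_arch_pow[of 2 "2 * Bfun C0"] by auto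
  define d where "d = int m"
  have d: "2 * Bfun C0 \<le> 2 powr real_of_int d" using \<open>2 * Bfun C0 < 2 ^ m\<close> by (simp add: d_def powr_realpow)
  define C' where "C' = 2 powr real_of_int d * Cc"
  have C': "0 < C'" using Cc by (simp add: C'_def)
  obtain K where K: "0 < K" and sc: "\<And>I. 0 < I \<Longrightarrow> \<exists>k0::int. C' * I * ln (exp 1 + side_pow k0 \<alpha>) \<le> side_pow k0 (\<beta> - \<alpha>) \<and>
    side_pow k0 \<beta> \<le> K * Psi \<alpha> \<beta> I"
    using dyadic_scale_choice[OF \<alpha>(1,2) C'] by blast
  have main: "hcontent \<beta> {x. t < \<bar>commutator b \<alpha> f x\<bar>} \<le> ennreal (Ch * C1 * K * Psi \<alpha> \<beta> I)"
    if bm: "b \<in> borel_measurable lebesgue" and fm: "f \<in> borel_measurable lebesgue" and v: "0 < v" and bv: "bmo_norm \<beta> b \<le> ennreal v"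
      and t: "0 < t" and I: "choquet \<beta> UNIV (\<lambda>x. Bfun (v * \<bar>f x\<bar> / t)) < ennreal I" for b f :: "'a \<Rightarrow> real" and t v I
  proof -
    have Ipos: "0 < I" using I by (metis ennreal_neg not_gr_zero not_le not_less_zero)
    obtain c where c: "oscillation_bound \<beta> (A * v) b c" using osc[OF v bv] by blast
    \<comment> \<open>Dividing b by v reduces the oscillation constant to \<open>A\<close>, and the
      factor on f turns the level t of the commutator into \<open>C0\<close>.\<close>
    define b' where "b' y = 1 / v * b y" for y
    define f' where "f' y = C0 * v / t * f y" for y
    have oc: "oscillation_bound \<beta> A b' (\<lambda>p. c p / v)"
      using oscillation_bound_scale[OF v c] by (simp add: b'_def[abs_def])
    have b'm: "b' \<in> borel_measurable lebesgue" unfolding b'_def[abs_def] using bm by measurable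
    have f'm: "f' \<in> borel_measurable lebesgue" unfolding f'_def[abs_def] using fm by measurable
    obtain \<C> where cov: "level_cover \<beta> (\<lambda>x. Bfun (v * \<bar>f x\<bar> / t)) \<C> (Cc * I)" using lc[OF I] by blast
    have "level_cover \<beta> (\<lambda>y. Bfun \<bar>f' y\<bar>) (\<lambda>j. \<C> (j - d)) (2 powr real_of_int d * (Cc * I))"
    proof (rule level_cover_scale[OF cov])
      fix y
      have "Bfun \<bar>f' y\<bar> = Bfun (C0 * (v * \<bar>f y\<bar> / t))" using C0 v t by (simp add: f'_def abs_mult mult.assoc)
      also have "\<dots> \<le> 2 * Bfun C0 * Bfun (v * \<bar>f y\<bar> / t)" using C0 v t by (intro Bfun_mult) auto
      also have "\<dots> \<le> 2 powr real_of_int d * Bfun (v * \<bar>f y\<bar> / t)"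
        using d v t by (intro mult_right_mono Bfun_nonneg) auto
      finally show "Bfun \<bar>f' y\<bar> \<le> 2 powr real_of_int d * Bfun (v * \<bar>f y\<bar> / t)" .
    qed (use Cc Ipos in simp)
    then have cov': "level_cover \<beta> (\<lambda>y. Bfun \<bar>f' y\<bar>) (\<lambda>j. \<C> (j - d)) (C' * I)" by (simp add: C'_def mult.assoc)
    obtain k0 :: int where k0: "C' * I * ln (exp 1 + side_pow k0 \<alpha>) \<le> side_pow k0 (\<beta> - \<alpha>)"
      and k0': "side_pow k0 \<beta> \<le> K * Psi \<alpha> \<beta> I" using sc[OF Ipos] by blast
    have N0: "0 \<le> C' * I" using C' Ipos by simp
    obtain X where X: "dcontent \<beta> X \<le> ennreal (C1 * side_pow k0 \<beta>)" and off: "\<And>x. x \<notin> X \<Longrightarrow> \<bar>commutator b' \<alpha> f' x\<bar> \<le> C0"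
      using conjunct2[OF C1', THEN spec, THEN spec, THEN spec, THEN spec, THEN spec, THEN spec,
          THEN mp, THEN mp, THEN mp, THEN mp, THEN mp, THEN mp, OF b'm f'm oc cov' N0 k0] by blast
    have "{x. t < \<bar>commutator b \<alpha> f x\<bar>} \<subseteq> X"
    proof
      fix x assume "x \<in> {x. t < \<bar>commutator b \<alpha> f x\<bar>}"
      then have x: "t < \<bar>commutator b \<alpha> f x\<bar>" by simp
      have "commutator b' \<alpha> f' x = C0 / t * commutator b \<alpha> f x"
        unfolding b'_def[abs_def] f'_def[abs_def] commutator_scale using v by simp
      then have "\<bar>commutator b' \<alpha> f' x\<bar> = C0 / t * \<bar>commutator b \<alpha> f x\<bar>" using C0 t by (simp add: abs_mult)
      moreover have "C0 / t * t < C0 / t * \<bar>commutator b \<alpha> f x\<bar>" using C0 t x by (intro mult_strict_left_mono) auto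
      ultimately have "C0 < \<bar>commutator b' \<alpha> f' x\<bar>" using t by simp
      then show "x \<in> X" using off[of x] by linarith
    qed
    then have "dcontent \<beta> {x. t < \<bar>commutator b \<alpha> f x\<bar>} \<le> dcontent \<beta> X" by (rule dcontent_mono)
    also have "\<dots> \<le> ennreal (C1 * (K * Psi \<alpha> \<beta> I))"
      using C1 k0' by (intro order_trans[OF X] ennreal_leI mult_left_mono) auto
    finally have "ennreal Ch * dcontent \<beta> {x. t < \<bar>commutator b \<alpha> f x\<bar>} \<le> ennreal Ch * ennreal (C1 * (K * Psi \<alpha> \<beta> I))"
      by (rule mult_left_mono) simp
    also have "\<dots> = ennreal (Ch * C1 * K * Psi \<alpha> \<beta> I)"
      using Ch C1 K by (subst ennreal_mult[symmetric]) (auto simp: Psi_def mult.assoc)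
    finally show ?thesis using Ch(2) order_trans by blast
  qed
  have CC: "0 < Ch * C1 * K" using Ch C1 K by simp
  show ?thesis
    by (rule exI[of _ "Ch * C1 * K"], rule conjI[OF CC], (rule allI)+, (rule impI)+, rule main; assumption)
qed

section \<open>Vanishing seminorm and passage to the limit\<close>

lemma hcontent_bounded_finite:
  fixes E :: "'a::euclidean_space set"
  assumes \<beta>: "0 < \<beta>" and E: "bounded E" shows "hcontent \<beta> E < \<infinity>"
proof -
  obtain C where C: "\<And>E::'a set. hcontent \<beta> E \<le> ennreal C * dcontent \<beta> E"
    using hcontent_le_dcontent[OF \<beta>] by auto
  obtain R where R: "E \<subseteq> ball 0 R" using bounded_subset_ballD[OF E] by blast
  obtain k :: nat where "R < 2 ^ k" using real_arch_pow[of 2 R] by auto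
  then have "R \<le> 2 powr real_of_int (int k)" by (simp add: powr_realpow)
  then have "E \<subseteq> enlarged (int k, dyadic_cube (int k) 0)"
    using R ball_subset_dyadic_nbhd[of 0 "int k"] subset_ball[of R _ 0] unfolding enlarged_cube by (meson order_trans)
  then have "dcontent \<beta> E \<le> dcontent \<beta> (enlarged (int k, dyadic_cube (int k) (0::'a)))" by (rule dcontent_mono)
  also have "\<dots> \<le> ennreal (3 ^ DIM('a)) * dyadic_weight \<beta> (int k, dyadic_cube (int k) (0::'a))"
    by (rule dcontent_enlarged) simp
  also have "\<dots> < \<infinity>" by (simp add: dyadic_weight_def ennreal_mult_less_top)
  finally have "ennreal C * dcontent \<beta> E < \<infinity>" by (simp add: ennreal_mult_less_top)
  with C[of E] show ?thesis by (rule le_less_trans)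
qed

text \<open>Serves the case of a vanishing seminorm: on a support of finite content, a uniformly
  small function has a small Choquet integral.\<close>

lemma choquet_bounded_support_le:
  assumes g: "\<And>x. g x \<le> G" and supp: "\<And>x. x \<notin> E \<Longrightarrow> g x \<le> 0" and G: "0 \<le> G"
  shows "choquet \<beta> UNIV g \<le> ennreal G * hcontent \<beta> E"
proof -
  have "choquet \<beta> UNIV g \<le> (\<integral>\<^sup>+s. hcontent \<beta> E * indicator {0<..G} s \<partial>lborel)"
    unfolding choquet_def
  proof (rule nn_integral_mono)
    fix s
    have e: "hcontent \<beta> ({} :: 'a set) = 0"
    proof -
      have "hcontent \<beta> ({} :: 'a set) \<le> (\<Sum>i. ennreal (omega \<beta> * 0 powr \<beta>))"
        unfolding hcontent_def by (intro INF_lower2[of "(\<lambda>_. 0, \<lambda>_. 0)"]) auto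
      then show ?thesis by simp
    qed
    show "indicator {0<..} s * hcontent \<beta> {x \<in> UNIV. s < g x} \<le> hcontent \<beta> E * indicator {0<..G} s"
    proof (cases "0 < s")
      case s: True
      show ?thesis
      proof (cases "s \<le> G")
        case True
        have "x \<in> E" if "s < g x" for x using supp[of x] s that by (cases "x \<in> E") auto
        then have "{x \<in> UNIV. s < g x} \<subseteq> E" by auto
        then have "hcontent \<beta> {x \<in> UNIV. s < g x} \<le> hcontent \<beta> E"
          unfolding hcontent_def by (intro INF_superset_mono) auto
        then show ?thesis using True s by simp
      next
        case False
        then have "{x \<in> UNIV. s < g x} = {}" using g by (force simp: not_less intro: order_trans)
        then show ?thesis by (simp add: e)
      qed
    qed simp
  qed
  also have "\<dots> = hcontent \<beta> E * ennreal G" using G by (subst nn_integral_cmult_indicator) auto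
  finally show ?thesis by (simp add: mult.commute)
qed

text \<open>The limit is taken as I decreases to the Choquet integral. At j = 0 the powers are still
  continuous from the right because the exponents \<alpha>/\<beta> and \<beta>/(\<beta>-\<alpha>)
  are positive.\<close>

lemma Psi_tendsto_right:
  assumes "0 < \<alpha>" "\<alpha> < \<beta>" "0 \<le> j"
  shows "(Psi \<alpha> \<beta> \<longlongrightarrow> Psi \<alpha> \<beta> j) (at_right j)"
proof -
  have ev: "\<forall>\<^sub>F x in at_right j. 0 \<le> x"
    using assms(3) by (auto simp: eventually_at_right_field intro!: exI[of _ "j + 1"])
  have id: "((\<lambda>t. t) \<longlongrightarrow> j) (at_right j)" by (rule tendsto_ident_at)
  have p: "((\<lambda>t. t powr (\<alpha> / \<beta>)) \<longlongrightarrow> j powr (\<alpha> / \<beta>)) (at_right j)"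
    using assms ev by (intro tendsto_powr'[OF id tendsto_const]) auto
  have l: "((\<lambda>t. ln (exp 1 + t powr (\<alpha> / \<beta>))) \<longlongrightarrow> ln (exp 1 + j powr (\<alpha> / \<beta>))) (at_right j)"
  proof (intro tendsto_ln tendsto_add tendsto_const p)
    have "0 < exp 1 + j powr (\<alpha> / \<beta>)" by (intro add_pos_nonneg) auto
    then show "exp 1 + j powr (\<alpha> / \<beta>) \<noteq> 0" by simp
  qed
  have nn: "\<forall>\<^sub>F t in at_right j. 0 \<le> t * ln (exp 1 + t powr (\<alpha> / \<beta>))"
    using ev
  proof eventually_elim
    case (elim t)
    then show ?case using ln_e_add_ge_1[of "t powr (\<alpha> / \<beta>)"] by simp
  qed
  show ?thesis
    unfolding Psi_def[abs_def]
    using assms nn by (intro tendsto_powr'[OF tendsto_mult[OF id l] tendsto_const]) auto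
qed

theorem theorem1p5:
  fixes \<alpha> \<beta> :: real
  assumes "0 < \<beta>" "\<beta> \<le> real DIM('a::euclidean_space)"
    and "0 < \<alpha>" "\<alpha> < \<beta>"
    and "real DIM('a) - \<alpha> < \<beta>"
  shows "\<exists>C>0. \<forall>(b::'a \<Rightarrow> real) (f::'a \<Rightarrow> real) (t::real).
     b \<in> borel_measurable lebesgue \<and> bmo_norm \<beta> b < \<infinity> \<and>
     f \<in> borel_measurable lebesgue \<and> bounded (range f) \<and> compact (closure {x. f x \<noteq> 0}) \<and>
     0 < t \<longrightarrow>
     hcontent \<beta> {x. \<bar>commutator b \<alpha> f x\<bar> > t}
       \<le> ennreal C * Psi_e \<alpha> \<beta>
            (choquet \<beta> UNIV (\<lambda>x. Bfun (enn2real (bmo_norm \<beta> b) * \<bar>f x\<bar> / t)))"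
proof -
  obtain C where C: "0 < C" and weak: "\<And>(b::'a \<Rightarrow> real) f t v I. b \<in> borel_measurable lebesgue \<Longrightarrow> f \<in> borel_measurable lebesgue \<Longrightarrow>
     0 < v \<Longrightarrow> bmo_norm \<beta> b \<le> ennreal v \<Longrightarrow> 0 < t \<Longrightarrow> choquet \<beta> UNIV (\<lambda>x. Bfun (v * \<bar>f x\<bar> / t)) < ennreal I \<Longrightarrow>
     hcontent \<beta> {x. t < \<bar>commutator b \<alpha> f x\<bar>} \<le> ennreal (C * Psi \<alpha> \<beta> I)"
    using commutator_weak_type[OF assms] by blast
  have "hcontent \<beta> {x. t < \<bar>commutator b \<alpha> f x\<bar>} \<le> ennreal C * Psi_e \<alpha> \<beta> (choquet \<beta> UNIV (\<lambda>x. Bfun (enn2real (bmo_norm \<beta> b) * \<bar>f x\<bar> / t)))"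
    if bm: "b \<in> borel_measurable lebesgue" and bfin: "bmo_norm \<beta> b < \<infinity>" and fm: "f \<in> borel_measurable lebesgue"
      and fb: "bounded (range f)" and fc: "compact (closure {x. f x \<noteq> 0})" and t: "0 < t" for b f :: "'a \<Rightarrow> real" and t
  proof -
    define v0 where "v0 = enn2real (bmo_norm \<beta> b)"
    define J where "J = choquet \<beta> UNIV (\<lambda>x. Bfun (v0 * \<bar>f x\<bar> / t))"
    have bv0: "bmo_norm \<beta> b = ennreal v0" using bfin by (simp add: v0_def)
    show ?thesis
    proof (cases "J = \<infinity>")
      case True
      then show ?thesis using C unfolding J_def v0_def by (simp add: Psi_e_def ennreal_mult_top)
    next
      case False
      define j where "j = enn2real J"
      have j: "0 \<le> j" "J = ennreal j" using False by (auto simp: j_def less_top)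
      \<comment> \<open>The weak type estimate asks for a strict upper bound of the Choquet
        integral, so it is obtained for every I > j, and I tends to j afterwards.\<close>
      have le: "hcontent \<beta> {x. t < \<bar>commutator b \<alpha> f x\<bar>} \<le> ennreal (C * Psi \<alpha> \<beta> I)" if I: "j < I" for I
      proof (cases "v0 = 0")
        case False
        then have v0: "0 < v0" by (simp add: v0_def less_le)
        have "choquet \<beta> UNIV (\<lambda>x. Bfun (v0 * \<bar>f x\<bar> / t)) < ennreal I"
          using I j unfolding J_def by (simp add: ennreal_lessI)
        then show ?thesis using bv0 by (intro weak[OF bm fm v0 _ t]) auto
      next
        \<comment> \<open>The seminorm vanishes but the estimate asks for v > 0. Since f is bounded
          and its support has finite content, a small positive v keeps the Choquet integral of B(v
          |f| / t) below I.\<close>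
        case True
        have Ipos: "0 < I" using I j by simp
        obtain M where M: "0 < M" "\<And>x. \<bar>f x\<bar> \<le> M" using fb unfolding bounded_pos by auto
        define E where "E = {x. f x \<noteq> 0}"
        have "bounded E" using compact_imp_bounded[OF fc] bounded_subset closure_subset unfolding E_def by blast
        then have Efin: "hcontent \<beta> E < \<infinity>" by (rule hcontent_bounded_finite[OF assms(1)])
        define H where "H = enn2real (hcontent \<beta> E)"
        have H: "0 \<le> H" "hcontent \<beta> E = ennreal H" using Efin by (auto simp: H_def)
        \<comment> \<open>For w \<le> 1 one has B(w) \<le> 2 w, so the Choquet integral is at most 2
          w H \<le> I H / (H + 1) < I. Taking H + 1 keeps the quotient meaningful when H =
          0.\<close>
        define w where "w = min 1 (I / (2 * (H + 1)))"
        have w: "0 < w" "w \<le> 1" "w \<le> I / (2 * (H + 1))" using Ipos H by (auto simp: w_def)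
        define v where "v = w * t / M"
        have v: "0 < v" using w t M by (simp add: v_def)
        have "choquet \<beta> UNIV (\<lambda>x. Bfun (v * \<bar>f x\<bar> / t)) \<le> ennreal (2 * w) * hcontent \<beta> E"
        proof (rule choquet_bounded_support_le)
          fix x
          have "v * \<bar>f x\<bar> / t = w * (\<bar>f x\<bar> / M)" using t by (simp add: v_def)
          also have "\<dots> \<le> w * 1" using M w by (intro mult_left_mono) (auto simp: divide_le_eq)
          finally have "Bfun (v * \<bar>f x\<bar> / t) \<le> Bfun w" using v t by (intro Bfun_mono) auto
          also have "\<dots> \<le> w * 2"
          proof -
            have "exp 1 + w \<le> exp 1 * (exp 1 :: real)"
            proof -
              have "exp 1 * 2 \<le> exp 1 * (exp 1 :: real)" using exp_ge_add_one_self[of "1::real"] by (intro mult_left_mono) auto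
              moreover have "(1::real) \<le> exp 1" by simp
              ultimately show ?thesis using w by linarith
            qed
            then have "ln (exp 1 + w) \<le> ln (exp 1 * exp 1)" using w by (subst ln_le_cancel_iff) (auto simp: add_pos_pos)
            also have "\<dots> = 2" by (simp add: ln_mult_pos)
            finally show ?thesis unfolding Bfun_def using w by (intro mult_left_mono) auto
          qed
          finally show "Bfun (v * \<bar>f x\<bar> / t) \<le> 2 * w" by simp
          show "x \<notin> E \<Longrightarrow> Bfun (v * \<bar>f x\<bar> / t) \<le> 0" by (simp add: E_def Bfun_def)
        qed (use w in simp)
        also have "\<dots> = ennreal (2 * w * H)" using w H by (simp add: ennreal_mult)
        also have "\<dots> < ennreal I"
        proof (rule ennreal_lessI[OF Ipos])
          have "2 * w * H \<le> 2 * (I / (2 * (H + 1))) * H" using w H by (intro mult_right_mono mult_left_mono) auto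
          also have "\<dots> = I * (H / (H + 1))" using H by (simp add: field_simps)
          also have "\<dots> < I * 1" using H Ipos by (intro mult_strict_left_mono) auto
          finally show "2 * w * H < I" by simp
        qed
        finally show ?thesis using bv0 True v by (intro weak[OF bm fm v _ t]) auto
      qed
      have "((\<lambda>I. ennreal (C * Psi \<alpha> \<beta> I)) \<longlongrightarrow> ennreal (C * Psi \<alpha> \<beta> j)) (at_right j)"
        by (intro tendsto_ennrealI tendsto_mult tendsto_const Psi_tendsto_right assms j)
      moreover have "\<forall>\<^sub>F I in at_right j. hcontent \<beta> {x. t < \<bar>commutator b \<alpha> f x\<bar>} \<le> ennreal (C * Psi \<alpha> \<beta> I)"
        using le by (auto simp: eventually_at_right_field intro!: exI[of _ "j + 1"])
      ultimately have "hcontent \<beta> {x. t < \<bar>commutator b \<alpha> f x\<bar>} \<le> ennreal (C * Psi \<alpha> \<beta> j)"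
        by (rule tendsto_lowerbound) simp
      also have "\<dots> = ennreal C * Psi_e \<alpha> \<beta> J"
        using C False unfolding Psi_e_def by (simp add: j_def ennreal_mult Psi_def)
      finally show ?thesis unfolding J_def v0_def .
    qed
  qed
  with C show ?thesis by blast
qed

end
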